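(* Let $E$ be a finite-dimensional real normed space of dimension $n$, let $\Omega\subset E$ be a domain, let $M$ be $\Omega$ endowed with its intrinsic distance $d$, with base point $x_0\in\Omega$, and let $T:\mathrm{Lip}_0(M)\to L^\infty(\Omega;E^* )$ be the gradient operator $Tf:=\nabla f$. Then: (i) The range of $T$ is $$Y:=\{g\in L^\infty(\Omega;E^* ): \text{for every } k\in\mathbb{N},\ g*u_k:\Omega_k\to\mathbb{R}^n \text{ is conservative}\}.$$ (ii) The inverse operator $T^{-1}:Y\to\mathrm{Lip}_0(M)$ is given by $$T^{-1}g(x)=\lim_{k\to\infty}\int_0^1 (g*u_k)(\gamma(t))\cdot\gamma'(t)\,dt,$$ where for each $x\in M$, $\gamma:[0,1]\to\Omega$ is any Lipschitz path going from the base point $x_0$ to $x$ (the choice of $\gamma$ being irrelevant). In particular, $T:\mathrm{Lip}_0(M)\to Y$ is an isometric isomorphism.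
   Context: $E$ is a real normed space of finite dimension $n$ with norm $\|\cdot\|$, identified with $\mathbb{R}^n$ through a basis; $\|\cdot\|_*$ is the dual norm on $E^*$ (also identified with $\mathbb{R}^n$ as coordinates). A domain in $E$ is a non-empty connected open subset. The intrinsic distance $d(x,y)$ on $\Omega$ is the infimum of the lengths (with respect to $\|\cdot\|$) of rectifiable continuous paths $[0,1]\to\Omega$ going from $x$ to $y$; $M=(\Omega,d)$. $\mathrm{Lip}_0(M)$ is the Banach space of Lipschitz functions $f:M\to\mathbb{R}$ with $f(x_0)=0$, with norm $\|f\|_{\mathrm{Lip}}=\sup_{x\ne y}|f(x)-f(y)|/d(x,y)$. $L^\infty(\Omega;E^* )$ carries the norm $\|g\|_\infty=\operatorname{ess\,sup}_{z\in\Omega}\|g(z)\|_*$. Functions in $\mathrm{Lip}_0(M)$ are locally Lipschitz on $\Omega$ for the norm, so $\nabla f$ exists a.e. by Rademacher's theorem and coincides with the distributional gradient. For $k\in\mathbb{N}$, $k\ge1$, $\Omega_k=\{x\in\Omega:\operatorname{dist}(x,\Omega^c)>1/k\}$ (with the usual convention $\operatorname{dist}(x,\emptyset)=+\infty$). A positive (nonnegative) mollifier $u:\mathbb{R}^n\to\mathbb{R}$ is fixed, i.e. a nonnegative $\mathcal{C}^\infty$ function supported in the closed unit ball with $\int u=1$, and $u_k(x):=k^n u(kx)$; distances and balls are taken with respect to $\|\cdot\|$. The convolution $(g*u_k)(x)=\int_\Omega g(y)u_k(x-y)\,dy$ is considered for $x\in\Omega_k$. A continuous vector field $H:U\to\mathbb{R}^n$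 on an open set $U\subset\mathbb{R}^n$ is conservative if there is a function $h:U\to\mathbb{R}$ with $H=\nabla h$ on $U$. In (ii), for a given path $\gamma$ the integral is defined for all $k$ large enough that $\gamma([0,1])\subset\Omega_k$. *)

theory Defs
  imports "HOL-Probability.Essential_Supremum"
begin

text \<open>
  The space \<open>E\<close> is \<open>real ^ 'n\<close> carrying an arbitrary norm \<open>N\<close>, which is unrelated to the
  Euclidean norm of that type.  Topology and differentiability do not depend on the
  choice of norm, so the notions of the library are used for them; every metric quantity
  (distances, lengths, supports, dual norm) refers to \<open>N\<close>.  A covector with coordinates
  \<open>\<xi>\<close> acts by \<open>v \<mapsto> \<xi> \<bullet> v\<close>, so that the gradient \<^term>\<open>GDERIV f x :> \<xi>\<close> is the coordinate
  vector of the differential.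
\<close>

definition is_norm :: "(real ^ 'n \<Rightarrow> real) \<Rightarrow> bool" where
  "is_norm N \<longleftrightarrow>
     (\<forall>x. N x = 0 \<longleftrightarrow> x = 0) \<and>
     (\<forall>c x. N (c *\<^sub>R x) = \<bar>c\<bar> * N x) \<and>
     (\<forall>x y. N (x + y) \<le> N x + N y)"

definition dual_norm :: "(real ^ 'n \<Rightarrow> real) \<Rightarrow> real ^ 'n \<Rightarrow> real" where
  "dual_norm N \<xi> = (SUP v\<in>{v. N v \<le> 1}. \<bar>\<xi> \<bullet> v\<bar>)"

definition is_domain :: "(real ^ 'n) set \<Rightarrow> bool" where
  "is_domain \<Omega> \<longleftrightarrow> open \<Omega> \<and> connected \<Omega> \<and> \<Omega> \<noteq> {}"

definition curve_length :: "(real ^ 'n \<Rightarrow> real) \<Rightarrow> (real \<Rightarrow> real ^ 'n) \<Rightarrow> ereal" where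
  "curve_length N \<gamma> =
     Sup {ereal (\<Sum>i<m. N (\<gamma> (t (Suc i)) - \<gamma> (t i))) | (m :: nat) (t :: nat \<Rightarrow> real).
            t 0 = 0 \<and> t m = 1 \<and> (\<forall>i<m. t i \<le> t (Suc i))}"

definition intrinsic_dist ::
    "(real ^ 'n \<Rightarrow> real) \<Rightarrow> (real ^ 'n) set \<Rightarrow> real ^ 'n \<Rightarrow> real ^ 'n \<Rightarrow> real" where
  "intrinsic_dist N \<Omega> x y =
     Inf {l :: real. \<exists>\<gamma>. path \<gamma> \<and> path_image \<gamma> \<subseteq> \<Omega> \<and> pathstart \<gamma> = x \<and> pathfinish \<gamma> = y \<and>
                          curve_length N \<gamma> = ereal l}"

text \<open>
  A function on \<open>\<Omega>\<close> is represented by its extension by \<open>0\<close> to the whole type.  This makes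
  the representation unique and compatible with the pointwise vector space operations.
\<close>

definition Lip0 ::
    "(real ^ 'n \<Rightarrow> real) \<Rightarrow> (real ^ 'n) set \<Rightarrow> real ^ 'n \<Rightarrow> (real ^ 'n \<Rightarrow> real) set" where
  "Lip0 N \<Omega> x0 =
     {f. (\<forall>x. x \<notin> \<Omega> \<longrightarrow> f x = 0) \<and> f x0 = 0 \<and>
         (\<exists>L. \<forall>x\<in>\<Omega>. \<forall>y\<in>\<Omega>. \<bar>f x - f y\<bar> \<le> L * intrinsic_dist N \<Omega> x y)}"

definition Lip_norm ::
    "(real ^ 'n \<Rightarrow> real) \<Rightarrow> (real ^ 'n) set \<Rightarrow> (real ^ 'n \<Rightarrow> real) \<Rightarrow> real" where
  "Lip_norm N \<Omega> f =
     Sup {\<bar>f x - f y\<bar> / intrinsic_dist N \<Omega> x y | x y. x \<in> \<Omega> \<and> y \<in> \<Omega> \<and> x \<noteq> y}"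

text \<open>
  \<open>Linf_fun\<close> consists of functions; the elements of \<open>Linf\<close> are their equivalence classes
  modulo equality almost everywhere in \<open>\<Omega>\<close>.  The vector space operations and the norm of
  \<open>Linf\<close> are those induced from representatives.
\<close>

definition ess_norm ::
    "(real ^ 'n \<Rightarrow> real) \<Rightarrow> (real ^ 'n) set \<Rightarrow> (real ^ 'n \<Rightarrow> real ^ 'n) \<Rightarrow> ereal" where
  "ess_norm N \<Omega> g = esssup (lebesgue_on \<Omega>) (\<lambda>z. ereal (dual_norm N (g z)))"

definition Linf_fun ::
    "(real ^ 'n \<Rightarrow> real) \<Rightarrow> (real ^ 'n) set \<Rightarrow> (real ^ 'n \<Rightarrow> real ^ 'n) set" where
  "Linf_fun N \<Omega> = {g \<in> borel_measurable (lebesgue_on \<Omega>). ess_norm N \<Omega> g < \<infinity>}"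

definition ae_equal ::
    "(real ^ 'n \<Rightarrow> real) \<Rightarrow> (real ^ 'n) set \<Rightarrow> ((real ^ 'n \<Rightarrow> real ^ 'n) \<times> (real ^ 'n \<Rightarrow> real ^ 'n)) set"
    where
  "ae_equal N \<Omega> =
     {(g, h). g \<in> Linf_fun N \<Omega> \<and> h \<in> Linf_fun N \<Omega> \<and> (AE z in lebesgue_on \<Omega>. g z = h z)}"

definition Linf ::
    "(real ^ 'n \<Rightarrow> real) \<Rightarrow> (real ^ 'n) set \<Rightarrow> (real ^ 'n \<Rightarrow> real ^ 'n) set set" where
  "Linf N \<Omega> = Linf_fun N \<Omega> // ae_equal N \<Omega>"

definition Linf_add ::
    "(real ^ 'n \<Rightarrow> real) \<Rightarrow> (real ^ 'n) set \<Rightarrow>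
     (real ^ 'n \<Rightarrow> real ^ 'n) set \<Rightarrow> (real ^ 'n \<Rightarrow> real ^ 'n) set \<Rightarrow> (real ^ 'n \<Rightarrow> real ^ 'n) set" where
  "Linf_add N \<Omega> G H =
     {w \<in> Linf_fun N \<Omega>. \<exists>g\<in>G. \<exists>h\<in>H. AE z in lebesgue_on \<Omega>. w z = g z + h z}"

definition Linf_scale ::
    "(real ^ 'n \<Rightarrow> real) \<Rightarrow> (real ^ 'n) set \<Rightarrow>
     real \<Rightarrow> (real ^ 'n \<Rightarrow> real ^ 'n) set \<Rightarrow> (real ^ 'n \<Rightarrow> real ^ 'n) set" where
  "Linf_scale N \<Omega> c G =
     {w \<in> Linf_fun N \<Omega>. \<exists>g\<in>G. AE z in lebesgue_on \<Omega>. w z = c *\<^sub>R g z}"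

definition Linf_norm ::
    "(real ^ 'n \<Rightarrow> real) \<Rightarrow> (real ^ 'n) set \<Rightarrow> (real ^ 'n \<Rightarrow> real ^ 'n) set \<Rightarrow> real" where
  "Linf_norm N \<Omega> G = real_of_ereal (ess_norm N \<Omega> (SOME g. g \<in> G))"

text \<open>
  The class of all essentially bounded fields agreeing almost everywhere with the gradient.
  It would be empty, hence not an element of \<open>Linf\<close>, for a function that fails to be
  differentiable almost everywhere in \<open>\<Omega>\<close>.
\<close>

definition grad_op ::
    "(real ^ 'n \<Rightarrow> real) \<Rightarrow> (real ^ 'n) set \<Rightarrow> (real ^ 'n \<Rightarrow> real) \<Rightarrow> (real ^ 'n \<Rightarrow> real ^ 'n) set" where
  "grad_op N \<Omega> f = {g \<in> Linf_fun N \<Omega>. AE z in lebesgue_on \<Omega>. GDERIV f z :> g z}"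

fun Ck :: "nat \<Rightarrow> (real ^ 'n \<Rightarrow> real) \<Rightarrow> bool" where
  "Ck 0 f \<longleftrightarrow> continuous_on UNIV f"
| "Ck (Suc k) f \<longleftrightarrow> (\<exists>D. (\<forall>x. GDERIV f x :> D x) \<and> (\<forall>i. Ck k (\<lambda>x. D x $ i)))"

definition is_mollifier :: "(real ^ 'n \<Rightarrow> real) \<Rightarrow> (real ^ 'n \<Rightarrow> real) \<Rightarrow> bool" where
  "is_mollifier N u \<longleftrightarrow>
     (\<forall>x. u x \<ge> 0) \<and> (\<forall>k. Ck k u) \<and> closure {x. u x \<noteq> 0} \<subseteq> {x. N x \<le> 1} \<and>
     (LINT x|lebesgue. u x) = 1"

definition dilate :: "(real ^ 'n \<Rightarrow> real) \<Rightarrow> nat \<Rightarrow> real ^ 'n \<Rightarrow> real" where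
  "dilate u k x = real k ^ CARD('n) * u (real k *\<^sub>R x)"

text \<open>The infimum is taken in \<^typ>\<open>ereal\<close>, so the distance to the empty set is \<open>\<infinity>\<close>.\<close>

definition inner_part :: "(real ^ 'n \<Rightarrow> real) \<Rightarrow> (real ^ 'n) set \<Rightarrow> nat \<Rightarrow> (real ^ 'n) set" where
  "inner_part N \<Omega> k = {x \<in> \<Omega>. (INF y\<in>- \<Omega>. ereal (N (x - y))) > ereal (1 / real k)}"

definition convolve ::
    "(real ^ 'n) set \<Rightarrow> (real ^ 'n \<Rightarrow> real ^ 'n) \<Rightarrow> (real ^ 'n \<Rightarrow> real) \<Rightarrow> real ^ 'n \<Rightarrow> real ^ 'n" where
  "convolve \<Omega> g v x = (LINT y|lebesgue_on \<Omega>. v (x - y) *\<^sub>R g y)"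

definition conservative :: "(real ^ 'n) set \<Rightarrow> (real ^ 'n \<Rightarrow> real ^ 'n) \<Rightarrow> bool" where
  "conservative U H \<longleftrightarrow> continuous_on U H \<and> (\<exists>h. \<forall>x\<in>U. GDERIV h x :> H x)"

definition Y_space ::
    "(real ^ 'n \<Rightarrow> real) \<Rightarrow> (real ^ 'n) set \<Rightarrow> (real ^ 'n \<Rightarrow> real) \<Rightarrow> (real ^ 'n \<Rightarrow> real ^ 'n) set set" where
  "Y_space N \<Omega> u =
     {G \<in> Linf N \<Omega>. \<forall>g\<in>G. \<forall>k\<ge>1. conservative (inner_part N \<Omega> k) (convolve \<Omega> g (dilate u k))}"

definition lipschitz_path ::
    "(real ^ 'n \<Rightarrow> real) \<Rightarrow> (real ^ 'n) set \<Rightarrow> real ^ 'n \<Rightarrow> real ^ 'n \<Rightarrow> (real \<Rightarrow> real ^ 'n) \<Rightarrow> bool" where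
  "lipschitz_path N \<Omega> x y \<gamma> \<longleftrightarrow>
     \<gamma> ` {0..1} \<subseteq> \<Omega> \<and> \<gamma> 0 = x \<and> \<gamma> 1 = y \<and>
     (\<exists>L. \<forall>s\<in>{0..1}. \<forall>t\<in>{0..1}. N (\<gamma> s - \<gamma> t) \<le> L * \<bar>s - t\<bar>)"

text \<open>
  The derivative of a Lipschitz path exists for almost every \<open>t\<close>; \<^const>\<open>vector_derivative\<close>
  takes unspecified values on the remaining null set, which do not affect the integral.
\<close>

definition path_integrand ::
    "(real ^ 'n \<Rightarrow> real ^ 'n) \<Rightarrow> (real \<Rightarrow> real ^ 'n) \<Rightarrow> real \<Rightarrow> real" where
  "path_integrand H \<gamma> t = H (\<gamma> t) \<bullet> vector_derivative \<gamma> (at t within {0..1})"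

end

theory Submission
  imports Defs
begin

text \<open>
  Everything rests on one computation: for a function \<open>f\<close> that is Lipschitz along segments,
  \<open>f * u\<^sub>k\<close> is differentiable on \<open>\<Omega>\<^sub>k\<close> with gradient \<open>\<nabla>f * u\<^sub>k\<close> (\<open>GDERIV_mollify\<close>).  It needs
  \<open>\<nabla>f\<close> to exist only almost everywhere, which is Rademacher's theorem.  So \<open>\<nabla>f * u\<^sub>k\<close> is
  conservative with the potential \<open>f * u\<^sub>k\<close>, and since \<open>f * u\<^sub>k \<rightarrow> f\<close> pointwise, \<open>f\<close> is recovered
  from \<open>\<nabla>f\<close> by integrating \<open>\<nabla>f * u\<^sub>k\<close> along paths.  This places the range of the gradient
  operator inside \<open>Y\<close> and gives injectivity and the formula for the inverse.  Averaging does
  not increase the essential supremum of the dual norm, so \<open>f * u\<^sub>k\<close>, and in the limit \<open>f\<close>, is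
  Lipschitz along segments with constant \<open>\<parallel>\<nabla>f\<parallel>\<^sub>\<infinity>\<close>; cutting rectifiable paths into small pieces
  turns this into a Lipschitz bound for the intrinsic distance, hence the isometry.

  For surjectivity, let \<open>h\<^sub>k\<close> be a potential of \<open>g * u\<^sub>k\<close> on \<open>\<Omega>\<^sub>k\<close> and let \<open>C\<close> bound \<open>g\<close>.  Convolutions
  commute, so \<open>h\<^sub>k * u\<^sub>j\<close> and \<open>h\<^sub>j * u\<^sub>k\<close> have the same gradient \<open>g * u\<^sub>k * u\<^sub>j\<close> and differ locally by a
  constant.  The first is within \<open>C / j\<close> of \<open>h\<^sub>k\<close>, the second within \<open>C / k\<close> of \<open>h\<^sub>j\<close>.  Hence the
  differences \<open>h\<^sub>k(x) - h\<^sub>k(x\<^sub>0)\<close> form a Cauchy sequence; this replaces any discussion of the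
  convergence of \<open>g * u\<^sub>k\<close> to \<open>g\<close>.  Their limit \<open>f\<close> is Lipschitz along segments, and the same
  exchange of indices shows that \<open>f * u\<^sub>i\<close> differs locally by a constant from \<open>h\<^sub>i\<close>.  So
  \<open>(\<nabla>f - g) * u\<^sub>i = 0\<close> for all large \<open>i\<close>, and a bounded function whose mollifications vanish is
  zero almost everywhere (\<open>AE_zero_of_mollify_zero\<close>).

  Rademacher's theorem itself goes through mollification too.  A Lipschitz function of one
  real variable is the integral of a density, hence differentiable almost everywhere, and by
  Fubini a Lipschitz function on the whole space has each directional derivative almost
  everywhere.  Mollified directional derivatives are directional derivatives of a
  differentiable function, so they are linear in the direction; by the vanishing principle
  just mentioned the directional derivatives are linear as well, almost everywhere and for a
  countable dense set of directions.  The Lipschitz bound upgrades this to a gradient.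
\<close>

section \<open>Lipschitz functions of one real variable\<close>

text \<open>
  The inverse of the homeomorphism \<open>G\<close> pushes Lebesgue measure forward to the measure that gives
  an interval \<open>{a..b}\<close> the mass \<open>G b - G a\<close>.  Lipschitz maps send null sets to null sets, so
  this measure is absolutely continuous, and \<open>g\<close> is its Radon-Nikodym density.
\<close>

lemma lipschitz_homeomorphism_density:
  fixes G :: "real \<Rightarrow> real"
  assumes L: "0 < L"
    and lower: "\<And>s t. s \<le> t \<Longrightarrow> L * (t - s) \<le> G t - G s"
    and upper: "\<And>s t. s \<le> t \<Longrightarrow> G t - G s \<le> M * (t - s)"
  obtains g where "g \<in> borel_measurable borel"
    and "\<And>a b. a \<le> b \<Longrightarrow> set_integrable lborel {a..b} g \<and> (LINT t:{a..b}|lborel. g t) = G b - G a"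
proof -
  have smono: "G s < G t" if "s < t" for s t
  proof -
    have "0 < L * (t - s)" using L that by simp
    then show ?thesis using lower[of s t] that by simp
  qed
  have M: "0 \<le> M" using lower[of 0 1] upper[of 0 1] L by simp
  have lip: "\<bar>G t - G s\<bar> \<le> M * \<bar>t - s\<bar>" for s t
  proof (cases "s \<le> t")
    case True
    then have "0 \<le> L * (t - s)" using L by simp
    then show ?thesis using True lower[of s t] upper[of s t] by (simp add: abs_of_nonneg)
  next
    case False
    then have "0 \<le> L * (s - t)" using L by simp
    then show ?thesis using False lower[of t s] upper[of t s] by (simp add: abs_if)
  qed
  have contG: "continuous_on A G" for A
  proof (rule continuous_on_subset[OF lipschitz_on_continuous_on[of M UNIV G]])
    show "M-lipschitz_on UNIV G"
      using lip M by (auto simp: lipschitz_on_def dist_real_def)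
  qed simp
  have inj: "inj G" by (rule injI) (metis smono linorder_neqE_linordered_idom less_irrefl)
  have surj: "\<exists>t. G t = y" for y
  proof -
    define r where "r = \<bar>y - G 0\<bar> / L"
    have r: "0 \<le> r" "L * r = \<bar>y - G 0\<bar>" using L by (auto simp: r_def)
    have "G (- r) \<le> y" "y \<le> G r"
      using lower[of "- r" 0] lower[of 0 r] r by auto
    then show ?thesis
      using IVT'[of G "- r" y r] contG r by force
  qed
  then have bij: "bij G" using inj by (auto simp: bij_def surj_def) metis
  have mono_inv: "mono (inv G)"
  proof (rule monoI, rule ccontr)
    fix x y :: real assume "x \<le> y" "\<not> inv G x \<le> inv G y"
    then have "G (inv G y) < G (inv G x)" by (intro smono) simp
    then show False using \<open>x \<le> y\<close> bij by (simp add: bij_is_surj surj_f_inv_f)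
  qed
  have meas_inv[measurable]: "inv G \<in> borel_measurable borel"
    by (rule borel_measurable_mono[OF mono_inv])
  define N where "N = distr lborel borel (inv G)"
  have N_eq: "emeasure N A = emeasure lborel (G ` A)" if "A \<in> sets borel" for A
    using that bij_vimage_eq_inv_image[OF bij_imp_bij_inv[OF bij]] bij
    by (simp add: N_def emeasure_distr inv_inv_eq)
  have imgb: "G ` A \<in> sets borel" if "A \<in> sets borel" for A
    using measurable_sets[OF meas_inv that] bij_vimage_eq_inv_image[OF bij_imp_bij_inv[OF bij]] bij
    by (simp add: inv_inv_eq)
  have "absolutely_continuous lborel N"
  proof (unfold absolutely_continuous_def, rule subsetI)
    fix A :: "real set" assume A: "A \<in> null_sets lborel"
    then have "negligible A"
      by (simp add: negligible_iff_null_sets null_sets_completionI)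
    then have "negligible (G ` A)"
    proof (rule negligible_locally_Lipschitz_image[rotated])
      fix x :: real assume "x \<in> A"
      show "\<exists>T B. open T \<and> x \<in> T \<and> (\<forall>y\<in>A \<inter> T. norm (G y - G x) \<le> B * norm (y - x))"
        by (rule exI[of _ UNIV], rule exI[of _ M]) (use lip in auto)
    qed simp
    then have "emeasure lebesgue (G ` A) = 0" by (simp add: negligible_iff_null_sets null_setsD1)
    then have "emeasure lborel (G ` A) = 0" using imgb[of A] A by (auto simp: null_sets_def)
    then show "A \<in> null_sets N" using A N_eq[of A] by (auto simp: null_sets_def N_def)
  qed
  then obtain d where d[measurable]: "d \<in> borel_measurable lborel" and dN: "density lborel d = N"
    using sigma_finite_measure.Radon_Nikodym[OF sigma_finite_lborel, of N] by (auto simp: N_def)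
  have img: "G ` {a..b} = {G a..G b}" if "a \<le> b" for a b
  proof
    have "G x \<le> G y" if "x \<le> y" for x y
      using smono[of x y] that by (cases "x = y") auto
    then show "G ` {a..b} \<subseteq> {G a..G b}" by auto
    show "{G a..G b} \<subseteq> G ` {a..b}"
    proof
      fix y assume "y \<in> {G a..G b}"
      then show "y \<in> G ` {a..b}"
        using IVT'[of G a y b] contG that by auto
    qed
  qed
  have nn: "(\<integral>\<^sup>+t. d t * indicator {a..b} t \<partial>lborel) = ennreal (G b - G a)" if "a \<le> b" for a b
  proof -
    have "(\<integral>\<^sup>+t. d t * indicator {a..b} t \<partial>lborel) = emeasure N {a..b}"
      by (simp add: dN[symmetric] emeasure_density)
    also have "\<dots> = emeasure lborel {G a..G b}" using img[OF that] by (simp add: N_eq)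
    finally show ?thesis using that smono[of a b] by (cases "a = b") (auto simp: emeasure_lborel_Icc_eq)
  qed
  have fin: "AE t in lborel. d t \<noteq> \<infinity>"
  proof -
    have "AE t in lborel. \<forall>n::nat. d t * indicator {- real n..real n} t \<noteq> \<infinity>"
    proof (rule AE_all_countable[THEN iffD2], rule allI, rule nn_integral_PInf_AE)
      fix n :: nat
      show "(\<integral>\<^sup>+t. d t * indicator {- real n..real n} t \<partial>lborel) \<noteq> \<infinity>"
        by (subst nn) auto
    qed auto
    then show ?thesis
    proof eventually_elim
      case (elim t)
      obtain n :: nat where "\<bar>t\<bar> \<le> real n" using real_arch_simple by blast
      then have "indicator {- real n..real n} t = (1::ennreal)" by (auto simp: indicator_def)
      then show ?case using elim[rule_format, of n] by auto
    qed
  qed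
  define g where "g t = enn2real (d t)" for t
  have g[measurable]: "g \<in> borel_measurable borel" unfolding g_def by measurable
  have g0: "0 \<le> g t" for t by (simp add: g_def)
  show thesis
  proof (rule that[OF g])
    fix a b :: real assume ab: "a \<le> b"
    have "(\<integral>\<^sup>+t. ennreal (indicator {a..b} t *\<^sub>R g t) \<partial>lborel)
        = (\<integral>\<^sup>+t. d t * indicator {a..b} t \<partial>lborel)"
      by (rule nn_integral_cong_AE)
        (use fin in \<open>eventually_elim, auto simp: g_def indicator_def less_top\<close>)
    then have eq: "(\<integral>\<^sup>+t. ennreal (indicator {a..b} t *\<^sub>R g t) \<partial>lborel) = ennreal (G b - G a)"
      using nn[OF ab] by simp
    have m: "(\<lambda>t. indicator {a..b} t *\<^sub>R g t) \<in> borel_measurable lborel" by measurable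
    have i: "integrable lborel (\<lambda>t. indicator {a..b} t *\<^sub>R g t)"
      by (rule integrableI_nn_integral_finite[OF m _ eq]) (simp add: g0)
    have "(LINT t|lborel. indicator {a..b} t *\<^sub>R g t) = G b - G a"
    proof (subst integral_eq_nn_integral)
      have "0 \<le> G b - G a" using smono[of a b] ab by (cases "a = b") auto
      then show "enn2real (\<integral>\<^sup>+t. ennreal (indicator {a..b} t *\<^sub>R g t) \<partial>lborel) = G b - G a"
        using eq by simp
    qed (use g0 in auto)
    with i show "set_integrable lborel {a..b} g \<and> (LINT t:{a..b}|lborel. g t) = G b - G a"
      by (simp add: set_integrable_def set_lebesgue_integral_def)
  qed
qed

lemma AE_lborel_not_in_negligible:
  assumes "negligible E"
  shows "AE x in lborel. x \<notin> E"
proof -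
  have "AE x in lebesgue. x \<notin> E"
    using assms unfolding negligible_iff_null_sets by (rule AE_not_in)
  then show ?thesis by (simp only: AE_completion_iff)
qed

text \<open>
  In \<open>integrable_ccontinuous_explicit\<close> the averages are taken over cubes that have the point as
  their lowest corner, which gives the derivative from the right.  The derivative from the left
  is the one from the right of the reflected integral.
\<close>

lemma AE_real_derivative_of_indefinite_integral:
  fixes g G :: "real \<Rightarrow> real"
  assumes int: "\<And>a b. a \<le> b \<Longrightarrow> set_integrable lborel {a..b} g \<and> (LINT t:{a..b}|lborel. g t) = G b - G a"
  shows "AE t in lborel. (G has_real_derivative g t) (at t)"
proof -
  have io: "g integrable_on {a..b}" for a b
    using int[of a b] set_borel_integral_eq_integral(1)[of "{a..b}" g] by (cases "a \<le> b") auto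
  have ie: "integral {a..b} g = G b - G a" if "a \<le> b" for a b
    using int[OF that] set_borel_integral_eq_integral(2)[of "{a..b}" g] by simp
  obtain N1 where N1: "negligible N1" and r: "\<And>x e. x \<notin> N1 \<Longrightarrow> 0 < e \<Longrightarrow>
      \<exists>d>0. \<forall>h. 0 < h \<and> h < d \<longrightarrow> norm (integral (cbox x (x + h *\<^sub>R One)) g /\<^sub>R h ^ DIM(real) - g x) < e"
    using integrable_ccontinuous_explicit[of g] io by (metis cbox_interval)
  have io': "(\<lambda>t. g (- t)) integrable_on cbox a b" for a b
    using io[of "- b" "- a"] Henstock_Kurzweil_Integration.integrable_reflect_real[where f=g and a="- b" and b="- a"] by simp
  obtain N2 where N2: "negligible N2" and l: "\<And>x e. x \<notin> N2 \<Longrightarrow> 0 < e \<Longrightarrow>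
      \<exists>d>0. \<forall>h. 0 < h \<and> h < d \<longrightarrow> norm (integral (cbox x (x + h *\<^sub>R One)) (\<lambda>t. g (- t)) /\<^sub>R h ^ DIM(real) - g (- x)) < e"
    using integrable_ccontinuous_explicit[of "\<lambda>t. g (- t)", OF io'] by blast
  have neg: "negligible (N1 \<union> uminus ` N2)"
    using N1 N2 negligible_differentiable_image_negligible[of N2 uminus]
    by (simp add: differentiable_on_minus)
  show ?thesis
    using AE_lborel_not_in_negligible[OF neg]
  proof eventually_elim
    case (elim t)
    then have t1: "t \<notin> N1" and t2: "- t \<notin> N2" by auto (metis imageI minus_minus)
    show "(G has_real_derivative g t) (at t)"
      unfolding DERIV_def LIM_def
    proof (intro allI impI)
      fix e :: real assume e: "0 < e"
      obtain d1 where d1: "d1 > 0" "\<And>h. 0 < h \<Longrightarrow> h < d1 \<Longrightarrow> \<bar>(G (t + h) - G t) / h - g t\<bar> < e"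
        using r[OF t1 e] ie by (force simp: divide_inverse mult.commute)
      obtain d2 where d2: "d2 > 0" "\<And>h. 0 < h \<Longrightarrow> h < d2 \<Longrightarrow> \<bar>(G t - G (t - h)) / h - g t\<bar> < e"
      proof -
        obtain d where d: "d > 0" "\<And>h. 0 < h \<Longrightarrow> h < d \<Longrightarrow>
            norm (integral (cbox (- t) (- t + h *\<^sub>R One)) (\<lambda>t. g (- t)) /\<^sub>R h ^ DIM(real) - g (- (- t))) < e"
          using l[OF t2 e] by blast
        have "integral (cbox (- t) (- t + h *\<^sub>R One)) (\<lambda>t. g (- t)) = G t - G (t - h)" if "0 < h" for h
        proof -
          have "integral {- t.. - (t - h)} (\<lambda>t. g (- t)) = integral {t - h..t} g"
            by (rule Henstock_Kurzweil_Integration.integral_reflect_real)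
          then show ?thesis using ie[of "t - h" t] that by simp
        qed
        then show ?thesis using d by (intro that[of d]) (auto simp: divide_inverse mult.commute)
      qed
      show "\<exists>s>0. \<forall>h. h \<noteq> 0 \<and> dist h 0 < s \<longrightarrow> dist ((G (t + h) - G t) / h) (g t) < e"
      proof (intro exI[of _ "min d1 d2"] conjI allI impI)
        fix h :: real assume h: "h \<noteq> 0 \<and> dist h 0 < min d1 d2"
        show "dist ((G (t + h) - G t) / h) (g t) < e"
        proof (cases "h > 0")
          case True
          then show ?thesis using d1(2)[of h] h by (simp add: dist_real_def)
        next
          case False
          have "(G t - G (t - (- h))) / (- h) = (G (t + h) - G t) / h"
            using h by (simp add: field_simps)
          then show ?thesis using d2(2)[of "- h"] h False by (simp add: dist_real_def)
        qed
      qed (use d1 d2 in auto)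
    qed
  qed
qed

text \<open>
  Adding a sufficiently steep linear function turns \<open>F\<close> into a homeomorphism that is Lipschitz in
  both directions.
\<close>

lemma lipschitz_real_derivative:
  fixes F :: "real \<Rightarrow> real"
  assumes lip: "\<And>s t. \<bar>F s - F t\<bar> \<le> L * \<bar>s - t\<bar>"
  obtains g where "g \<in> borel_measurable borel"
    and "AE t in lborel. (F has_real_derivative g t) (at t)"
    and "\<And>a b. a \<le> b \<Longrightarrow> set_integrable lborel {a..b} g \<and> (LINT t:{a..b}|lborel. g t) = F b - F a"
proof -
  \<comment> \<open>The slope \<open>2 * K\<close> leaves an increase of at least \<open>K > 0\<close> after the variation of \<open>F\<close> is subtracted.\<close>
  define K where "K = \<bar>L\<bar> + 1"
  have K: "0 < K" by (simp add: K_def)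
  have lip': "\<bar>F s - F t\<bar> \<le> K * \<bar>s - t\<bar>" for s t
    by (rule order_trans[OF lip mult_right_mono]) (auto simp: K_def)
  define G where "G t = F t + 2 * K * t" for t
  obtain h where h[measurable]: "h \<in> borel_measurable borel"
    and ih: "\<And>a b. a \<le> b \<Longrightarrow> set_integrable lborel {a..b} h \<and> (LINT t:{a..b}|lborel. h t) = G b - G a"
  proof -
    have "K * (t - s) \<le> G t - G s" "G t - G s \<le> 3 * K * (t - s)" if "s \<le> t" for s t
      using lip'[of t s] that by (auto simp: G_def algebra_simps)
    then show ?thesis
      using lipschitz_homeomorphism_density[OF K, of G "3 * K"] that by blast
  qed
  define g where "g t = h t - 2 * K" for t
  have eq: "set_integrable lborel {a..b} g \<and> (LINT t:{a..b}|lborel. g t) = F b - F a" if "a \<le> b" for a b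
  proof -
    have c: "set_integrable lborel {a..b} (\<lambda>t. 2 * K)" "(LINT t:{a..b}|lborel. 2 * K) = 2 * K * (b - a)"
      using that by (auto simp: set_integrable_def set_lebesgue_integral_def)
    show ?thesis
      using ih[OF that] c unfolding g_def
      by (auto simp: G_def algebra_simps)
  qed
  show thesis
    by (rule that[OF _ AE_real_derivative_of_indefinite_integral[OF eq] eq]) (auto simp: g_def[abs_def])
qed

section \<open>Gradients and differentiation under the integral sign\<close>

lemma GDERIV_directional:
  fixes f :: "'a::real_inner \<Rightarrow> real"
  assumes "GDERIV f x :> D"
  shows "((\<lambda>t. (f (x + t *\<^sub>R v) - f x) / t) \<longlongrightarrow> D \<bullet> v) (at 0)"
proof -
  have "((\<lambda>t. f (x + t *\<^sub>R v)) has_derivative (\<lambda>t. (t *\<^sub>R v) \<bullet> D)) (at 0)"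
  proof -
    have "(f has_derivative (\<lambda>h. h \<bullet> D)) (at (x + 0 *\<^sub>R v))" using assms by (simp add: gderiv_def)
    then show ?thesis
      by (rule has_derivative_compose[rotated]) (auto intro!: derivative_eq_intros)
  qed
  then have "((\<lambda>t. f (x + t *\<^sub>R v)) has_real_derivative D \<bullet> v) (at 0)"
    by (simp add: has_field_derivative_def mult_commute_abs inner_commute)
  then show ?thesis by (simp add: DERIV_def)
qed

lemma GDERIV_directional_bound:
  fixes f :: "'a::real_inner \<Rightarrow> real"
  assumes D: "GDERIV f x :> D" and d: "0 < d"
    and lip: "\<And>t. 0 < t \<Longrightarrow> t < d \<Longrightarrow> \<bar>f (x + t *\<^sub>R v) - f x\<bar> \<le> K * t"
  shows "\<bar>D \<bullet> v\<bar> \<le> K"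
proof -
  have "((\<lambda>t. \<bar>(f (x + t *\<^sub>R v) - f x) / t\<bar>) \<longlongrightarrow> \<bar>D \<bullet> v\<bar>) (at_right 0)"
    using tendsto_rabs[OF GDERIV_directional[OF D]] by (rule filterlim_mono) (auto simp: at_le)
  moreover have "\<forall>\<^sub>F t in at_right (0::real). \<bar>(f (x + t *\<^sub>R v) - f x) / t\<bar> \<le> K"
    unfolding eventually_at_right_field using d lip
    by (intro exI[of _ d]) (auto simp: abs_divide divide_le_eq)
  ultimately show ?thesis by (rule tendsto_upperbound) simp
qed

lemma GDERIV_unique:
  fixes f :: "'a::real_inner \<Rightarrow> real"
  assumes "GDERIV f x :> D" "GDERIV f x :> D'"
  shows "D = D'"
proof -
  have "D \<bullet> (D - D') = D' \<bullet> (D - D')"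
    using tendsto_unique[OF _ GDERIV_directional[OF assms(1)] GDERIV_directional[OF assms(2)]] by simp
  then have "(D - D') \<bullet> (D - D') = 0" by (simp add: inner_diff_left)
  then show ?thesis by simp
qed

lemma GDERIV_cong_open:
  assumes "open U" "x \<in> U" "\<And>y. y \<in> U \<Longrightarrow> f y = h y" "GDERIV f x :> D"
  shows "GDERIV h x :> D"
  using assms(4) unfolding gderiv_def
  by (rule has_derivative_transform_within_open[where s=U]) (use assms in auto)

lemma GDERIV_cmult:
  fixes f :: "'a::real_inner \<Rightarrow> real"
  assumes "GDERIV f z :> D"
  shows "GDERIV (\<lambda>x. c * f x) z :> c *\<^sub>R D"
  using has_derivative_mult_right[of f "\<lambda>h. h \<bullet> D" "at z" c] assms by (simp add: gderiv_def)

lemma GDERIV_mean_value: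
  fixes f :: "'a::real_inner \<Rightarrow> real"
  assumes "\<And>z. z \<in> closed_segment x y \<Longrightarrow> GDERIV f z :> D z"
  obtains z where "z \<in> closed_segment x y" "f y - f x = D z \<bullet> (y - x)"
proof -
  define p where "p t = x + t *\<^sub>R (y - x)" for t
  have p: "p t \<in> closed_segment x y" if "0 \<le> t" "t \<le> 1" for t
    unfolding in_segment p_def using that by (intro exI[of _ t]) (simp add: algebra_simps)
  have "DERIV (\<lambda>t. f (p t)) t :> D (p t) \<bullet> (y - x)" if "0 \<le> t" "t \<le> 1" for t
  proof -
    have "(f has_derivative (\<lambda>h. h \<bullet> D (p t))) (at (p t))"
      using assms[OF p[OF that]] by (simp add: gderiv_def)
    moreover have "(p has_derivative (\<lambda>s. s *\<^sub>R (y - x))) (at t)"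
      unfolding p_def by (auto intro!: derivative_eq_intros)
    ultimately have "((\<lambda>t. f (p t)) has_derivative (\<lambda>s. (s *\<^sub>R (y - x)) \<bullet> D (p t))) (at t)"
      by (rule has_derivative_compose[rotated])
    then show ?thesis by (simp add: has_field_derivative_def mult_commute_abs inner_commute)
  qed
  then obtain t where t: "0 < t" "t < 1" "f (p 1) - f (p 0) = (1 - 0) * (D (p t) \<bullet> (y - x))"
    using MVT2[of 0 1 "\<lambda>t. f (p t)" "\<lambda>t. D (p t) \<bullet> (y - x)"] by auto
  show thesis
    by (rule that[of "p t"]) (use t p in \<open>auto simp: p_def\<close>)
qed

text \<open>
  The connected set \<open>P\<close>, in the applications the image of a path, has no interior in general; the
  difference \<open>F - H\<close> is constant on the component of \<open>U\<close> that contains \<open>P\<close>.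
\<close>

lemma gradients_eq_differences_eq:
  fixes F H :: "'a::euclidean_space \<Rightarrow> real"
  assumes U: "open U" and P: "connected P" "P \<subseteq> U"
    and F: "\<And>z. z \<in> U \<Longrightarrow> GDERIV F z :> D z" and H: "\<And>z. z \<in> U \<Longrightarrow> GDERIV H z :> D z"
    and xy: "x \<in> P" "y \<in> P"
  shows "F x - F y = H x - H y"
proof -
  let ?S = "connected_component_set U x"
  have sub: "P \<subseteq> ?S" using connected_component_maximal[OF xy(1) P] .
  have "F x - H x = F y - H y"
  proof (rule has_derivative_zero_unique_connected[of ?S "\<lambda>z. F z - H z"])
    show "open ?S" by (rule open_connected_component[OF U])
    fix z assume "z \<in> ?S"
    then have "z \<in> U" using connected_component_subset by blast
    then have "((\<lambda>z. F z - H z) has_derivative (\<lambda>h. h \<bullet> D z - h \<bullet> D z)) (at z)"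
      using F H by (intro has_derivative_diff) (auto simp: gderiv_def)
    then show "((\<lambda>z. F z - H z) has_derivative (\<lambda>x. 0)) (at z)" by simp
  qed (use xy sub in auto)
  then show ?thesis by simp
qed

text \<open>
  The remainder quotients of the integrands are dominated by \<open>2 * K\<close> and tend to zero for almost
  every parameter, so dominated convergence applies to the full derivative at once.
  Differentiability for almost every parameter suffices, which is what makes the lemma
  applicable to integrands that are merely Lipschitz.
\<close>

lemma GDERIV_integral:
  fixes F :: "'a::euclidean_space \<Rightarrow> 'z \<Rightarrow> real"
  assumes d: "0 < d"
    and int: "\<And>y. y \<in> ball x d \<Longrightarrow> integrable M (F y)"
    and K: "integrable M K" "\<And>z. 0 \<le> K z"
    and lip: "\<And>y z. y \<in> ball x d \<Longrightarrow> \<bar>F y z - F x z\<bar> \<le> K z * norm (y - x)"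
    and der: "AE z in M. GDERIV (\<lambda>y. F y z) x :> G z"
    and meas[measurable]: "G \<in> borel_measurable M"
  shows "integrable M G" "GDERIV (\<lambda>y. LINT z|M. F y z) x :> (LINT z|M. G z)"
proof -
  have bd: "AE z in M. norm (G z) \<le> K z"
    using der
  proof eventually_elim
    case (elim z)
    show ?case
    proof (cases "G z = 0")
      case False
      have "\<bar>G z \<bullet> G z\<bar> \<le> K z * norm (G z)"
      proof (rule GDERIV_directional_bound[OF elim, of "d / norm (G z)"])
        fix t :: real assume t: "0 < t" "t < d / norm (G z)"
        then have "x + t *\<^sub>R G z \<in> ball x d" using False by (simp add: dist_norm field_simps)
        from lip[OF this, of z] show "\<bar>F (x + t *\<^sub>R G z) z - F x z\<bar> \<le> K z * norm (G z) * t"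
          using t by (simp add: mult_ac)
      qed (use d False in auto)
      then show ?thesis using False by (simp add: dot_square_norm power2_eq_square)
    qed (simp add: K)
  qed
  show iG: "integrable M G"
    by (rule Bochner_Integration.integrable_bound[OF K(1)]) (use bd K in \<open>auto elim!: eventually_mono\<close>)
  have "((\<lambda>y. ((LINT z|M. F y z) - (LINT z|M. F x z) - (y - x) \<bullet> (LINT z|M. G z)) /\<^sub>R norm (y - x)) \<longlongrightarrow> 0) (at x)"
  proof (subst tendsto_at_iff_sequentially, intro allI impI)
    fix X :: "nat \<Rightarrow> 'a" assume X: "\<forall>i. X i \<in> UNIV - {x}" and lim: "X \<longlonglongrightarrow> x"
    define R where "R y z = (F y z - F x z - (y - x) \<bullet> G z) /\<^sub>R norm (y - x)" for y z
    obtain n where n: "\<And>i. X (i + n) \<in> ball x d"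
      using lim d unfolding lim_sequentially by (metis dist_commute le_add2 mem_ball)
    have iF: "integrable M (F (X (i + n)))" for i using n int by auto
    have iFx: "integrable M (F x)" using d int by simp
    have eq: "(LINT z|M. R (X (i + n)) z)
       = ((LINT z|M. F (X (i + n)) z) - (LINT z|M. F x z) - (X (i + n) - x) \<bullet> (LINT z|M. G z)) /\<^sub>R norm (X (i + n) - x)" for i
      proof -
      have "integrable M (\<lambda>z. F (X (i + n)) z - F x z)" using iF[of i] iFx by simp
      moreover have "integrable M (\<lambda>z. (X (i + n) - x) \<bullet> G z)" using iG by simp
      ultimately show ?thesis
        unfolding R_def integral_scaleR_right using iF[of i] iFx iG by simp
    qed

    have "(\<lambda>i. LINT z|M. R (X (i + n)) z) \<longlonglongrightarrow> (LINT z|M. 0)"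
    proof (rule integral_dominated_convergence[where w="\<lambda>z. 2 * K z"])
      show "(\<lambda>z. R (X (i + n)) z) \<in> borel_measurable M" for i
        proof -
        have [measurable]: "F (X (i + n)) \<in> borel_measurable M" "F x \<in> borel_measurable M"
          using iF[of i] iFx by (auto dest: borel_measurable_integrable)
        show ?thesis unfolding R_def by measurable
      qed
      show "integrable M (\<lambda>z. 2 * K z)" using K by simp
      show "AE z in M. norm (R (X (i + n)) z) \<le> 2 * K z" for i
        using bd
      proof eventually_elim
        case (elim z)
        let ?y = "X (i + n)"
        have "\<bar>(?y - x) \<bullet> G z\<bar> \<le> norm (?y - x) * K z"
          by (rule order_trans[OF Cauchy_Schwarz_ineq2]) (simp add: elim mult_left_mono)
        then have "\<bar>F ?y z - F x z - (?y - x) \<bullet> G z\<bar> \<le> 2 * K z * norm (?y - x)"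
          using lip[of ?y z, OF n] by (simp add: mult_ac)
        moreover have "0 < norm (?y - x)" using X by auto
        ultimately show ?case
          by (simp add: R_def divide_inverse[symmetric] mult.commute[of "inverse _"] divide_le_eq)
      qed
      show "AE z in M. (\<lambda>i. R (X (i + n)) z) \<longlonglongrightarrow> 0"
        using der
      proof eventually_elim
        case (elim z)
        then have "((\<lambda>y. R y z) \<longlongrightarrow> 0) (at x)"
          by (simp add: gderiv_def has_derivative_at_within R_def)
        then have "(\<lambda>i. R (X i) z) \<longlonglongrightarrow> 0"
          using X lim unfolding tendsto_at_iff_sequentially by (auto simp: o_def)
        then show ?case by (rule LIMSEQ_ignore_initial_segment)
      qed
    qed simp
    then show "((\<lambda>y. ((LINT z|M. F y z) - (LINT z|M. F x z) - (y - x) \<bullet> (LINT z|M. G z)) /\<^sub>R norm (y - x)) \<circ> X) \<longlonglongrightarrow> 0"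
      unfolding eq by (simp add: o_def LIMSEQ_offset[where k=n])
  qed
  then show "GDERIV (\<lambda>y. LINT z|M. F y z) x :> (LINT z|M. G z)"
    by (simp add: gderiv_def has_derivative_at_within bounded_linear_inner_left)
qed

section \<open>Norms\<close>

locale normed_coordinates =
  fixes N :: "real ^ 'n \<Rightarrow> real"
  assumes is_norm: "is_norm N"
begin

lemma N_zero_iff [simp]: "N x = 0 \<longleftrightarrow> x = 0"
  and N_scaleR: "N (c *\<^sub>R x) = \<bar>c\<bar> * N x"
  and N_triangle: "N (x + y) \<le> N x + N y"
  using is_norm by (auto simp: is_norm_def)

lemma N_zero [simp]: "N 0 = 0"
  by simp

lemma N_minus [simp]: "N (- x) = N x"
  using N_scaleR[of "-1" x] by simp

lemma N_commute: "N (x - y) = N (y - x)"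
  using N_minus[of "x - y"] by simp

lemma N_nonneg [simp]: "0 \<le> N x"
  using N_triangle[of x "- x"] by simp

lemma N_diff_triangle: "N (x - z) \<le> N (x - y) + N (y - z)"
  using N_triangle[of "x - y" "y - z"] by simp

lemma N_sum: "N (sum f A) \<le> (\<Sum>i\<in>A. N (f i))"
proof (induction A rule: infinite_finite_induct)
  case (insert i A)
  then show ?case using N_triangle[of "f i" "sum f A"] by simp
qed auto

lemma N_le_norm: obtains B where "0 < B" "\<And>x. N x \<le> B * norm x"
proof
  let ?B = "(\<Sum>i\<in>Basis. N i) + 1"
  show "0 < ?B" by (simp add: add_nonneg_pos sum_nonneg)
  fix x
  have "N x = N (\<Sum>i\<in>Basis. (x \<bullet> i) *\<^sub>R i)" by (simp add: euclidean_representation)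
  also have "\<dots> \<le> (\<Sum>i\<in>Basis. \<bar>x \<bullet> i\<bar> * N i)"
    using N_sum[of "\<lambda>i. (x \<bullet> i) *\<^sub>R i" Basis] by (simp add: N_scaleR)
  also have "\<dots> \<le> (\<Sum>i\<in>Basis. norm x * N i)"
    by (intro sum_mono mult_right_mono) (auto simp: Basis_le_norm)
  also have "\<dots> \<le> ?B * norm x" by (simp add: sum_distrib_left[symmetric] distrib_left mult.commute[of _ "norm x"])
  finally show "N x \<le> ?B * norm x" .
qed

lemma N_diff_le: "\<bar>N x - N y\<bar> \<le> N (x - y)"
  using N_triangle[of "x - y" y] N_triangle[of "y - x" x] N_commute[of x y] by simp

lemma continuous_on_N [continuous_intros]:
  assumes "continuous_on A f"
  shows "continuous_on A (\<lambda>x. N (f x))"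
proof -
  obtain B where B: "0 < B" "\<And>x. N x \<le> B * norm x" using N_le_norm by blast
  have "B-lipschitz_on UNIV N"
    using B N_diff_le by (auto simp: lipschitz_on_def dist_norm intro: order_trans)
  then have "continuous_on UNIV N" by (rule lipschitz_on_continuous_on)
  then show ?thesis using assms by (rule continuous_on_compose2) auto
qed

lemma norm_le_N: obtains b where "0 < b" "\<And>x. norm x \<le> b * N x"
proof -
  obtain s where s: "s \<in> sphere 0 1" "\<And>y. y \<in> sphere 0 1 \<Longrightarrow> N s \<le> N y"
    using continuous_attains_inf[of "sphere (0::real^'n) 1" N] continuous_on_N[OF continuous_on_id]
    by auto
  have "s \<noteq> 0" using s(1) by auto
  then have pos: "0 < N s" using N_nonneg[of s] by (simp add: less_eq_real_def)
  show thesis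
  proof (rule that[of "1 / N s"])
    fix x
    show "norm x \<le> 1 / N s * N x"
    proof (cases "x = 0")
      case False
      then have "N s \<le> N ((1 / norm x) *\<^sub>R x)" by (intro s(2)) simp
      then show ?thesis using False pos by (simp add: N_scaleR field_simps)
    qed simp
  qed (use pos in simp)
qed

definition nball :: "real ^ 'n \<Rightarrow> real \<Rightarrow> (real ^ 'n) set" where
  "nball x r = {y. N (y - x) < r}"

lemma centre_in_nball [simp]: "x \<in> nball x r \<longleftrightarrow> 0 < r"
  by (simp add: nball_def)

lemma open_nball [simp]: "open (nball x r)"
  unfolding nball_def by (intro open_Collect_less continuous_intros)

lemma convex_nball [simp]: "convex (nball x r)"
proof (rule convexI)
  fix y z and s t :: real assume yz: "y \<in> nball x r" "z \<in> nball x r" and st: "0 \<le> s" "0 \<le> t" "s + t = 1"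
  have "s *\<^sub>R y + t *\<^sub>R z - x = s *\<^sub>R (y - x) + t *\<^sub>R (z - x)"
    using st(3) by (simp add: algebra_simps flip: scaleR_add_left)
  then have "N (s *\<^sub>R y + t *\<^sub>R z - x) \<le> s * N (y - x) + t * N (z - x)"
    using N_triangle[of "s *\<^sub>R (y - x)" "t *\<^sub>R (z - x)"] st by (simp add: N_scaleR)
  also have "\<dots> < r"
    using convex_bound_lt[of "N (y - x)" r "N (z - x)" s t] yz st by (simp add: nball_def)
  finally show "s *\<^sub>R y + t *\<^sub>R z \<in> nball x r" by (simp add: nball_def)
qed

lemma nball_subset:
  assumes "N (y - x) + s \<le> r"
  shows "nball y s \<subseteq> nball x r"
proof
  fix z assume "z \<in> nball y s"
  then show "z \<in> nball x r" using N_diff_triangle[of z x y] assms by (simp add: nball_def)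
qed

lemma open_contains_nball:
  assumes "open S" "x \<in> S"
  obtains r where "0 < r" "nball x r \<subseteq> S"
proof -
  obtain e where e: "0 < e" "ball x e \<subseteq> S" using assms open_contains_ball by blast
  obtain b where b: "0 < b" "\<And>x. norm x \<le> b * N x" using norm_le_N by blast
  have "nball x (e / b) \<subseteq> ball x e"
  proof
    fix y assume "y \<in> nball x (e / b)"
    then have "b * N (y - x) < e" using b by (simp add: nball_def field_simps)
    then show "y \<in> ball x e" using b(2)[of "y - x"] by (simp add: dist_norm norm_minus_commute)
  qed
  then show thesis using that[of "e / b"] e b by auto
qed

lemma ball_subset_nball:
  assumes "0 < r" obtains e where "0 < e" "ball x e \<subseteq> nball x r"
  using assms open_nball[of x r] centre_in_nball[of x r] open_contains_ball by blast

lemma bounded_nball: obtains R where "nball x r \<subseteq> ball x R"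
proof -
  obtain b where b: "0 < b" "\<And>x. norm x \<le> b * N x" using norm_le_N by blast
  have "nball x r \<subseteq> ball x (b * r)"
  proof
    fix y assume "y \<in> nball x r"
    then have "b * N (y - x) < b * r" using b by (simp add: nball_def)
    then show "y \<in> ball x (b * r)" using b(2)[of "y - x"] by (simp add: dist_norm norm_minus_commute)
  qed
  then show thesis by (rule that)
qed

end

section \<open>Mollification\<close>

lemma lborel_eq_distr_reflect: "(lborel :: 'a::euclidean_space measure) = distr lborel borel (\<lambda>z. x - z)"
  using lborel_affine[of "-1" x] by (simp add: density_1)

lemma AE_lborel_reflect:
  fixes x :: "'a::euclidean_space"
  assumes "AE y in lborel. P y"
  shows "AE z in lborel. P (x - z)"
  using assms by (subst (asm) lborel_eq_distr_reflect[of x]) (rule AE_distrD[rotated], auto)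

lemma integral_lborel_reflect:
  fixes f :: "'a::euclidean_space \<Rightarrow> 'b::{banach, second_countable_topology}"
  assumes [measurable]: "f \<in> borel_measurable borel"
  shows "(LINT z|lborel. f (x - z)) = (LINT y|lborel. f y)"
  by (subst (2) lborel_eq_distr_reflect[of x]) (simp add: integral_distr)

lemma integrable_product_function:
  fixes v :: "'a::euclidean_space \<Rightarrow> real" and w :: "'b::euclidean_space \<Rightarrow> real"
  assumes v: "integrable lborel v" and w: "integrable lborel w"
  shows "integrable (lborel \<Otimes>\<^sub>M lborel) (\<lambda>(z, y). v z * w y)"
proof (rule lborel_pair.Fubini_integrable)
  note [measurable] = borel_measurable_integrable[OF v] borel_measurable_integrable[OF w]
  show "(\<lambda>(z, y). v z * w y) \<in> borel_measurable (lborel \<Otimes>\<^sub>M lborel)" by measurable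
  show "integrable lborel (\<lambda>z. LINT y|lborel. norm (case (z, y) of (z, y) \<Rightarrow> v z * w y))"
    using v by (simp add: abs_mult)
  show "AE z in lborel. integrable lborel (\<lambda>y. case (z, y) of (z, y) \<Rightarrow> v z * w y)"
    using w by simp
qed

text \<open>
  The convolution of \<open>v\<close> and \<open>f\<close>, written with the displacement as the variable of integration:
  derivatives then fall on \<open>f\<close>, and only the values of \<open>f\<close> near \<open>x\<close> matter.  In the form of
  \<open>mollify_reflect\<close> they fall on \<open>v\<close>.
\<close>

definition mollify ::
    "('a::euclidean_space \<Rightarrow> real) \<Rightarrow> ('a \<Rightarrow> 'b::{banach, second_countable_topology}) \<Rightarrow> 'a \<Rightarrow> 'b" where
  "mollify v f x = (LINT z|lborel. v z *\<^sub>R f (x - z))"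

lemma mollify_reflect:
  assumes [measurable]: "v \<in> borel_measurable borel" "f \<in> borel_measurable borel"
  shows "mollify v f x = (LINT y|lborel. v (x - y) *\<^sub>R f y)"
  using integral_lborel_reflect[of "\<lambda>y. v (x - y) *\<^sub>R f y" x] by (simp add: mollify_def)

context normed_coordinates
begin

text \<open>
  Abstracts the rescaled mollifier \<open>u\<^sub>k\<close>, for which \<open>r\<close> is \<open>1 / k\<close>.
\<close>

definition kernel :: "real \<Rightarrow> (real ^ 'n \<Rightarrow> real) \<Rightarrow> bool" where
  "kernel r v \<longleftrightarrow> (\<forall>x. 0 \<le> v x) \<and> (\<forall>x. v x \<noteq> 0 \<longrightarrow> N x \<le> r) \<and> (LINT x|lborel. v x) = 1 \<and>
     (\<exists>D. (\<forall>x. GDERIV v x :> D x) \<and> continuous_on UNIV D)"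

lemma kernel_nonneg: "kernel r v \<Longrightarrow> 0 \<le> v x"
  and kernel_support: "kernel r v \<Longrightarrow> v x \<noteq> 0 \<Longrightarrow> N x \<le> r"
  and kernel_integral: "kernel r v \<Longrightarrow> (LINT x|lborel. v x) = 1"
  by (auto simp: kernel_def)

lemma kernel_integrable:
  assumes "kernel r v" shows "integrable lborel v"
  using kernel_integral[OF assms] not_integrable_integral_eq[of lborel v] by fastforce

lemma kernel_continuous:
  assumes "kernel r v" shows "continuous_on A v"
proof (rule continuous_at_imp_continuous_on, rule ballI)
  fix x
  obtain D where "GDERIV v x :> D" using assms by (auto simp: kernel_def)
  then show "isCont v x" by (auto simp: gderiv_def dest: has_derivative_continuous)
qed

lemma kernel_measurable:
  assumes "kernel r v" shows "v \<in> borel_measurable borel"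
  by (rule borel_measurable_continuous_onI[OF kernel_continuous[OF assms]])

lemma kernel_gradient:
  assumes v: "kernel r v"
  obtains D L where "\<And>x. GDERIV v x :> D x" "D \<in> borel_measurable borel"
    "0 \<le> L" "\<And>x y. \<bar>v x - v y\<bar> \<le> L * norm (x - y)"
proof -
  obtain D where D: "\<And>x. GDERIV v x :> D x" and cD: "continuous_on UNIV D"
    using v by (auto simp: kernel_def)
  have D0: "D x = 0" if "r < N x" for x
  proof (rule GDERIV_unique[OF D])
    have "open {x. r < N x}" by (intro open_Collect_less continuous_intros)
    moreover have "((\<lambda>x. 0) has_derivative (\<lambda>h. h \<bullet> (0::real^'n))) (at x)" by simp
    ultimately have "(v has_derivative (\<lambda>h. h \<bullet> (0::real^'n))) (at x)"
      using that kernel_support[OF v]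
      by (intro has_derivative_transform_within_open[of "\<lambda>x. 0" _ x UNIV "{x. r < N x}" v]) force+
    then show "GDERIV v x :> 0" by (simp add: gderiv_def)
  qed
  obtain R where R: "nball 0 (r + 1) \<subseteq> ball 0 R" using bounded_nball by blast
  have "compact (D ` cball 0 R)"
    by (intro compact_continuous_image continuous_on_subset[OF cD]) auto
  then obtain L where L: "\<And>x. x \<in> cball 0 R \<Longrightarrow> norm (D x) \<le> L"
    by (meson bounded_iff compact_imp_bounded imageI)
  have bd: "norm (D x) \<le> max L 0" for x
  proof (cases "r < N x")
    case False
    then have "x \<in> nball 0 (r + 1)" by (simp add: nball_def)
    then have "x \<in> cball 0 R" using R ball_subset_cball by blast
    then show ?thesis using L by fastforce
  qed (simp add: D0)
  show thesis
  proof (rule that[OF D borel_measurable_continuous_onI[OF cD], of "max L 0"])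
    fix x y
    obtain z where "v x - v y = D z \<bullet> (x - y)" using GDERIV_mean_value[of y x v D] D by blast
    then show "\<bar>v x - v y\<bar> \<le> max L 0 * norm (x - y)"
      using Cauchy_Schwarz_ineq2[of "D z" "x - y"] mult_right_mono[OF bd[of z] norm_ge_zero[of "x - y"]]
      by simp
  qed auto
qed

lemma mollify_integrable:
  fixes f :: "real ^ 'n \<Rightarrow> 'b::{banach, second_countable_topology}"
  assumes v: "kernel r v" and [measurable]: "f \<in> borel_measurable borel"
    and B: "\<And>z. N z \<le> r \<Longrightarrow> norm (f (x - z)) \<le> B"
  shows "integrable lborel (\<lambda>z. v z *\<^sub>R f (x - z))"
proof (rule Bochner_Integration.integrable_bound)
  note [measurable] = kernel_measurable[OF v]
  show "integrable lborel (\<lambda>z. v z * B)" using kernel_integrable[OF v] by simp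
  show "(\<lambda>z. v z *\<^sub>R f (x - z)) \<in> borel_measurable lborel" by measurable
  have "norm (v z *\<^sub>R f (x - z)) \<le> norm (v z * B)" for z
  proof (cases "v z = 0")
    case False
    then have "norm (f (x - z)) \<le> B" using B kernel_support[OF v] by blast
    then show ?thesis using kernel_nonneg[OF v, of z] by (simp add: abs_mult mult_left_mono)
  qed simp
  then show "AE z in lborel. norm (v z *\<^sub>R f (x - z)) \<le> norm (v z * B)" by simp
qed

lemma norm_mollify_le:
  fixes f :: "real ^ 'n \<Rightarrow> 'b::{banach, second_countable_topology}"
  assumes v: "kernel r v" and f: "f \<in> borel_measurable borel"
    and B: "\<And>z. N z \<le> r \<Longrightarrow> norm (f (x - z)) \<le> B"
  shows "norm (mollify v f x) \<le> B"
proof -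
  have "norm (mollify v f x) \<le> (LINT z|lborel. v z * B)"
    unfolding mollify_def
  proof (rule Bochner_Integration.integral_norm_bound_integral)
    show "integrable lborel (\<lambda>z. v z *\<^sub>R f (x - z))" by (rule mollify_integrable[OF v f B])
    show "integrable lborel (\<lambda>z. v z * B)" using kernel_integrable[OF v] by simp
    fix z
    show "norm (v z *\<^sub>R f (x - z)) \<le> v z * B"
    proof (cases "v z = 0")
      case False
      then have "norm (f (x - z)) \<le> B" using B kernel_support[OF v] by blast
      then show ?thesis using kernel_nonneg[OF v, of z] by (simp add: mult_left_mono)
    qed simp
  qed
  then show ?thesis using kernel_integral[OF v] by simp
qed

lemma mollify_diff_const:
  fixes f :: "real ^ 'n \<Rightarrow> 'b::{banach, second_countable_topology}"
  assumes v: "kernel r v" and f: "f \<in> borel_measurable borel"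
    and B: "\<And>z. N z \<le> r \<Longrightarrow> norm (f (x - z)) \<le> B"
  shows "mollify v (\<lambda>y. f y - c) x = mollify v f x - c"
  using mollify_integrable[OF assms] kernel_integrable[OF v] kernel_integral[OF v]
  by (simp add: mollify_def scaleR_diff_right)

lemma norm_mollify_minus_le:
  fixes f :: "real ^ 'n \<Rightarrow> 'b::{banach, second_countable_topology}"
  assumes v: "kernel r v" and [measurable]: "f \<in> borel_measurable borel"
    and B: "\<And>z. N z \<le> r \<Longrightarrow> norm (f (x - z) - f x) \<le> B"
  shows "norm (mollify v f x - f x) \<le> B"
proof -
  have "norm (f (x - z)) \<le> B + norm (f x)" if "N z \<le> r" for z
    using B[OF that] norm_triangle_ineq[of "f (x - z) - f x" "f x"] by simp
  then have "mollify v f x - f x = mollify v (\<lambda>y. f y - f x) x"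
    by (intro mollify_diff_const[OF v, symmetric]) auto
  also have "norm \<dots> \<le> B"
    by (rule norm_mollify_le[OF v]) (use B in auto)
  finally show ?thesis .
qed

lemma inner_mollify:
  fixes g :: "real ^ 'n \<Rightarrow> real ^ 'n"
  assumes v: "kernel r v" and f: "g \<in> borel_measurable borel"
    and B: "\<And>z. N z \<le> r \<Longrightarrow> norm (g (x - z)) \<le> B"
  shows "mollify v g x \<bullet> e = mollify v (\<lambda>y. g y \<bullet> e) x"
  using mollify_integrable[OF assms] by (simp add: mollify_def flip: integral_inner_left)

text \<open>
  The derivative falls on \<open>f\<close>.  The gap between \<open>r\<close> and \<open>s\<close> leaves room for moving \<open>x\<close>.
\<close>

lemma GDERIV_mollify:
  fixes f :: "real ^ 'n \<Rightarrow> real"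
  assumes v: "kernel r v" and r: "r < s"
    and [measurable]: "f \<in> borel_measurable borel" "g \<in> borel_measurable borel"
    and L: "0 \<le> L" and lip: "\<And>y z. y \<in> nball x s \<Longrightarrow> z \<in> nball x s \<Longrightarrow> \<bar>f y - f z\<bar> \<le> L * norm (y - z)"
    and der: "AE y in lborel. y \<in> nball x s \<longrightarrow> GDERIV f y :> g y"
  shows "GDERIV (mollify v f) x :> mollify v g x"
proof -
  note [measurable] = kernel_measurable[OF v]
  obtain d where d: "0 < d" "ball x d \<subseteq> nball x (s - r)"
    using ball_subset_nball[of "s - r" x] r by auto
  have inside: "y - z \<in> nball x s" if "y \<in> ball x d" "N z \<le> r" for y z
  proof -
    have "N (y - x) < s - r" using that d by (auto simp: nball_def)
    then show ?thesis using that N_triangle[of "y - x" "- z"] by (simp add: nball_def algebra_simps)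
  qed
  obtain R where R: "nball x s \<subseteq> ball x R" using bounded_nball by blast
  have bd: "norm (f y) \<le> \<bar>f x\<bar> + L * R" if "y \<in> nball x s" for y
  proof -
    have "0 < s" using that le_less_trans[OF N_nonneg[of "y - x"]] by (simp add: nball_def)
    then have "\<bar>f y - f x\<bar> \<le> L * norm (y - x)" using that by (intro lip) auto
    also have "\<dots> \<le> L * R" 
      using L R that by (intro mult_left_mono) (auto simp: dist_norm norm_minus_commute)
    finally show ?thesis by simp
  qed
  have "GDERIV (\<lambda>y. LINT z|lborel. v z * f (y - z)) x :> (LINT z|lborel. v z *\<^sub>R g (x - z))"
  proof (rule GDERIV_integral(2)[OF d(1)])
    show "integrable lborel (\<lambda>z. v z * f (y - z))" if "y \<in> ball x d" for y
      using mollify_integrable[OF v, of f y, OF _ bd[OF inside[OF that]]] by simp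
    show "integrable lborel (\<lambda>z. L * v z)" using kernel_integrable[OF v] by simp
    show "0 \<le> L * v z" for z using L kernel_nonneg[OF v] by simp
    show "\<bar>v z * f (y - z) - v z * f (x - z)\<bar> \<le> L * v z * norm (y - x)" if "y \<in> ball x d" for y z
    proof (cases "v z = 0")
      case False
      then have "\<bar>f (y - z) - f (x - z)\<bar> \<le> L * norm ((y - z) - (x - z))"
        using that d kernel_support[OF v] by (intro lip inside) auto
      then have "v z * \<bar>f (y - z) - f (x - z)\<bar> \<le> v z * (L * norm (y - x))"
        using kernel_nonneg[OF v, of z] by (intro mult_left_mono) simp_all
      then show ?thesis using kernel_nonneg[OF v, of z]
        by (simp add: abs_mult mult_ac flip: right_diff_distrib)
    qed simp
    show "AE z in lborel. GDERIV (\<lambda>y. v z * f (y - z)) x :> v z *\<^sub>R g (x - z)"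
      using AE_lborel_reflect[OF der, of x]
    proof eventually_elim
      case (elim z)
      show ?case
      proof (cases "v z = 0")
        case False
        then have "(f has_derivative (\<lambda>h. h \<bullet> g (x - z))) (at (x - z))"
          using elim inside[of x z] d kernel_support[OF v] by (simp add: gderiv_def)
        then have "((\<lambda>y. f (y - z)) has_derivative (\<lambda>h. h \<bullet> g (x - z))) (at x)"
          by (rule has_derivative_compose[rotated]) (auto intro!: derivative_eq_intros)
        then show ?thesis unfolding gderiv_def by (auto intro!: derivative_eq_intros)
      qed (simp add: GDERIV_const)
    qed
  qed measurable
  then show ?thesis by (simp add: mollify_def[abs_def])
qed

text \<open>
  The derivative falls on the kernel.  The point is existence: it makes the directional
  derivatives of a mollification linear in the direction, for any Lipschitz \<open>f\<close>.
\<close>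

lemma mollify_differentiable:
  fixes f :: "real ^ 'n \<Rightarrow> real"
  assumes v: "kernel r v" and [measurable]: "f \<in> borel_measurable borel"
    and bd: "\<And>R. \<exists>B. \<forall>x. norm x \<le> R \<longrightarrow> \<bar>f x\<bar> \<le> B"
  obtains D where "GDERIV (mollify v f) x :> D"
proof -
  obtain D L where D: "\<And>x. GDERIV v x :> D x" and [measurable]: "D \<in> borel_measurable borel"
    and L: "0 \<le> L" "\<And>x y. \<bar>v x - v y\<bar> \<le> L * norm (x - y)" using kernel_gradient[OF v] by metis
  note [measurable] = kernel_measurable[OF v]
  obtain b where b: "0 < b" "\<And>x. norm x \<le> b * N x" using norm_le_N by blast
  \<comment> \<open>Outside this ball, \<open>v (y - z)\<close> vanishes for all \<open>y\<close> at distance less than one from \<open>x\<close>.\<close>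
  define R where "R = norm x + 1 + b * r"
  obtain B where B: "\<And>x. norm x \<le> R \<Longrightarrow> \<bar>f x\<bar> \<le> B" using bd by blast
  define h where "h z = indicator (cball 0 R) z * f z" for z
  have [measurable]: "cball (0::real^'n) R \<in> sets borel" by (rule borel_closed) simp
  have [measurable]: "h \<in> borel_measurable borel" unfolding h_def by measurable
  have sub: "norm z \<le> R" if "y \<in> ball x 1" "v (y - z) \<noteq> 0" for y z
  proof -
    have "norm z \<le> norm x + norm (y - x) + norm (y - z)" by norm
    moreover have "norm (y - z) \<le> b * r"
      using order_trans[OF b(2) mult_left_mono[OF kernel_support[OF v that(2)]]] b(1) by simp
    moreover have "norm (y - x) < 1" using that by (simp add: dist_norm norm_minus_commute)
    ultimately show ?thesis by (simp add: R_def)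
  qed
  have eq: "v (y - z) * f z = v (y - z) * h z" if "y \<in> ball x 1" for y z
    using sub[OF that, of z] by (auto simp: h_def)
  have hB: "\<bar>h z\<bar> \<le> indicator (cball 0 R) z * B" for z
    using B by (auto simp: h_def indicator_def)
  have ih: "integrable lborel (\<lambda>z. indicator (cball 0 R) z * c)" for c :: real
    by (rule integrable_mult_left) (use emeasure_bounded_finite[of "cball 0 R"] in \<open>simp add: integrable_indicator_iff\<close>)
  have ih': "integrable lborel h"
    by (rule Bochner_Integration.integrable_bound[OF ih[of B]]) (use hB in \<open>auto intro!: AE_I2 order_trans[OF hB]\<close>)
  have "GDERIV (\<lambda>y. LINT z|lborel. v (y - z) * h z) x :> (LINT z|lborel. h z *\<^sub>R D (x - z))"
  proof (rule GDERIV_integral(2)[where d=1 and K="\<lambda>z. L * \<bar>h z\<bar>"])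
    fix y
    obtain M where M: "\<And>x. \<bar>v x\<bar> \<le> M"
    proof -
      have "\<bar>v x\<bar> \<le> \<bar>v 0\<bar> + L * (b * \<bar>r\<bar>)" for x
      proof (cases "v x = 0")
        case True then show ?thesis using L b by simp
      next
        case False
        have "norm x \<le> b * \<bar>r\<bar>"
          using b(2)[of x] mult_left_mono[OF kernel_support[OF v False], of b] b(1)
          by (smt (verit) mult_left_mono)
        then show ?thesis using L(2)[of x 0] L(1) mult_left_mono[of "norm x" "b * \<bar>r\<bar>" L] by simp
      qed
      then show thesis by (rule that)
    qed
    show "integrable lborel (\<lambda>z. v (y - z) * h z)"
    proof (rule Bochner_Integration.integrable_bound[of _ "\<lambda>z. M * h z"])
      show "AE z in lborel. norm (v (y - z) * h z) \<le> norm (M * h z)"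
        using M by (intro AE_I2) (auto simp: abs_mult intro!: mult_right_mono order_trans[OF M])
    qed (use ih' in auto)
  next
    fix y z
    have "\<bar>v (y - z) * h z - v (x - z) * h z\<bar> = \<bar>v (y - z) - v (x - z)\<bar> * \<bar>h z\<bar>"
      by (simp add: left_diff_distrib[symmetric] abs_mult)
    also have "\<dots> \<le> (L * norm (y - x)) * \<bar>h z\<bar>"
      using L(2)[of "y - z" "x - z"] by (intro mult_right_mono) auto
    finally show "\<bar>v (y - z) * h z - v (x - z) * h z\<bar> \<le> L * \<bar>h z\<bar> * norm (y - x)" by (simp add: mult_ac)
  next
    show "AE z in lborel. GDERIV (\<lambda>y. v (y - z) * h z) x :> h z *\<^sub>R D (x - z)"
    proof (rule AE_I2)
      fix z
      have "(v has_derivative (\<lambda>h. h \<bullet> D (x - z))) (at (x - z))"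
        using D by (simp add: gderiv_def)
      then have "((\<lambda>y. v (y - z)) has_derivative (\<lambda>h. h \<bullet> D (x - z))) (at x)"
        by (rule has_derivative_compose[rotated]) (auto intro!: derivative_eq_intros)
      then show "GDERIV (\<lambda>y. v (y - z) * h z) x :> h z *\<^sub>R D (x - z)"
        unfolding gderiv_def by (auto intro!: derivative_eq_intros)
    qed
  qed (use L ih' in auto)
  then have "((\<lambda>y. LINT z|lborel. v (y - z) * h z) has_derivative (\<lambda>t. t \<bullet> (LINT z|lborel. h z *\<^sub>R D (x - z)))) (at x)"
    by (simp add: gderiv_def)
  then have "(mollify v f has_derivative (\<lambda>t. t \<bullet> (LINT z|lborel. h z *\<^sub>R D (x - z)))) (at x)"
    by (rule has_derivative_transform_within_open[where s="ball x 1"])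
      (auto simp: mollify_reflect eq)
  then show thesis by (intro that) (simp add: gderiv_def)
qed

lemma continuous_on_mollify:
  fixes g :: "real ^ 'n \<Rightarrow> real ^ 'n"
  assumes v: "kernel r v" and [measurable]: "g \<in> borel_measurable borel"
    and B: "\<And>x. norm (g x) \<le> B"
  shows "continuous_on A (mollify v g)"
proof -
  have "continuous_on A (\<lambda>x. mollify v g x \<bullet> e)" for e
  proof (rule continuous_at_imp_continuous_on, rule ballI)
    fix x
    have "\<bar>g y \<bullet> e\<bar> \<le> B * norm e" for y
      using Cauchy_Schwarz_ineq2[of "g y" e] mult_right_mono[OF B[of y] norm_ge_zero[of e]] by simp
    then have "\<exists>C. \<forall>y. norm y \<le> R \<longrightarrow> \<bar>g y \<bullet> e\<bar> \<le> C" for R by blast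
    then obtain D where "GDERIV (mollify v (\<lambda>y. g y \<bullet> e)) x :> D"
      using mollify_differentiable[OF v, of "\<lambda>y. g y \<bullet> e" x] by auto
    moreover have "mollify v (\<lambda>y. g y \<bullet> e) = (\<lambda>x. mollify v g x \<bullet> e)"
      using inner_mollify[OF v, of g _ B e] B by auto
    ultimately show "isCont (\<lambda>x. mollify v g x \<bullet> e) x"
      by (auto simp: gderiv_def dest: has_derivative_continuous)
  qed
  then show ?thesis by (subst continuous_on_componentwise) blast
qed

text \<open>
  By Fubini both sides are the average of \<open>g (x - z - y)\<close> with weight \<open>v z * w y\<close>.
\<close>

lemma mollify_commute:
  fixes g :: "real ^ 'n \<Rightarrow> real ^ 'n"
  assumes v: "kernel r v" and w: "kernel s w" and [measurable]: "g \<in> borel_measurable borel"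
    and B: "\<And>x. norm (g x) \<le> B"
  shows "mollify v (mollify w g) x = mollify w (mollify v g) x"
proof -
  note [measurable] = kernel_measurable[OF v] kernel_measurable[OF w]
  define F where "F z y = (v z * w y) *\<^sub>R g (x - z - y)" for z y
  have "integrable (lborel \<Otimes>\<^sub>M lborel) (\<lambda>(z, y). F z y)"
  proof (rule Bochner_Integration.integrable_bound)
    show "integrable (lborel \<Otimes>\<^sub>M lborel) (\<lambda>p. B * (case p of (z, y) \<Rightarrow> v z * w y))"
      using integrable_product_function[OF kernel_integrable[OF v] kernel_integrable[OF w]] by (rule integrable_mult_right)
    show "(\<lambda>(z, y). F z y) \<in> borel_measurable (lborel \<Otimes>\<^sub>M lborel)" unfolding F_def by measurable
    have "0 \<le> B" using B[of 0] norm_ge_zero[of "g 0"] by linarith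
    then show "AE p in lborel \<Otimes>\<^sub>M lborel. norm (case p of (z, y) \<Rightarrow> F z y) \<le> norm (B * (case p of (z, y) \<Rightarrow> v z * w y))"
      using B by (intro AE_I2) (auto simp: F_def abs_mult mult.commute[of B] intro!: mult_left_mono)
  qed
  from lborel_pair.Fubini_integral[OF this]
  have "(LINT y|lborel. LINT z|lborel. F z y) = (LINT z|lborel. LINT y|lborel. F z y)" .
  moreover have "(LINT y|lborel. F z y) = v z *\<^sub>R mollify w g (x - z)" for z
    unfolding F_def mollify_def by (simp flip: scaleR_scaleR)
  moreover have "(LINT z|lborel. F z y) = w y *\<^sub>R mollify v g (x - y)" for y
  proof -
    have "F z y = w y *\<^sub>R (v z *\<^sub>R g (x - y - z))" for z
      by (simp add: F_def mult.commute diff_diff_eq add.commute)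
    then show ?thesis by (simp add: mollify_def del: scaleR_scaleR)
  qed
  ultimately show ?thesis by (simp add: mollify_def)
qed

end

section \<open>Functions with vanishing mollifications\<close>

text \<open>
  Almost every \<open>g x\<close> is the limit of the averages of \<open>g\<close> over small cubes at \<open>x\<close>.
\<close>

lemma AE_zero_of_zero_box_integrals:
  fixes g :: "'a::euclidean_space \<Rightarrow> real"
  assumes S: "open S" and [measurable]: "g \<in> borel_measurable borel" and B: "\<And>x. \<bar>g x\<bar> \<le> B"
    and zero: "\<And>a b. cbox a b \<subseteq> S \<Longrightarrow> (LINT x|lborel. indicator (cbox a b) x * g x) = 0"
  shows "AE x in lborel. x \<in> S \<longrightarrow> g x = 0"
proof -
  have i: "set_integrable lborel (cbox a b) g" for a b
    unfolding set_integrable_def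
  proof (rule Bochner_Integration.integrable_bound)
    show "integrable lborel (\<lambda>x. indicator (cbox a b) x * B)"
      by (rule integrable_mult_left) (simp add: integrable_indicator_iff emeasure_lborel_cbox_eq)
    have "\<bar>g x\<bar> \<le> \<bar>B\<bar>" for x using B[of x] by simp
    then show "AE x in lborel. norm (indicator (cbox a b) x *\<^sub>R g x) \<le> norm (indicator (cbox a b) x * B)"
      by (intro AE_I2) (auto simp: indicator_def)
  qed measurable
  have io: "g integrable_on cbox a b" for a b
    using set_borel_integral_eq_integral(1)[OF i] .
  have z: "integral (cbox a b) g = 0" if "cbox a b \<subseteq> S" for a b
    using set_borel_integral_eq_integral(2)[OF i, of a b] zero[OF that]
    by (simp add: set_lebesgue_integral_def)
  obtain E where E: "negligible E" and lim: "\<And>x e. x \<notin> E \<Longrightarrow> 0 < e \<Longrightarrow>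
      \<exists>d>0. \<forall>h. 0 < h \<and> h < d \<longrightarrow> norm (integral (cbox x (x + h *\<^sub>R One)) g /\<^sub>R h ^ DIM('a) - g x) < e"
    using integrable_ccontinuous_explicit[of g, OF io] by blast
  show ?thesis
    using AE_lborel_not_in_negligible[OF E]
  proof (eventually_elim, intro impI)
    fix x assume x: "x \<notin> E" "x \<in> S"
    obtain \<epsilon> where \<epsilon>: "0 < \<epsilon>" "ball x \<epsilon> \<subseteq> S" using S x open_contains_ball by blast
    have "\<bar>g x\<bar> < e" if "0 < e" for e
    proof -
      obtain d where d: "0 < d" "\<And>h. 0 < h \<Longrightarrow> h < d \<Longrightarrow>
          norm (integral (cbox x (x + h *\<^sub>R One)) g /\<^sub>R h ^ DIM('a) - g x) < e"
        using lim[OF x(1) \<open>0 < e\<close>] by blast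
      \<comment> \<open>The diameter of the cube is at most \<open>DIM('a)\<close> times its edge \<open>h\<close>.\<close>
      define h where "h = min (d / 2) (\<epsilon> / (2 * DIM('a)))"
      have h: "0 < h" "h < d" "h * DIM('a) < \<epsilon>"
      proof -
        show "0 < h" "h < d" using d \<epsilon> by (auto simp: h_def)
        have "h * DIM('a) \<le> \<epsilon> / (2 * DIM('a)) * DIM('a)" by (intro mult_right_mono) (auto simp: h_def)
        then show "h * DIM('a) < \<epsilon>" using \<epsilon> by simp
      qed
      have "cbox x (x + h *\<^sub>R One) \<subseteq> ball x \<epsilon>"
      proof
        fix y assume y: "y \<in> cbox x (x + h *\<^sub>R One)"
        have "norm (y - x) \<le> (\<Sum>b\<in>Basis. \<bar>(y - x) \<bullet> b\<bar>)" by (rule norm_le_l1)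
        also have "\<dots> \<le> (\<Sum>b\<in>(Basis::'a set). h)"
          using y by (intro sum_mono) (auto simp: mem_box inner_simps)
        also have "\<dots> < \<epsilon>" using h(3) by (simp add: mult.commute)
        finally show "y \<in> ball x \<epsilon>" by (simp add: dist_norm norm_minus_commute)
      qed
      then have "integral (cbox x (x + h *\<^sub>R One)) g = 0" using \<epsilon> by (intro z) auto
      then show ?thesis using d(2)[OF h(1,2)] by simp
    qed
    then show "g x = 0" by (metis abs_le_zero_iff dense_ge less_imp_le)
  qed
qed

lemma integral_lborel_translate:
  fixes f :: "'a::euclidean_space \<Rightarrow> 'b::{banach, second_countable_topology}"
  assumes [measurable]: "f \<in> borel_measurable borel"
  shows "(LINT y|lborel. f (z + y)) = (LINT x|lborel. f x)"
  by (subst (2) lborel_distr_plus[of z, symmetric]) (simp add: integral_distr)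

text \<open>
  A change of variables moves the translation from \<open>g\<close> to the box, whose indicator function is
  continuous off the frontier, a null set.
\<close>

lemma translated_box_integral_continuous:
  fixes g :: "'a::euclidean_space \<Rightarrow> real"
  assumes [measurable]: "g \<in> borel_measurable borel" and B: "\<And>x. \<bar>g x\<bar> \<le> B"
  shows "isCont (\<lambda>z. LINT x|lborel. indicator (cbox a b) x * g (x - z)) 0"
proof -
  define W where "W z = (LINT x|lborel. indicator (cbox a b) x * g (x - z))" for z
  have W: "W z = (LINT y|lborel. indicator (cbox a b) (z + y) * g y)" for z
    unfolding W_def using integral_lborel_translate[of "\<lambda>x. indicator (cbox a b) x * g (x - z)" z] by simp
  obtain R where R: "cbox a b \<subseteq> cball 0 R"
    using bounded_cbox[of a b] unfolding bounded_iff by (auto simp: subset_iff)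
  have [measurable]: "cball (0::'a) (R + 1) \<in> sets borel" by (rule borel_closed) simp
  have B0: "0 \<le> B" using B[of 0] by simp
  have "W \<midarrow>0\<rightarrow> W 0"
  proof (subst tendsto_at_iff_sequentially, intro allI impI)
    fix Z :: "nat \<Rightarrow> 'a" assume "\<forall>i. Z i \<in> UNIV - {0}" and lim: "Z \<longlonglongrightarrow> 0"
    obtain n where n: "\<And>i. norm (Z (i + n)) < 1"
      using lim unfolding lim_sequentially dist_norm by (metis diff_zero le_add2 zero_less_one)
    have "(\<lambda>i. LINT y|lborel. indicator (cbox a b) (Z (i + n) + y) * g y)
        \<longlonglongrightarrow> (LINT y|lborel. indicator (cbox a b) (0 + y) * g y)"
    proof (rule integral_dominated_convergence[where w="\<lambda>y. indicator (cball 0 (R + 1)) y * B"])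
      show "integrable lborel (\<lambda>y. indicator (cball (0::'a) (R + 1)) y * B)"
        by (rule integrable_mult_left)
          (use emeasure_bounded_finite[of "cball (0::'a) (R + 1)"] in \<open>simp add: integrable_indicator_iff\<close>)
      show "AE y in lborel. norm (indicator (cbox a b) (Z (i + n) + y) * g y) \<le> indicator (cball 0 (R + 1)) y * B" for i
      proof (rule AE_I2)
        fix y
        show "norm (indicator (cbox a b) (Z (i + n) + y) * g y) \<le> indicator (cball 0 (R + 1)) y * B"
        proof (cases "Z (i + n) + y \<in> cbox a b")
          case True
          then have "norm (Z (i + n) + y) \<le> R" using R by auto
          then have "norm y \<le> R + 1"
            using n[of i] norm_triangle_ineq4[of "Z (i + n) + y" "Z (i + n)"] by simp
          then show ?thesis using B True by simp
        qed (use B0 in simp)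
      qed
      have "AE y in lborel. y \<notin> frontier (cbox a b)"
        by (rule AE_lborel_not_in_negligible[OF negligible_convex_frontier[OF convex_box(1)]])
      then show "AE y in lborel. (\<lambda>i. indicator (cbox a b) (Z (i + n) + y) * g y)
          \<longlonglongrightarrow> indicator (cbox a b) (0 + y) * g y"
      proof eventually_elim
        case (elim y)
        have "isCont (indicator (cbox a b) :: 'a \<Rightarrow> real) (0 + y)"
          using elim by (simp add: isCont_indicator)
        moreover have "(\<lambda>i. Z (i + n) + y) \<longlonglongrightarrow> 0 + y"
          by (intro tendsto_add tendsto_const LIMSEQ_ignore_initial_segment[OF lim])
        ultimately have "(\<lambda>i. indicator (cbox a b) (Z (i + n) + y) :: real) \<longlonglongrightarrow> indicator (cbox a b) (0 + y)"
          by (rule isCont_tendsto_compose)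
        then show ?case by (rule tendsto_mult_right)
      qed
    qed measurable
    then have "(\<lambda>i. W (Z (i + n))) \<longlonglongrightarrow> W 0" by (simp add: W)
    then show "(W \<circ> Z) \<longlonglongrightarrow> W 0" unfolding o_def by (rule LIMSEQ_offset)
  qed
  then show ?thesis unfolding W_def[abs_def] isCont_def by simp
qed

context normed_coordinates
begin

text \<open>
  Let \<open>W z\<close> be the integral of \<open>g\<close> over the box \<open>B\<close> translated by \<open>- z\<close>.  By Fubini, the integral over
  \<open>B\<close> of the mollification of \<open>g\<close> is the average of \<open>W\<close> with the weight \<open>v k\<close>.  It vanishes for all
  large \<open>k\<close>, and as \<open>W\<close> is continuous at zero it tends to \<open>W 0\<close>, the integral of \<open>g\<close> over \<open>B\<close>.
\<close>

lemma AE_zero_of_mollify_zero: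
  fixes g :: "real ^ 'n \<Rightarrow> real"
  assumes S: "open S" and v: "\<And>k. m \<le> k \<Longrightarrow> kernel (r k) (v k)" and r: "r \<longlonglongrightarrow> 0"
    and [measurable]: "g \<in> borel_measurable borel" and B: "\<And>x. \<bar>g x\<bar> \<le> B"
    and zero: "\<And>k x. m \<le> k \<Longrightarrow> x \<in> S \<Longrightarrow> mollify (v k) g x = 0"
  shows "AE x in lborel. x \<in> S \<longrightarrow> g x = 0"
proof (rule AE_zero_of_zero_box_integrals[OF S _ B])
  show "g \<in> borel_measurable borel" by measurable
  fix a b assume sub: "cbox a b \<subseteq> S"
  define W where "W z = (LINT x|lborel. indicator (cbox a b) x * g (x - z))" for z
  have [measurable]: "W \<in> borel_measurable borel" unfolding W_def by measurable
  have Wz: "(LINT z|lborel. v k z * W z) = 0" if k: "m \<le> k" for k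
  proof -
    note [measurable] = kernel_measurable[OF v[OF k]]
    define F where "F z x = v k z * (indicator (cbox a b) x * g (x - z))" for z x
    have "integrable (lborel \<Otimes>\<^sub>M lborel) (\<lambda>(z, x). F z x)"
    proof (rule Bochner_Integration.integrable_bound)
      have "integrable lborel (indicator (cbox a b) :: real ^ 'n \<Rightarrow> real)"
        by (simp add: integrable_indicator_iff emeasure_lborel_cbox_eq)
      from integrable_product_function[OF kernel_integrable[OF v[OF k]] this]
      show "integrable (lborel \<Otimes>\<^sub>M lborel) (\<lambda>p. B * (case p of (z, x) \<Rightarrow> v k z * indicator (cbox a b) x))"
        by (rule integrable_mult_right)
      show "(\<lambda>(z, x). F z x) \<in> borel_measurable (lborel \<Otimes>\<^sub>M lborel)" unfolding F_def by measurable
      have "\<bar>g y\<bar> \<le> \<bar>B\<bar>" for y using B[of y] by simp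
      then show "AE p in lborel \<Otimes>\<^sub>M lborel. norm (case p of (z, x) \<Rightarrow> F z x)
          \<le> norm (B * (case p of (z, x) \<Rightarrow> v k z * indicator (cbox a b) x))"
        by (intro AE_I2) (auto simp: F_def abs_mult mult.commute[of "\<bar>B\<bar>"] mult.assoc intro!: mult_left_mono)
    qed
    from lborel_pair.Fubini_integral[OF this]
    have "(LINT x|lborel. LINT z|lborel. F z x) = (LINT z|lborel. LINT x|lborel. F z x)" .
    moreover have "(LINT x|lborel. F z x) = v k z * W z" for z
      unfolding F_def W_def by simp
    moreover have "(LINT z|lborel. F z x) = 0" for x
    proof -
      have "(LINT z|lborel. F z x) = indicator (cbox a b) x * mollify (v k) g x"
        unfolding F_def mollify_def by (cases "x \<in> cbox a b") auto
      then show ?thesis using zero[OF k, of x] sub by (cases "x \<in> cbox a b") auto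
    qed
    ultimately show ?thesis by simp
  qed
  have "\<bar>W 0\<bar> \<le> e" if e: "0 < e" for e
  proof -
    have "isCont W 0"
      unfolding W_def using B by (intro translated_box_integral_continuous) auto
    then obtain d where d: "0 < d" "\<And>z. norm z < d \<Longrightarrow> \<bar>W z - W 0\<bar> < e"
      using e unfolding continuous_at_eps_delta by (auto simp: dist_norm)
    obtain \<beta> where b: "0 < \<beta>" "\<And>x. norm x \<le> \<beta> * N x" using norm_le_N by blast
    have "\<forall>\<^sub>F k in sequentially. r k < d / \<beta>"
      using order_tendstoD(2)[OF r, of "d / \<beta>"] d b by simp
    then have "\<forall>\<^sub>F k in sequentially. m \<le> k \<and> r k < d / \<beta>"
      using eventually_ge_at_top[of m] by eventually_elim auto
    then obtain k where k: "m \<le> k" "r k < d / \<beta>" using eventually_happens'[OF sequentially_bot] by blast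
    have "norm (mollify (v k) (\<lambda>y. W (- y)) 0 - W (- 0)) \<le> e"
    proof (rule norm_mollify_minus_le[OF v[OF k(1)]])
      fix z assume "N z \<le> r k"
      then have "\<beta> * N z \<le> \<beta> * r k" using b by simp
      moreover have "\<beta> * r k < d" using k(2) b by (simp add: field_simps)
      ultimately have "\<beta> * N z < d" by simp
      then have "norm z < d" using b(2)[of z] by simp
      then show "norm (W (- (0 - z)) - W (- 0)) \<le> e" using d(2)[of z] by simp
    qed measurable
    then show ?thesis using Wz[OF k(1)] by (simp add: mollify_def)
  qed
  then have "W 0 = 0" by (metis abs_le_zero_iff field_le_epsilon add_0)
  then show "(LINT x|lborel. indicator (cbox a b) x * g x) = 0" by (simp add: W_def)
qed

end

section \<open>Rademacher's theorem\<close>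

lemma AE_lborel_translate:
  fixes c :: "'a::euclidean_space"
  assumes "AE y in lborel. P y"
  shows "AE y in lborel. P (c + y)"
  using assms by (subst (asm) lborel_distr_plus[of c, symmetric]) (rule AE_distrD[rotated], auto)

lemma
  fixes f :: "'a::euclidean_space \<Rightarrow> real"
  assumes lip: "\<And>x y. \<bar>f x - f y\<bar> \<le> L * norm (x - y)"
  shows lipschitz_constant_nonneg: "0 \<le> L"
    and lipschitz_continuous: "continuous_on A f"
    and lipschitz_measurable: "f \<in> borel_measurable borel"
proof -
  have "0 \<le> L * norm (One::'a)" using lip[of One 0] abs_ge_zero order_trans by fastforce
  then show L: "0 \<le> L" by (simp add: zero_le_mult_iff)
  show cont: "continuous_on A f" for A
    by (rule lipschitz_on_continuous_on[of L]) (use lip L in \<open>auto simp: lipschitz_on_def dist_norm\<close>)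
  show "f \<in> borel_measurable borel" by (rule borel_measurable_continuous_onI[OF cont])
qed

text \<open>
  Lets differentiability be expressed by countably many conditions, so that the set of points of
  differentiability is Borel.
\<close>

lemma abs_le_of_rational_dense:
  fixes \<phi> :: "real \<Rightarrow> real"
  assumes U: "open U" and cont: "continuous_on U \<phi>" and le: "\<And>q. of_rat q \<in> U \<Longrightarrow> \<bar>\<phi> (of_rat q)\<bar> \<le> e"
    and t: "t \<in> U"
  shows "\<bar>\<phi> t\<bar> \<le> e"
proof (rule ccontr)
  assume "\<not> \<bar>\<phi> t\<bar> \<le> e"
  moreover have "open (U \<inter> (\<lambda>s. \<bar>\<phi> s\<bar>) -` {e<..})"
    by (intro continuous_open_preimage continuous_on_rabs cont U) auto
  ultimately obtain d where d: "0 < d" "ball t d \<subseteq> U \<inter> (\<lambda>s. \<bar>\<phi> s\<bar>) -` {e<..}"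
    using t by (elim openE[where x=t]) auto
  obtain q where "t < of_rat q" "of_rat q < t + d" using of_rat_dense[of t "t + d"] d by auto
  then have "of_rat q \<in> ball t d" by (simp add: dist_real_def)
  then show False using d le by fastforce
qed

text \<open>
  On each line parallel to \<open>v\<close> the derivative exists almost everywhere by the one-dimensional case.
  Fubini's theorem makes the exceptional set null; for this the set has to be measurable, which is
  why the difference quotients are tested with rational increments only.
\<close>

lemma lipschitz_directional_derivative:
  fixes f :: "'a::euclidean_space \<Rightarrow> real" and v :: 'a
  assumes lip: "\<And>x y. \<bar>f x - f y\<bar> \<le> L * norm (x - y)"
  obtains D where "D \<in> borel_measurable borel" "\<And>x. \<bar>D x\<bar> \<le> L * norm v"
    "AE x in lborel. ((\<lambda>t. (f (x + t *\<^sub>R v) - f x) / t) \<longlongrightarrow> D x) (at 0)"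
proof -
  note L = lipschitz_constant_nonneg[OF lip]
  note contf = lipschitz_continuous[OF lip, of UNIV] and [measurable] = lipschitz_measurable[OF lip]
  define Q where "Q t x = (f (x + t *\<^sub>R v) - f x) / t" for t x
  have Qb: "\<bar>Q t x\<bar> \<le> L * norm v" for t x
  proof (cases "t = 0")
    case False
    then show ?thesis using lip[of "x + t *\<^sub>R v" x] by (simp add: Q_def abs_divide divide_le_eq mult_ac)
  qed (simp add: Q_def L)
  define E where "E x = lim (\<lambda>n. Q (inverse (real (Suc n))) x)" for x
  have [measurable]: "E \<in> borel_measurable borel" unfolding E_def Q_def by measurable
  \<comment> \<open>Where the difference quotients diverge, \<open>E\<close> is arbitrary; the cut-off bounds \<open>D\<close> everywhere.\<close>
  define D where "D x = (if \<bar>E x\<bar> \<le> L * norm v then E x else 0)" for x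
  have D[measurable]: "D \<in> borel_measurable borel" unfolding D_def by measurable
  have D_lim: "D x = l" if "((\<lambda>t. Q t x) \<longlongrightarrow> l) (at 0)" for x l
  proof -
    have "(\<lambda>n. Q (inverse (real (Suc n))) x) \<longlonglongrightarrow> l"
      using that LIMSEQ_inverse_real_of_nat unfolding tendsto_at_iff_sequentially by (auto simp: o_def)
    then have E: "E x = l" unfolding E_def by (rule limI)
    have "\<bar>l\<bar> \<le> L * norm v"
      by (rule tendsto_upperbound[OF tendsto_rabs[OF that]]) (use Qb in auto)
    then show ?thesis by (simp add: D_def E)
  qed
  define P where "P x \<longleftrightarrow> (\<forall>m::nat. \<exists>j::nat. \<forall>q::rat.
      0 < \<bar>real_of_rat q\<bar> \<and> \<bar>real_of_rat q\<bar> < inverse (real (Suc j)) \<longrightarrow> \<bar>Q (real_of_rat q) x - D x\<bar> \<le> inverse (real (Suc m)))" for x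
  have P_iff: "P x \<longleftrightarrow> ((\<lambda>t. Q t x) \<longlongrightarrow> D x) (at 0)" for x
  proof
    assume P: "P x"
    show "((\<lambda>t. Q t x) \<longlongrightarrow> D x) (at 0)"
      unfolding tendsto_iff eventually_at
    proof (intro allI impI)
      fix e :: real assume "0 < e"
      then obtain m where m: "inverse (real (Suc m)) < e" using reals_Archimedean by blast
      obtain j where j: "\<And>q. 0 < \<bar>real_of_rat q\<bar> \<Longrightarrow> \<bar>real_of_rat q\<bar> < inverse (real (Suc j)) \<Longrightarrow>
          \<bar>Q (real_of_rat q) x - D x\<bar> \<le> inverse (real (Suc m))"
        using P unfolding P_def by blast
      define U where "U = {t. 0 < \<bar>t\<bar> \<and> \<bar>t\<bar> < inverse (real (Suc j))}"
      have "open U" unfolding U_def by (intro open_Collect_conj open_Collect_less continuous_intros)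
      moreover have "continuous_on U (\<lambda>t. Q t x - D x)"
        unfolding Q_def by (intro continuous_intros continuous_on_compose2[OF contf]) (auto simp: U_def)
      ultimately have "\<bar>Q t x - D x\<bar> \<le> inverse (real (Suc m))" if "t \<in> U" for t
        using j that by (rule abs_le_of_rational_dense[where U=U]) (auto simp: U_def)
      then show "\<exists>d>0. \<forall>t\<in>UNIV. t \<noteq> 0 \<and> dist t 0 < d \<longrightarrow> dist (Q t x) (D x) < e"
        using m by (intro exI[of _ "inverse (real (Suc j))"]) (auto simp: U_def dist_real_def intro: le_less_trans)
    qed
  next
    assume lim: "((\<lambda>t. Q t x) \<longlongrightarrow> D x) (at 0)"
    show "P x" unfolding P_def
    proof
      fix m :: nat
      have "0 < inverse (real (Suc m))" by simp
      then obtain d where d: "0 < d" "\<And>t. t \<noteq> 0 \<Longrightarrow> \<bar>t\<bar> < d \<Longrightarrow> \<bar>Q t x - D x\<bar> < inverse (real (Suc m))"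
        using LIM_D[OF lim, of "inverse (real (Suc m))"] by auto
      obtain j where "inverse (real (Suc j)) < d" using d reals_Archimedean by blast
      then show "\<exists>j::nat. \<forall>q::rat. 0 < \<bar>real_of_rat q\<bar> \<and> \<bar>real_of_rat q\<bar> < inverse (real (Suc j)) \<longrightarrow>
          \<bar>Q (real_of_rat q) x - D x\<bar> \<le> inverse (real (Suc m))"
        using d(2) by (intro exI[of _ j]) (auto intro!: less_imp_le)
    qed
  qed
  have [measurable]: "Measurable.pred borel P" unfolding P_def Q_def by measurable
  have lines: "AE t in lborel. P (x + t *\<^sub>R v)" for x
  proof -
    define F where "F t = f (x + t *\<^sub>R v)" for t
    have "\<bar>F s - F t\<bar> \<le> (L * norm v) * \<bar>s - t\<bar>" for s t
      using lip[of "x + s *\<^sub>R v" "x + t *\<^sub>R v"] by (simp add: F_def mult_ac flip: scaleR_diff_left)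
    from lipschitz_real_derivative[OF this] obtain g
      where "AE t in lborel. (F has_real_derivative g t) (at t)" by metis
    then show ?thesis
    proof eventually_elim
      case (elim t)
      have "(\<lambda>s. (F (t + s) - F t) / s) = (\<lambda>s. Q s (x + t *\<^sub>R v))"
        by (simp add: F_def Q_def algebra_simps)
      then have lim: "((\<lambda>s. Q s (x + t *\<^sub>R v)) \<longlongrightarrow> g t) (at 0)" using elim by (simp add: DERIV_def)
      then show ?case using D_lim[OF lim] by (simp add: P_iff)
    qed
  qed
  have "AE x in lborel. AE t in lborel. P (x + t *\<^sub>R v)" using lines by simp
  then have "AE t in lborel. AE x in lborel. P (x + t *\<^sub>R v)"
    by (subst (asm) lborel_pair.AE_commute) measurable
  \<comment> \<open>A single good \<open>t\<close> is enough, as the exceptional set is only translated by \<open>t *\<^sub>R v\<close>.\<close>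
  then obtain t :: real where t: "AE x in lborel. P (x + t *\<^sub>R v)"
    using eventually_happens'[of "ae_filter lborel"] by (auto simp: ae_filter_eq_bot_iff)
  have "AE x in lborel. P x"
    using AE_lborel_translate[OF t, of "- (t *\<^sub>R v)"] by simp
  then have "AE x in lborel. ((\<lambda>t. Q t x) \<longlongrightarrow> D x) (at 0)" by (simp add: P_iff)
  then show thesis by (intro that[OF D]) (auto simp: D_def Q_def L)
qed

text \<open>
  By compactness finitely many of the directions in \<open>V\<close> approximate all unit vectors, and along these
  the difference quotients converge uniformly.  The Lipschitz bound carries the estimate over to
  nearby directions.
\<close>

lemma GDERIV_of_dense_directional:
  fixes f :: "'a::euclidean_space \<Rightarrow> real"
  assumes lip: "\<And>x y. \<bar>f x - f y\<bar> \<le> L * norm (x - y)"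
    and V: "\<And>U::'a set. open U \<Longrightarrow> U \<noteq> {} \<Longrightarrow> \<exists>v\<in>V. v \<in> U"
    and lim: "\<And>v. v \<in> V \<Longrightarrow> ((\<lambda>t. (f (x + t *\<^sub>R v) - f x) / t) \<longlongrightarrow> w \<bullet> v) (at 0)"
  shows "GDERIV f x :> w"
  unfolding gderiv_def has_derivative_at_alt
proof (intro conjI allI impI)
  show "bounded_linear (\<lambda>h. h \<bullet> w)" by (rule bounded_linear_inner_left)
  fix e :: real assume e: "0 < e"
  \<comment> \<open>Collects the errors of replacing a direction by a nearby one, in \<open>f\<close> and in \<open>w\<close>, and of the limit itself.\<close>
  define K where "K = \<bar>L\<bar> + norm w + 1"
  have K: "0 < K" by (simp add: K_def add_nonneg_pos)
  define \<eta> where "\<eta> = e / K"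
  have \<eta>: "0 < \<eta>" using e K by (simp add: \<eta>_def)
  have "sphere (0::'a) 1 \<subseteq> (\<Union>v\<in>V. ball v \<eta>)"
  proof
    fix \<theta> :: 'a
    obtain v where "v \<in> V" "v \<in> ball \<theta> \<eta>" using V[of "ball \<theta> \<eta>"] \<eta> by auto
    then show "\<theta> \<in> (\<Union>v\<in>V. ball v \<eta>)" by (auto simp: dist_commute)
  qed
  then obtain T where T: "T \<subseteq> V" "finite T" "sphere 0 1 \<subseteq> (\<Union>v\<in>T. ball v \<eta>)"
    using compactE_image[OF compact_sphere, of V "\<lambda>v. ball v \<eta>" 0 1] by (metis open_ball)
  have "\<forall>\<^sub>F t in at (0::real). \<forall>v\<in>T. \<bar>(f (x + t *\<^sub>R v) - f x) / t - w \<bullet> v\<bar> < \<eta>"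
  proof (rule eventually_ball_finite[OF T(2)], rule ballI)
    fix v assume "v \<in> T"
    then show "\<forall>\<^sub>F t in at (0::real). \<bar>(f (x + t *\<^sub>R v) - f x) / t - w \<bullet> v\<bar> < \<eta>"
      using tendstoD[OF lim \<eta>, of v] T by (auto simp: dist_real_def)
  qed
  then obtain d where d: "0 < d" "\<And>t v. t \<noteq> 0 \<Longrightarrow> \<bar>t\<bar> < d \<Longrightarrow> v \<in> T \<Longrightarrow> \<bar>(f (x + t *\<^sub>R v) - f x) / t - w \<bullet> v\<bar> < \<eta>"
    unfolding eventually_at by (auto simp: dist_real_def)
  show "\<exists>d>0. \<forall>y. norm (y - x) < d \<longrightarrow> norm (f y - f x - (y - x) \<bullet> w) \<le> e * norm (y - x)"
  proof (intro exI[of _ d] conjI allI impI)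
    fix y assume y: "norm (y - x) < d"
    show "norm (f y - f x - (y - x) \<bullet> w) \<le> e * norm (y - x)"
    proof (cases "y = x")
      case False
      define t where "t = norm (y - x)"
      define \<theta> where "\<theta> = (y - x) /\<^sub>R t"
      have t: "0 < t" "t < d" using False y by (auto simp: t_def)
      have y_eq: "y = x + t *\<^sub>R \<theta>" using t by (simp add: \<theta>_def)
      have "norm \<theta> = 1" using t by (simp add: \<theta>_def flip: t_def)
      then obtain v where v: "v \<in> T" "norm (\<theta> - v) < \<eta>"
        using T(3) by (force simp: dist_norm norm_minus_commute)
      have "\<bar>f (x + t *\<^sub>R \<theta>) - f (x + t *\<^sub>R v)\<bar> \<le> L * (t * norm (\<theta> - v))"
        using lip[of "x + t *\<^sub>R \<theta>" "x + t *\<^sub>R v"] t by (simp flip: scaleR_diff_right)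
      also have "\<dots> \<le> \<bar>L\<bar> * (t * \<eta>)"
        using t v by (intro mult_mono) auto
      finally have 1: "\<bar>f (x + t *\<^sub>R \<theta>) - f (x + t *\<^sub>R v)\<bar> \<le> \<bar>L\<bar> * (t * \<eta>)" .
      have "\<bar>f (x + t *\<^sub>R v) - f x - t * (w \<bullet> v)\<bar> = t * \<bar>(f (x + t *\<^sub>R v) - f x) / t - w \<bullet> v\<bar>"
      proof -
        have "f (x + t *\<^sub>R v) - f x - t * (w \<bullet> v) = t * ((f (x + t *\<^sub>R v) - f x) / t - w \<bullet> v)"
          using t by (simp add: field_simps)
        then show ?thesis using t by (simp add: abs_mult)
      qed
      also have "\<dots> \<le> t * \<eta>" using d(2)[of t v] t v by (intro mult_left_mono) auto
      finally have 2: "\<bar>f (x + t *\<^sub>R v) - f x - t * (w \<bullet> v)\<bar> \<le> t * \<eta>" .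
      have "\<bar>t * (w \<bullet> (v - \<theta>))\<bar> \<le> t * (norm w * \<eta>)"
        using t v order_trans[OF Cauchy_Schwarz_ineq2[of w "v - \<theta>"] mult_left_mono[of "norm (v - \<theta>)" \<eta> "norm w"]]
        by (simp add: abs_mult norm_minus_commute)
      then have 3: "\<bar>t * (w \<bullet> v) - t * (w \<bullet> \<theta>)\<bar> \<le> t * (norm w * \<eta>)"
        by (simp add: inner_diff_right right_diff_distrib)
      have "f y - f x - (y - x) \<bullet> w = (f (x + t *\<^sub>R \<theta>) - f (x + t *\<^sub>R v))
          + (f (x + t *\<^sub>R v) - f x - t * (w \<bullet> v)) + (t * (w \<bullet> v) - t * (w \<bullet> \<theta>))"
        by (simp add: y_eq inner_commute)
      then have "norm (f y - f x - (y - x) \<bullet> w) \<le> \<bar>L\<bar> * (t * \<eta>) + t * \<eta> + t * (norm w * \<eta>)"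
        using 1 2 3 by simp
      also have "\<dots> = K * \<eta> * t" by (simp add: K_def algebra_simps)
      also have "\<dots> = e * norm (y - x)" using K by (simp add: \<eta>_def t_def)
      finally show ?thesis .
    qed simp
  qed (use d in simp)
qed

locale mollifying_sequence = normed_coordinates N for N :: "real ^ 'n \<Rightarrow> real" +
  fixes v :: "nat \<Rightarrow> real ^ 'n \<Rightarrow> real"
  assumes kernel: "0 < k \<Longrightarrow> kernel (1 / real k) (v k)"
begin

lemma AE_zero_of_mollification_sequence_zero:
  fixes g :: "real ^ 'n \<Rightarrow> real"
  assumes "open S" "g \<in> borel_measurable borel" "\<And>x. \<bar>g x\<bar> \<le> B"
    and "\<And>k x. m \<le> k \<Longrightarrow> x \<in> S \<Longrightarrow> mollify (v k) g x = 0"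
  shows "AE x in lborel. x \<in> S \<longrightarrow> g x = 0"
proof (rule AE_zero_of_mollify_zero[where r="\<lambda>k. 1 / real k" and v=v and m="max 1 m"])
  show "(\<lambda>k. 1 / real k) \<longlonglongrightarrow> 0" by (rule lim_1_over_n)
qed (use assms kernel in auto)

text \<open>
  The directional derivative of the mollification is the mollification of the directional
  derivative, by dominated convergence along the increments \<open>1 / (n + 1)\<close>.
\<close>

lemma mollify_directional:
  fixes f :: "real ^ 'n \<Rightarrow> real"
  assumes lip: "\<And>x y. \<bar>f x - f y\<bar> \<le> L * norm (x - y)" and k: "0 < k"
    and [measurable]: "D \<in> borel_measurable borel"
    and der: "AE x in lborel. ((\<lambda>t. (f (x + t *\<^sub>R e) - f x) / t) \<longlongrightarrow> D x) (at 0)"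
    and G: "GDERIV (mollify (v k) f) x :> G"
  shows "mollify (v k) D x = G \<bullet> e"
proof -
  note [measurable] = kernel_measurable[OF kernel[OF k]]
  note L = lipschitz_constant_nonneg[OF lip]
  note [measurable] = lipschitz_measurable[OF lip]
  obtain b where b: "0 < b" "\<And>x. norm x \<le> b * N x" using norm_le_N by blast
  have i: "integrable lborel (\<lambda>z. v k z * f (y - z))" for y
  proof -
    have "\<bar>f (y - z)\<bar> \<le> \<bar>f y\<bar> + L * (b * (1 / real k))" if "N z \<le> 1 / real k" for z
    proof -
      have "norm z \<le> b * (1 / real k)" using order_trans[OF b(2) mult_left_mono[OF that]] b(1) by simp
      then have "L * norm z \<le> L * (b * (1 / real k))" using L by (rule mult_left_mono)
      then show ?thesis using lip[of "y - z" y] by simp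
    qed
    then show ?thesis using mollify_integrable[OF kernel[OF k], of f y] by force
  qed
  define s where "s n = inverse (real (Suc n))" for n
  have s: "0 < s n" for n by (simp add: s_def)
  have s0: "s \<longlonglongrightarrow> 0" unfolding s_def by (rule LIMSEQ_inverse_real_of_nat)
  have seq: "(\<lambda>n. F (s n)) \<longlonglongrightarrow> l" if "(F \<longlongrightarrow> l) (at 0)" for F :: "real \<Rightarrow> real" and l
  proof -
    have "(F \<circ> s) \<longlonglongrightarrow> l"
      using that[unfolded tendsto_at_iff_sequentially, rule_format, of s] s s0
      by (metis Diff_iff UNIV_I less_irrefl singletonD)
    then show ?thesis by (simp add: o_def)
  qed
  have "(\<lambda>n. LINT z|lborel. v k z * ((f (x - z + s n *\<^sub>R e) - f (x - z)) / s n)) \<longlonglongrightarrow> (LINT z|lborel. v k z * D (x - z))"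
  proof (rule integral_dominated_convergence[where w="\<lambda>z. v k z * (L * norm e)"])
    show "integrable lborel (\<lambda>z. v k z * (L * norm e))" using kernel_integrable[OF kernel[OF k]] by simp
    show "AE z in lborel. norm (v k z * ((f (x - z + s n *\<^sub>R e) - f (x - z)) / s n)) \<le> v k z * (L * norm e)" for n
    proof (rule AE_I2)
      fix z
      have "\<bar>(f (x - z + s n *\<^sub>R e) - f (x - z)) / s n\<bar> \<le> L * norm e"
        using lip[of "x - z + s n *\<^sub>R e" "x - z"] s[of n] by (simp add: abs_divide divide_le_eq mult_ac)
      then show "norm (v k z * ((f (x - z + s n *\<^sub>R e) - f (x - z)) / s n)) \<le> v k z * (L * norm e)"
        using kernel_nonneg[OF kernel[OF k], of z] by (simp only: real_norm_def abs_mult abs_of_nonneg mult_left_mono)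
    qed
    show "AE z in lborel. (\<lambda>n. v k z * ((f (x - z + s n *\<^sub>R e) - f (x - z)) / s n)) \<longlonglongrightarrow> v k z * D (x - z)"
      using AE_lborel_reflect[OF der, of x] by eventually_elim (intro tendsto_mult_left seq)
  qed measurable
  moreover have "(LINT z|lborel. v k z * ((f (x - z + s n *\<^sub>R e) - f (x - z)) / s n))
      = (mollify (v k) f (x + s n *\<^sub>R e) - mollify (v k) f x) / s n" for n
    using i[of "x + s n *\<^sub>R e"] i[of x]
    by (simp add: mollify_def right_diff_distrib diff_divide_distrib algebra_simps)
  moreover have "mollify (v k) D x = (LINT z|lborel. v k z * D (x - z))" by (simp add: mollify_def)
  ultimately have "(\<lambda>n. (mollify (v k) f (x + s n *\<^sub>R e) - mollify (v k) f x) / s n) \<longlonglongrightarrow> mollify (v k) D x"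
    by (simp only:)
  then show ?thesis
    using seq[OF GDERIV_directional[OF G, of e]] by (rule LIMSEQ_unique)
qed

text \<open>
  For fixed \<open>e\<close> the mollifications of \<open>D e x - w x \<bullet> e\<close> vanish, because those of \<open>D\<close> are the
  directional derivatives of a differentiable function.  Hence \<open>D e x = w x \<bullet> e\<close> almost everywhere,
  simultaneously for a countable dense set of directions.
\<close>

theorem rademacher:
  fixes f :: "real ^ 'n \<Rightarrow> real"
  assumes lip: "\<And>x y. \<bar>f x - f y\<bar> \<le> L * norm (x - y)"
  shows "AE x in lborel. \<exists>w. GDERIV f x :> w"
proof -
  note L = lipschitz_constant_nonneg[OF lip]
  define good where "good e D \<longleftrightarrow> D \<in> borel_measurable borel \<and> (\<forall>x. \<bar>D x\<bar> \<le> L * norm e) \<and>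
    (AE x in lborel. ((\<lambda>t. (f (x + t *\<^sub>R e) - f x) / t) \<longlongrightarrow> D x) (at 0))" for e D
  have "\<exists>D. good e D" for e
  proof (rule lipschitz_directional_derivative[OF lip, of e])
    fix D assume "D \<in> borel_measurable borel" "\<And>x. \<bar>D x\<bar> \<le> L * norm e"
      "AE x in lborel. ((\<lambda>t. (f (x + t *\<^sub>R e) - f x) / t) \<longlongrightarrow> D x) (at 0)"
    then have "good e D" by (simp add: good_def)
    then show "\<exists>D. good e D" by blast
  qed
  then have "\<exists>D. \<forall>e. good e (D e)" by (intro choice) blast
  then obtain D where "\<And>e. good e (D e)" by blast
  then have D[measurable]: "\<And>e. D e \<in> borel_measurable borel"
    and DB: "\<And>e x. \<bar>D e x\<bar> \<le> L * norm e"
    and der: "\<And>e. AE x in lborel. ((\<lambda>t. (f (x + t *\<^sub>R e) - f x) / t) \<longlongrightarrow> D e x) (at 0)"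
    unfolding good_def by auto
  define w where "w x = (\<Sum>e\<in>Basis. D e x *\<^sub>R e)" for x
  note fm[measurable] = lipschitz_measurable[OF lip]
  have fb: "\<exists>B. \<forall>x. norm x \<le> R \<longrightarrow> \<bar>f x\<bar> \<le> B" for R
  proof (intro exI allI impI)
    fix x :: "real^'n" assume "norm x \<le> R"
    then have "L * norm x \<le> L * R" using L by (rule mult_left_mono)
    then show "\<bar>f x\<bar> \<le> \<bar>f 0\<bar> + L * R" using lip[of x 0] by simp
  qed
  have linear: "AE x in lborel. D e x = w x \<bullet> e" for e
  proof -
    define g where "g x = D e x - (\<Sum>b\<in>Basis. (e \<bullet> b) * D b x)" for x
    have we: "w x \<bullet> e = (\<Sum>b\<in>Basis. (e \<bullet> b) * D b x)" for x
      unfolding w_def inner_sum_left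
      by (intro sum.cong refl) (simp add: inner_commute[of _ e])
    have "AE x in lborel. x \<in> UNIV \<longrightarrow> g x = 0"
    proof (rule AE_zero_of_mollification_sequence_zero[where m=1])
      show "g \<in> borel_measurable borel" unfolding g_def by measurable
      show "\<bar>g x\<bar> \<le> L * norm e + (\<Sum>b\<in>(Basis::(real^'n) set). \<bar>e \<bullet> b\<bar> * (L * norm b))" for x
      proof -
        have "\<bar>\<Sum>b\<in>Basis. (e \<bullet> b) * D b x\<bar> \<le> (\<Sum>b\<in>(Basis::(real^'n) set). \<bar>e \<bullet> b\<bar> * (L * norm b))"
          by (rule order_trans[OF sum_abs sum_mono], subst abs_mult, intro mult_left_mono DB abs_ge_zero)
        then show ?thesis using DB[of e x] unfolding g_def by linarith
      qed
      fix k :: nat and x :: "real^'n" assume "1 \<le> k"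
      then have k: "0 < k" by simp
      obtain G where G: "GDERIV (mollify (v k) f) x :> G"
        by (rule mollify_differentiable[OF kernel[OF k] fm fb])
      have i: "integrable lborel (\<lambda>z. v k z * D b (x - z))" for b
        using mollify_integrable[OF kernel[OF k] D, of b x "L * norm b"] DB by simp
      have "mollify (v k) g x = mollify (v k) (D e) x - (\<Sum>b\<in>Basis. (e \<bullet> b) * mollify (v k) (D b) x)"
      proof -
        have "mollify (v k) g x = (LINT z|lborel. v k z * D e (x - z) - (\<Sum>b\<in>Basis. (e \<bullet> b) * (v k z * D b (x - z))))"
          unfolding mollify_def g_def real_scaleR_def right_diff_distrib sum_distrib_left
          by (simp only: mult.left_commute)
        also have "\<dots> = (LINT z|lborel. v k z * D e (x - z)) - (\<Sum>b\<in>Basis. (e \<bullet> b) * (LINT z|lborel. v k z * D b (x - z)))"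
          using i by (subst Bochner_Integration.integral_diff) (auto simp: Bochner_Integration.integral_sum)
        finally show ?thesis by (simp only: mollify_def real_scaleR_def)
      qed
      also have "\<dots> = G \<bullet> e - (\<Sum>b\<in>Basis. (e \<bullet> b) * (G \<bullet> b))"
        by (simp add: mollify_directional[OF lip k D der G])
      also have "\<dots> = 0"
        by (subst euclidean_inner[of G e]) (simp only: mult.commute diff_self)
      finally show "mollify (v k) g x = 0" .
    qed simp
    then show ?thesis by (simp add: g_def we)
  qed
  obtain V :: "(real^'n) set" where V: "countable V" "\<And>U. open U \<Longrightarrow> U \<noteq> {} \<Longrightarrow> \<exists>v\<in>V. v \<in> U"
    by (rule countable_dense_setE) blast
  have "AE x in lborel. \<forall>e\<in>V. D e x = w x \<bullet> e \<and> ((\<lambda>t. (f (x + t *\<^sub>R e) - f x) / t) \<longlongrightarrow> D e x) (at 0)"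
    using V(1) linear der by (subst AE_ball_countable) auto
  then show ?thesis
  proof eventually_elim
    case (elim x)
    have "GDERIV f x :> w x"
      by (rule GDERIV_of_dense_directional[OF lip V(2)]) (use elim in auto)
    then show ?case ..
  qed
qed

end

section \<open>Functions Lipschitz along segments\<close>

context normed_coordinates
begin

lemma bdd_above_dual_norm: "bdd_above ((\<lambda>v. \<bar>\<xi> \<bullet> v\<bar>) ` {v. N v \<le> 1})"
proof -
  obtain b where b: "0 < b" "\<And>x. norm x \<le> b * N x" using norm_le_N by blast
  show ?thesis
  proof (rule bdd_aboveI2[where M="norm \<xi> * b"])
    fix v assume "v \<in> {v. N v \<le> 1}"
    then have "norm v \<le> b" using order_trans[OF b(2)[of v], of b] b(1) by simp
    then show "\<bar>\<xi> \<bullet> v\<bar> \<le> norm \<xi> * b"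
      using Cauchy_Schwarz_ineq2[of \<xi> v] mult_left_mono[of "norm v" b "norm \<xi>"] by simp
  qed
qed

lemma dual_norm_nonneg: "0 \<le> dual_norm N \<xi>"
proof -
  have "\<bar>\<xi> \<bullet> 0\<bar> \<le> dual_norm N \<xi>"
    unfolding dual_norm_def by (rule cSUP_upper[OF _ bdd_above_dual_norm]) simp
  then show ?thesis by simp
qed

lemma abs_inner_le_dual_norm: "\<bar>\<xi> \<bullet> v\<bar> \<le> dual_norm N \<xi> * N v"
proof (cases "v = 0")
  case False
  then have n: "0 < N v" using N_nonneg[of v] by (simp add: less_eq_real_def)
  have "\<bar>\<xi> \<bullet> ((1 / N v) *\<^sub>R v)\<bar> \<le> dual_norm N \<xi>"
    unfolding dual_norm_def
    by (rule cSUP_upper[OF _ bdd_above_dual_norm]) (use n in \<open>simp add: N_scaleR\<close>)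
  then show ?thesis using n by (simp add: abs_mult field_simps)
qed simp

lemma dual_norm_le:
  assumes "\<And>v. \<bar>\<xi> \<bullet> v\<bar> \<le> C * N v" "0 \<le> C"
  shows "dual_norm N \<xi> \<le> C"
  unfolding dual_norm_def
proof (rule cSUP_least)
  show "{v. N v \<le> 1} \<noteq> {}" by (metis N_zero empty_iff mem_Collect_eq zero_le_one)
  fix v assume "v \<in> {v. N v \<le> 1}"
  then show "\<bar>\<xi> \<bullet> v\<bar> \<le> C" using assms(1)[of v] mult_left_mono[of "N v" 1 C] assms(2) by simp
qed

lemma dual_norm_zero: "dual_norm N 0 = 0"
  by (rule antisym[OF dual_norm_le dual_norm_nonneg]) auto

lemma dual_norm_add_le: "dual_norm N (\<xi> + \<eta>) \<le> dual_norm N \<xi> + dual_norm N \<eta>"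
proof (rule dual_norm_le)
  fix v
  have "\<bar>(\<xi> + \<eta>) \<bullet> v\<bar> \<le> \<bar>\<xi> \<bullet> v\<bar> + \<bar>\<eta> \<bullet> v\<bar>" by (simp add: inner_add_left)
  then show "\<bar>(\<xi> + \<eta>) \<bullet> v\<bar> \<le> (dual_norm N \<xi> + dual_norm N \<eta>) * N v"
    using abs_inner_le_dual_norm[of \<xi> v] abs_inner_le_dual_norm[of \<eta> v] by (simp add: distrib_right)
qed (simp add: dual_norm_nonneg)

lemma dual_norm_le_norm: obtains b where "0 < b" "\<And>\<xi>. dual_norm N \<xi> \<le> b * norm \<xi>"
proof -
  obtain b where b: "0 < b" "\<And>x. norm x \<le> b * N x" using norm_le_N by blast
  have "dual_norm N \<xi> \<le> b * norm \<xi>" for \<xi>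
  proof (rule dual_norm_le)
    fix v
    show "\<bar>\<xi> \<bullet> v\<bar> \<le> b * norm \<xi> * N v"
      using Cauchy_Schwarz_ineq2[of \<xi> v] mult_left_mono[OF b(2)[of v] norm_ge_zero[of \<xi>]]
      by (simp add: mult_ac)
  qed (use b in simp)
  then show thesis using that b by blast
qed

lemma norm_le_dual_norm: obtains b where "0 < b" "\<And>\<xi>. norm \<xi> \<le> b * dual_norm N \<xi>"
proof -
  obtain B where B: "0 < B" "\<And>x. N x \<le> B * norm x" using N_le_norm by blast
  have "norm \<xi> \<le> B * dual_norm N \<xi>" for \<xi>
  proof (cases "\<xi> = 0")
    case False
    have "norm \<xi> * norm \<xi> \<le> dual_norm N \<xi> * (B * norm \<xi>)"
      using abs_inner_le_dual_norm[of \<xi> \<xi>] mult_left_mono[OF B(2)[of \<xi>] dual_norm_nonneg[of \<xi>]]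
      by (simp add: dot_square_norm power2_eq_square)
    then show ?thesis using False by (simp add: mult_ac)
  qed (use B dual_norm_nonneg in simp)
  then show thesis using that B by blast
qed

lemma norm_bound_of_dual_norm_bound:
  assumes "\<And>x. dual_norm N (g x) \<le> C"
  obtains B where "\<And>x. norm (g x) \<le> B"
proof -
  obtain b where b: "0 < b" "\<And>\<xi>. norm \<xi> \<le> b * dual_norm N \<xi>" using norm_le_dual_norm by blast
  show thesis
    by (rule that[of "b * C"]) (use order_trans[OF b(2) mult_left_mono[OF assms]] b(1) in simp)
qed

lemma borel_measurable_dual_norm [measurable]: "dual_norm N \<in> borel_measurable borel"
proof -
  obtain b where b: "0 < b" "\<And>\<xi>. dual_norm N \<xi> \<le> b * norm \<xi>" using dual_norm_le_norm by blast
  have *: "dual_norm N \<xi> - dual_norm N \<eta> \<le> b * norm (\<xi> - \<eta>)" for \<xi> \<eta>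
    using dual_norm_add_le[of "\<xi> - \<eta>" \<eta>] b(2)[of "\<xi> - \<eta>"] by simp
  have "\<bar>dual_norm N \<xi> - dual_norm N \<eta>\<bar> \<le> b * norm (\<xi> - \<eta>)" for \<xi> \<eta>
    using *[of \<xi> \<eta>] *[of \<eta> \<xi>] by (simp add: norm_minus_commute abs_le_iff)
  then have "b-lipschitz_on UNIV (dual_norm N)"
    using b(1) by (auto simp: lipschitz_on_def dist_norm)
  then show ?thesis by (intro borel_measurable_continuous_onI lipschitz_on_continuous_on)
qed

text \<open>
  Only segments inside \<open>U\<close> are tested.  The condition is therefore stable under pointwise limits and
  can be read off from a gradient by the mean value theorem; for a domain it is nevertheless
  equivalent to the Lipschitz condition for the intrinsic distance
  (\<open>lipschitz_intrinsic_iff_seg_lipschitz\<close>).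
\<close>

definition seg_lipschitz :: "real \<Rightarrow> (real ^ 'n) set \<Rightarrow> (real ^ 'n \<Rightarrow> real) \<Rightarrow> bool" where
  "seg_lipschitz C U f \<longleftrightarrow> 0 \<le> C \<and> (\<forall>x y. closed_segment x y \<subseteq> U \<longrightarrow> \<bar>f x - f y\<bar> \<le> C * N (x - y))"

lemma seg_lipschitz_convex:
  assumes "seg_lipschitz C U f" "convex S" "S \<subseteq> U" "x \<in> S" "y \<in> S"
  shows "\<bar>f x - f y\<bar> \<le> C * N (x - y)"
  using assms closed_segment_subset[of x S y] by (auto simp: seg_lipschitz_def)

lemma seg_lipschitz_of_gradient:
  assumes "\<And>z. z \<in> U \<Longrightarrow> GDERIV f z :> D z" "\<And>z. z \<in> U \<Longrightarrow> dual_norm N (D z) \<le> C" "0 \<le> C"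
  shows "seg_lipschitz C U f"
  unfolding seg_lipschitz_def
proof (intro conjI allI impI)
  fix x y assume sub: "closed_segment x y \<subseteq> U"
  obtain z where z: "z \<in> closed_segment x y" "f y - f x = D z \<bullet> (y - x)"
    using GDERIV_mean_value[of x y f D] assms(1) sub by blast
  have "\<bar>D z \<bullet> (y - x)\<bar> \<le> C * N (y - x)"
    using abs_inner_le_dual_norm[of "D z" "y - x"] mult_right_mono[OF assms(2)[of z] N_nonneg[of "y - x"]] z sub
    by force
  then show "\<bar>f x - f y\<bar> \<le> C * N (x - y)" using z(2) N_commute[of x y] by (simp add: abs_minus_commute)
qed (use assms in simp)

lemma dual_norm_gradient_le:
  assumes f: "seg_lipschitz C U f" and U: "open U" "z \<in> U" and D: "GDERIV f z :> D"
  shows "dual_norm N D \<le> C"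
proof (rule dual_norm_le)
  obtain r where r: "0 < r" "nball z r \<subseteq> U" using open_contains_nball[OF U] by blast
  fix v
  show "\<bar>D \<bullet> v\<bar> \<le> C * N v"
  proof (rule GDERIV_directional_bound[OF D, of "r / (N v + 1)"])
    have n: "0 < N v + 1" using N_nonneg[of v] by linarith
    show "0 < r / (N v + 1)" using r n by simp
    fix t assume t: "0 < t" "t < r / (N v + 1)"
    then have "t * (N v + 1) < r" using n by (simp add: field_simps)
    then have "t * N v < r" using t by (simp add: distrib_left)
    then have "z + t *\<^sub>R v \<in> nball z r" using t by (simp add: nball_def N_scaleR)
    then have "\<bar>f (z + t *\<^sub>R v) - f z\<bar> \<le> C * N (z + t *\<^sub>R v - z)"
      using r by (intro seg_lipschitz_convex[OF f convex_nball r(2)]) auto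
    then show "\<bar>f (z + t *\<^sub>R v) - f z\<bar> \<le> C * N v * t" using t by (simp add: N_scaleR mult_ac)
  qed
qed (use f in \<open>simp add: seg_lipschitz_def\<close>)

lemma seg_lipschitz_continuous_on:
  assumes f: "seg_lipschitz C U f" and U: "open U"
  shows "continuous_on U f"
proof (rule continuous_at_imp_continuous_on, rule ballI)
  fix x assume "x \<in> U"
  then obtain r where r: "0 < r" "nball x r \<subseteq> U" using open_contains_nball[OF U] by blast
  obtain B where B: "0 < B" "\<And>x. N x \<le> B * norm x" using N_le_norm by blast
  have C: "0 \<le> C" using f by (simp add: seg_lipschitz_def)
  have "(C * B)-lipschitz_on (nball x r) f"
  proof (rule lipschitz_onI)
    fix y z assume yz: "y \<in> nball x r" "z \<in> nball x r"
    have "\<bar>f y - f z\<bar> \<le> C * N (y - z)" by (rule seg_lipschitz_convex[OF f convex_nball r(2) yz])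
    also have "\<dots> \<le> C * (B * norm (y - z))" using B C by (intro mult_left_mono) auto
    finally show "dist (f y) (f z) \<le> C * B * dist y z" by (simp add: dist_norm mult.assoc)
  qed (use B C in simp)
  then have "continuous_on (nball x r) f" by (rule lipschitz_on_continuous_on)
  then show "isCont f x" using r by (simp add: continuous_on_eq_continuous_at)
qed

text \<open>
  A path in \<open>U\<close> keeps a positive distance from the complement of \<open>U\<close>.  By uniform continuity the
  chords of a fine partition stay in \<open>U\<close>, and their lengths add up to at most the length of the path.
\<close>

lemma seg_lipschitz_curve:
  assumes f: "seg_lipschitz C U f" and U: "open U" and \<gamma>: "path \<gamma>" "path_image \<gamma> \<subseteq> U"
    and len: "curve_length N \<gamma> \<le> ereal l"
  shows "\<bar>f (pathfinish \<gamma>) - f (pathstart \<gamma>)\<bar> \<le> C * l"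
proof -
  have C: "0 \<le> C" using f by (simp add: seg_lipschitz_def)
  obtain e where e: "0 < e" "\<And>x. x \<in> path_image \<gamma> \<Longrightarrow> ball x e \<subseteq> U"
  proof -
    obtain e where "0 < e" "(\<Union>x\<in>path_image \<gamma>. ball x e) \<subseteq> U"
      using compact_subset_open_imp_ball_epsilon_subset[OF compact_path_image[OF \<gamma>(1)] U \<gamma>(2)] by blast
    then show thesis using that by blast
  qed
  have "uniformly_continuous_on {0..1} \<gamma>"
    using \<gamma>(1) by (intro compact_uniformly_continuous) (auto simp: path_def)
  then obtain d where d: "0 < d" "\<And>s t. s \<in> {0..1} \<Longrightarrow> t \<in> {0..1} \<Longrightarrow> dist s t < d \<Longrightarrow> dist (\<gamma> s) (\<gamma> t) < e"
    using e(1) unfolding uniformly_continuous_on_def by meson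
  obtain m where m: "inverse (real (Suc m)) < d" using d(1) reals_Archimedean by blast
  define t where "t i = real i / real (Suc m)" for i :: nat
  have t01: "t i \<in> {0..1}" if "i \<le> Suc m" for i using that by (simp add: t_def)
  have step: "\<bar>f (\<gamma> (t (Suc i))) - f (\<gamma> (t i))\<bar> \<le> C * N (\<gamma> (t (Suc i)) - \<gamma> (t i))" if i: "i < Suc m" for i
  proof -
    have "dist (t i) (t (Suc i)) < d"
      using m by (simp add: t_def dist_real_def abs_minus_commute inverse_eq_divide flip: diff_divide_distrib)
    then have "dist (\<gamma> (t i)) (\<gamma> (t (Suc i))) < e" using t01 i by (intro d) auto
    moreover have "\<gamma> (t i) \<in> path_image \<gamma>" using t01[of i] i by (simp add: path_image_def)
    ultimately show ?thesis
      using e by (intro seg_lipschitz_convex[OF f convex_ball e(2)[of "\<gamma> (t i)"]]) auto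
  qed
  have "f (pathfinish \<gamma>) - f (pathstart \<gamma>) = (\<Sum>i<Suc m. f (\<gamma> (t (Suc i))) - f (\<gamma> (t i)))"
    by (subst sum_lessThan_telescope) (simp add: t_def pathfinish_def pathstart_def)
  also have "\<bar>\<dots>\<bar> \<le> (\<Sum>i<Suc m. C * N (\<gamma> (t (Suc i)) - \<gamma> (t i)))"
    by (rule order_trans[OF sum_abs sum_mono]) (use step in simp)
  also have "\<dots> = C * (\<Sum>i<Suc m. N (\<gamma> (t (Suc i)) - \<gamma> (t i)))" by (rule sum_distrib_left[symmetric])
  also have "\<dots> \<le> C * l"
  proof (rule mult_left_mono[OF _ C])
    have "ereal (\<Sum>i<Suc m. N (\<gamma> (t (Suc i)) - \<gamma> (t i))) \<le> curve_length N \<gamma>"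
      unfolding curve_length_def
    proof (rule Sup_upper, rule CollectI, intro exI conjI)
      show "t 0 = 0" "t (Suc m) = 1" "\<forall>i<Suc m. t i \<le> t (Suc i)" by (auto simp: t_def divide_right_mono)
    qed simp
    then show "(\<Sum>i<Suc m. N (\<gamma> (t (Suc i)) - \<gamma> (t i))) \<le> l"
      using len order_trans ereal_less_eq(3) by blast
  qed
  finally show ?thesis .
qed

lemma curve_length_le_lipschitz:
  assumes "\<And>s t. s \<in> {0..1} \<Longrightarrow> t \<in> {0..1} \<Longrightarrow> N (\<gamma> s - \<gamma> t) \<le> L * \<bar>s - t\<bar>"
  shows "curve_length N \<gamma> \<le> ereal L"
  unfolding curve_length_def
proof (rule Sup_least, clarify)
  fix m :: nat and t :: "nat \<Rightarrow> real"
  assume t: "t 0 = 0" "t m = 1" "\<forall>i<m. t i \<le> t (Suc i)"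
  have mono: "t i \<le> t j" if "i \<le> j" "j \<le> m" for i j
    using that
  proof (induction j)
    case (Suc j)
    show ?case
    proof (cases "i = Suc j")
      case False
      then have "t i \<le> t j" using Suc by simp
      also have "t j \<le> t (Suc j)" using t(3) Suc by simp
      finally show ?thesis .
    qed simp
  qed simp
  have "(\<Sum>i<m. N (\<gamma> (t (Suc i)) - \<gamma> (t i))) \<le> (\<Sum>i<m. L * (t (Suc i) - t i))"
  proof (rule sum_mono)
    fix i assume "i \<in> {..<m}"
    then have "t i \<in> {0..1}" "t (Suc i) \<in> {0..1}" "t i \<le> t (Suc i)"
      using mono[of 0 i] mono[of i m] mono[of 0 "Suc i"] mono[of "Suc i" m] mono[of i "Suc i"] t by auto
    then show "N (\<gamma> (t (Suc i)) - \<gamma> (t i)) \<le> L * (t (Suc i) - t i)"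
      using assms[of "t (Suc i)" "t i"] by simp
  qed
  also have "\<dots> = L" using t by (simp add: sum_distrib_left[symmetric] sum_lessThan_telescope)
  finally show "ereal (\<Sum>i<m. N (\<gamma> (t (Suc i)) - \<gamma> (t i))) \<le> ereal L" by simp
qed

lemma endpoint_distance_le_curve_length: "ereal (N (\<gamma> 1 - \<gamma> 0)) \<le> curve_length N \<gamma>"
proof -
  define t where "t i = real i" for i :: nat
  have "ereal (\<Sum>i<1. N (\<gamma> (t (Suc i)) - \<gamma> (t i))) \<le> curve_length N \<gamma>"
    unfolding curve_length_def
  proof (rule Sup_upper, rule CollectI, intro exI conjI)
    show "t 0 = 0" "t 1 = 1" "\<forall>i<1. t i \<le> t (Suc i)" by (auto simp: t_def)
  qed simp
  then show ?thesis by (simp add: t_def)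
qed

lemma curve_length_real:
  assumes "curve_length N \<gamma> \<le> ereal L"
  obtains l where "curve_length N \<gamma> = ereal l" "0 \<le> l" "l \<le> L"
proof (cases "curve_length N \<gamma>")
  case (real l)
  moreover have "0 \<le> l" 
    using order_trans[OF _ endpoint_distance_le_curve_length[of \<gamma>], of 0] real by simp
  ultimately show ?thesis using that assms by simp
next
  case PInf
  then show ?thesis using assms by simp
next
  case MInf
  then show ?thesis using endpoint_distance_le_curve_length[of \<gamma>] by simp
qed

lemma lipschitz_path_path:
  assumes "lipschitz_path N \<Omega> x y \<gamma>"
  shows "path \<gamma>" "path_image \<gamma> \<subseteq> \<Omega>" "pathstart \<gamma> = x" "pathfinish \<gamma> = y"
proof -
  obtain L where L: "\<And>s t. s \<in> {0..1} \<Longrightarrow> t \<in> {0..1} \<Longrightarrow> N (\<gamma> s - \<gamma> t) \<le> L * \<bar>s - t\<bar>"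
    using assms unfolding lipschitz_path_def by blast
  obtain b where b: "0 < b" "\<And>x. norm x \<le> b * N x" using norm_le_N by blast
  have "(b * \<bar>L\<bar>)-lipschitz_on {0..1} \<gamma>"
  proof (rule lipschitz_onI)
    fix s t :: real assume "s \<in> {0..1}" "t \<in> {0..1}"
    then have "b * N (\<gamma> s - \<gamma> t) \<le> b * (L * \<bar>s - t\<bar>)" using L b by simp
    also have "\<dots> \<le> b * (\<bar>L\<bar> * \<bar>s - t\<bar>)" using b by (intro mult_left_mono mult_right_mono) auto
    finally show "dist (\<gamma> s) (\<gamma> t) \<le> b * \<bar>L\<bar> * dist s t"
      using b(2)[of "\<gamma> s - \<gamma> t"] by (simp add: dist_norm mult.assoc)
  qed (use b in simp)
  then show "path \<gamma>" unfolding path_def by (rule lipschitz_on_continuous_on)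
qed (use assms in \<open>auto simp: lipschitz_path_def path_image_def pathstart_def pathfinish_def\<close>)

lemma lipschitz_path_exists:
  assumes \<Omega>: "open \<Omega>" "connected \<Omega>" and xy: "x \<in> \<Omega>" "y \<in> \<Omega>"
  shows "\<exists>\<gamma>. lipschitz_path N \<Omega> x y \<gamma>"
proof -
  obtain p where p: "polynomial_function p" "path_image p \<subseteq> \<Omega>" "pathstart p = x" "pathfinish p = y"
    using connected_open_polynomial_connected[OF \<Omega> xy] by blast
  obtain p' where p': "polynomial_function p'" "\<And>t. (p has_vector_derivative p' t) (at t)"
    using has_vector_derivative_polynomial_function[OF p(1)] by blast
  have "compact (p' ` {0..1})"
    using continuous_on_polymonial_function[OF p'(1)] by (intro compact_continuous_image) auto
  then obtain K where K: "\<And>t. t \<in> {0..1} \<Longrightarrow> norm (p' t) \<le> K"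
    by (meson bounded_iff compact_imp_bounded imageI)
  obtain B where B: "0 < B" "\<And>x. N x \<le> B * norm x" using N_le_norm by blast
  have "N (p s - p t) \<le> (B * K) * \<bar>s - t\<bar>" if "s \<in> {0..1}" "t \<in> {0..1}" for s t
  proof -
    have "norm (p s - p t) \<le> K * norm (s - t)"
    proof (rule differentiable_bound[of "{0..1}" p "\<lambda>t h. h *\<^sub>R p' t"])
      show "(p has_derivative (\<lambda>h. h *\<^sub>R p' t)) (at t within {0..1})" for t
        using p'(2)[of t] by (simp add: has_vector_derivative_def has_derivative_at_withinI)
      show "onorm (\<lambda>h. h *\<^sub>R p' t) \<le> K" if "t \<in> {0..1}" for t
        by (rule onorm_le) (use K[OF that] in \<open>simp add: mult.commute[of K] mult_left_mono\<close>)
    qed (use that in auto)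
    then have "B * norm (p s - p t) \<le> B * (K * \<bar>s - t\<bar>)" using B by simp
    then show ?thesis using B(2)[of "p s - p t"] by (simp add: mult.assoc)
  qed
  then show ?thesis
    using p(2-4) unfolding lipschitz_path_def path_image_def pathstart_def pathfinish_def by blast
qed

lemma intrinsic_dist_le:
  assumes "path \<gamma>" "path_image \<gamma> \<subseteq> \<Omega>" "pathstart \<gamma> = x" "pathfinish \<gamma> = y" "curve_length N \<gamma> = ereal l"
  shows "intrinsic_dist N \<Omega> x y \<le> l"
  unfolding intrinsic_dist_def
proof (rule cInf_lower)
  show "bdd_below {l. \<exists>\<gamma>. path \<gamma> \<and> path_image \<gamma> \<subseteq> \<Omega> \<and> pathstart \<gamma> = x \<and> pathfinish \<gamma> = y \<and> curve_length N \<gamma> = ereal l}"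
  proof (rule bdd_belowI[of _ 0], clarify)
    fix l \<gamma> assume "curve_length N \<gamma> = ereal l"
    then show "0 \<le> l"
      using order_trans[OF _ endpoint_distance_le_curve_length[of \<gamma>], of 0] by simp
  qed
qed (use assms in blast)

text \<open>
  The infimum is over a set of reals, so it is meaningful only because a path of finite length
  exists.
\<close>

lemma intrinsic_dist_greatest:
  assumes \<Omega>: "open \<Omega>" "connected \<Omega>" and xy: "x \<in> \<Omega>" "y \<in> \<Omega>"
    and bound: "\<And>\<gamma> l. path \<gamma> \<Longrightarrow> path_image \<gamma> \<subseteq> \<Omega> \<Longrightarrow> pathstart \<gamma> = x \<Longrightarrow> pathfinish \<gamma> = y \<Longrightarrow>
      curve_length N \<gamma> = ereal l \<Longrightarrow> c \<le> l"
  shows "c \<le> intrinsic_dist N \<Omega> x y"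
  unfolding intrinsic_dist_def
proof (rule cInf_greatest)
  obtain \<gamma> where \<gamma>: "lipschitz_path N \<Omega> x y \<gamma>" using lipschitz_path_exists[OF \<Omega> xy] by blast
  obtain L where "\<forall>s\<in>{0..1}. \<forall>t\<in>{0..1}. N (\<gamma> s - \<gamma> t) \<le> L * \<bar>s - t\<bar>"
    using \<gamma> unfolding lipschitz_path_def by blast
  then have "curve_length N \<gamma> \<le> ereal L" by (intro curve_length_le_lipschitz) auto
  then obtain l where "curve_length N \<gamma> = ereal l" by (rule curve_length_real)
  then show "{l. \<exists>\<gamma>. path \<gamma> \<and> path_image \<gamma> \<subseteq> \<Omega> \<and> pathstart \<gamma> = x \<and> pathfinish \<gamma> = y \<and> curve_length N \<gamma> = ereal l} \<noteq> {}"
    using lipschitz_path_path[OF \<gamma>] by blast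
qed (use bound in blast)

lemma norm_le_intrinsic_dist:
  assumes \<Omega>: "open \<Omega>" "connected \<Omega>" and xy: "x \<in> \<Omega>" "y \<in> \<Omega>"
  shows "N (x - y) \<le> intrinsic_dist N \<Omega> x y"
proof (rule intrinsic_dist_greatest[OF assms])
  fix \<gamma> l assume "pathstart \<gamma> = x" "pathfinish \<gamma> = y" "curve_length N \<gamma> = ereal l"
  then show "N (x - y) \<le> l"
    using endpoint_distance_le_curve_length[of \<gamma>] N_commute[of x y] by (simp add: pathstart_def pathfinish_def)
qed

lemma intrinsic_dist_segment_le:
  assumes "closed_segment x y \<subseteq> \<Omega>"
  shows "intrinsic_dist N \<Omega> x y \<le> N (x - y)"
proof -
  have "curve_length N (linepath x y) \<le> ereal (N (x - y))"
  proof (rule curve_length_le_lipschitz)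
    fix s t :: real
    have "linepath x y s - linepath x y t = (t - s) *\<^sub>R (x - y)" by (simp add: linepath_def algebra_simps)
    then show "N (linepath x y s - linepath x y t) \<le> N (x - y) * \<bar>s - t\<bar>"
      by (simp add: N_scaleR abs_minus_commute)
  qed
  then obtain l where "curve_length N (linepath x y) = ereal l" "l \<le> N (x - y)" by (rule curve_length_real)
  then show ?thesis using intrinsic_dist_le[of "linepath x y" \<Omega> x y l] assms by simp
qed

lemma lipschitz_intrinsic_iff_seg_lipschitz:
  assumes \<Omega>: "open \<Omega>" "connected \<Omega>" and C: "0 \<le> C"
  shows "(\<forall>x\<in>\<Omega>. \<forall>y\<in>\<Omega>. \<bar>f x - f y\<bar> \<le> C * intrinsic_dist N \<Omega> x y) \<longleftrightarrow> seg_lipschitz C \<Omega> f"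
proof
  assume *: "\<forall>x\<in>\<Omega>. \<forall>y\<in>\<Omega>. \<bar>f x - f y\<bar> \<le> C * intrinsic_dist N \<Omega> x y"
  show "seg_lipschitz C \<Omega> f"
    unfolding seg_lipschitz_def
  proof (intro conjI allI impI)
    fix x y assume s: "closed_segment x y \<subseteq> \<Omega>"
    then have "\<bar>f x - f y\<bar> \<le> C * intrinsic_dist N \<Omega> x y" using * by auto
    also have "\<dots> \<le> C * N (x - y)" by (rule mult_left_mono[OF intrinsic_dist_segment_le[OF s] C])
    finally show "\<bar>f x - f y\<bar> \<le> C * N (x - y)" .
  qed (rule C)
next
  assume f: "seg_lipschitz C \<Omega> f"
  show "\<forall>x\<in>\<Omega>. \<forall>y\<in>\<Omega>. \<bar>f x - f y\<bar> \<le> C * intrinsic_dist N \<Omega> x y"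
  proof (intro ballI)
    fix x y assume xy: "x \<in> \<Omega>" "y \<in> \<Omega>"
    have le: "\<bar>f x - f y\<bar> \<le> C * l"
      if "path \<gamma>" "path_image \<gamma> \<subseteq> \<Omega>" "pathstart \<gamma> = x" "pathfinish \<gamma> = y" "curve_length N \<gamma> = ereal l" for \<gamma> l
      using seg_lipschitz_curve[OF f \<Omega>(1) that(1,2), of l] that(3-5) by (simp add: abs_minus_commute)
    show "\<bar>f x - f y\<bar> \<le> C * intrinsic_dist N \<Omega> x y"
    \<comment> \<open>Dividing by \<open>C\<close> brings the bound into the form needed for an infimum.\<close>
    proof (cases "C = 0")
      case True
      obtain \<gamma> where \<gamma>: "lipschitz_path N \<Omega> x y \<gamma>" using lipschitz_path_exists[OF \<Omega> xy] by blast
      obtain L where "\<forall>s\<in>{0..1}. \<forall>t\<in>{0..1}. N (\<gamma> s - \<gamma> t) \<le> L * \<bar>s - t\<bar>"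
        using \<gamma> unfolding lipschitz_path_def by blast
      then have "curve_length N \<gamma> \<le> ereal L" by (intro curve_length_le_lipschitz) auto
      then obtain l where "curve_length N \<gamma> = ereal l" by (rule curve_length_real)
      then show ?thesis using le[OF lipschitz_path_path[OF \<gamma>]] True by simp
    next
      case False
      then have C0: "0 < C" using C by simp
      have "\<bar>f x - f y\<bar> / C \<le> intrinsic_dist N \<Omega> x y"
        by (rule intrinsic_dist_greatest[OF \<Omega> xy]) (use le C0 in \<open>simp add: divide_le_eq mult.commute\<close>)
      then show ?thesis using C0 by (simp add: divide_le_eq mult.commute)
    qed
  qed
qed

end

text \<open>
  McShane's formula.
\<close>

lemma lipschitz_extension:
  fixes f :: "'a::metric_space \<Rightarrow> real"
  assumes L: "0 \<le> L" and lip: "\<And>x y. x \<in> S \<Longrightarrow> y \<in> S \<Longrightarrow> \<bar>f x - f y\<bar> \<le> L * dist x y"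
  obtains h where "\<And>x y. \<bar>h x - h y\<bar> \<le> L * dist x y" "\<And>x. x \<in> S \<Longrightarrow> h x = f x"
proof (cases "S = {}")
  case True
  then show ?thesis using that[of "\<lambda>_. 0"] L by simp
next
  case False
  then obtain s where s: "s \<in> S" by blast
  define h where "h x = (INF y\<in>S. f y + L * dist x y)" for x
  have tri: "L * dist x z \<le> L * dist x y + L * dist y z" for x y z
    using mult_left_mono[OF dist_triangle[of x z y] L] by (simp add: distrib_left)
  have bdd: "bdd_below ((\<lambda>y. f y + L * dist x y) ` S)" for x
  proof (rule bdd_belowI2)
    fix y assume "y \<in> S"
    then show "f s - L * dist s x \<le> f y + L * dist x y"
      using lip[OF s, of y] tri[of s y x] by simp
  qed
  have le: "h x - h y \<le> L * dist x y" for x y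
  proof -
    have "h x - L * dist x y \<le> f z + L * dist y z" if "z \<in> S" for z
      using cINF_lower[OF bdd that, of x] tri[of x z y] by (simp add: h_def)
    then have "h x - L * dist x y \<le> h y"
      unfolding h_def[of y] by (rule cINF_greatest[OF False])
    then show ?thesis by simp
  qed
  show ?thesis
  proof (rule that[of h])
    show "\<bar>h x - h y\<bar> \<le> L * dist x y" for x y
      using le[of x y] le[of y x] by (simp add: dist_commute abs_le_iff)
    fix x assume x: "x \<in> S"
    have "f x \<le> h x"
      unfolding h_def by (rule cINF_greatest[OF False]) (use lip[OF x] in \<open>force simp: abs_le_iff\<close>)
    moreover have "h x \<le> f x"
      using cINF_lower[OF bdd x, of x] by (simp add: h_def)
    ultimately show "h x = f x" by simp
  qed
qed

context mollifying_sequence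
begin

text \<open>
  \<open>U\<close> is a union of countably many balls.  On each of them \<open>f\<close> is Lipschitz and agrees with a
  function that is Lipschitz on the whole space.
\<close>

lemma seg_lipschitz_AE_differentiable:
  assumes f: "seg_lipschitz C U f" and U: "open U"
  shows "AE z in lborel. z \<in> U \<longrightarrow> (\<exists>w. GDERIV f z :> w)"
proof -
  define F where "F = {B. B \<subseteq> U \<and> (\<exists>x r. B = nball x r)}"
  have "open B" if "B \<in> F" for B using that by (auto simp: F_def)
  then obtain F' where F': "F' \<subseteq> F" "countable F'" "\<Union>F' = \<Union>F" by (rule Lindelof)
  have "\<Union>F = U"
  proof
    show "U \<subseteq> \<Union>F"
    proof
      fix x assume "x \<in> U"
      then obtain r where "0 < r" "nball x r \<subseteq> U" using open_contains_nball[OF U] by blast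
      then have "nball x r \<in> F" "x \<in> nball x r" by (auto simp: F_def)
      then show "x \<in> \<Union>F" by blast
    qed
  qed (auto simp: F_def)
  obtain K where K: "0 < K" "\<And>x. N x \<le> K * norm x" using N_le_norm by blast
  have C: "0 \<le> C" using f by (simp add: seg_lipschitz_def)
  have "AE z in lborel. \<forall>B\<in>F'. z \<in> B \<longrightarrow> (\<exists>w. GDERIV f z :> w)"
  proof (subst AE_ball_countable[OF F'(2)], rule ballI)
    fix B assume "B \<in> F'"
    then have B: "B \<subseteq> U" "convex B" "open B" using F'(1) by (auto simp: F_def)
    have lipB: "\<bar>f x - f y\<bar> \<le> (C * K) * dist x y" if "x \<in> B" "y \<in> B" for x y
    proof -
      have "\<bar>f x - f y\<bar> \<le> C * N (x - y)" by (rule seg_lipschitz_convex[OF f B(2,1) that])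
      also have "\<dots> \<le> C * (K * norm (x - y))" using K C by (intro mult_left_mono) auto
      finally show ?thesis by (simp add: dist_norm mult.assoc)
    qed
    obtain h where h: "\<And>x y. \<bar>h x - h y\<bar> \<le> (C * K) * dist x y" "\<And>x. x \<in> B \<Longrightarrow> h x = f x"
      using lipschitz_extension[of "C * K" B f] lipB C K by auto
    have "AE z in lborel. \<exists>w. GDERIV h z :> w"
      by (rule rademacher) (use h(1) in \<open>simp add: dist_norm\<close>)
    then show "AE z in lborel. z \<in> B \<longrightarrow> (\<exists>w. GDERIV f z :> w)"
      by eventually_elim (use GDERIV_cong_open[OF B(3)] h(2) in blast)
  qed
  then show ?thesis
    using F'(3) \<open>\<Union>F = U\<close> by (auto elim!: eventually_mono)
qed

text \<open>
  The values of \<open>w\<close> at points where \<open>f\<close> has no gradient are chosen so that \<open>w\<close> is Borel measurable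
  and bounded everywhere; convolutions with \<open>w\<close> can then be formed at every point.
\<close>

lemma seg_lipschitz_AE_gradient:
  assumes f: "seg_lipschitz C U f" and U: "open U"
  obtains w where "w \<in> borel_measurable borel" "\<And>z. dual_norm N (w z) \<le> C"
    "AE z in lborel. z \<in> U \<longrightarrow> GDERIV f z :> w z"
proof -
  have C: "0 \<le> C" using f by (simp add: seg_lipschitz_def)
  define h where "h z = indicator U z *\<^sub>R f z" for z
  have [measurable]: "h \<in> borel_measurable borel"
    unfolding h_def using U
    by (intro borel_measurable_continuous_on_indicator seg_lipschitz_continuous_on[OF f]) auto
  define q where "q e n z = (h (z + inverse (real (Suc n)) *\<^sub>R e) - h z) / inverse (real (Suc n))" for e z and n :: nat
  define D where "D z = (\<Sum>e\<in>Basis. lim (\<lambda>n. q e n z) *\<^sub>R e)" for z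
  have [measurable]: "D \<in> borel_measurable borel" unfolding D_def q_def by measurable
  have D: "D z = w" if z: "z \<in> U" and w: "GDERIV f z :> w" for z w
  proof -
    have "GDERIV h z :> w"
      by (rule GDERIV_cong_open[OF U z _ w]) (simp add: h_def)
    then have lim: "((\<lambda>t. (h (z + t *\<^sub>R e) - h z) / t) \<longlongrightarrow> w \<bullet> e) (at 0)" for e
      by (rule GDERIV_directional)
    have "(\<lambda>n. q e n z) \<longlonglongrightarrow> w \<bullet> e" for e
      using lim[of e, unfolded tendsto_at_iff_sequentially, rule_format, of "\<lambda>n. inverse (real (Suc n))"]
        LIMSEQ_inverse_real_of_nat by (simp add: o_def q_def del: of_nat_Suc)
    then have "lim (\<lambda>n. q e n z) = w \<bullet> e" for e by (intro limI)
    then show ?thesis by (simp add: D_def euclidean_representation)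
  qed
  define w where "w z = (if dual_norm N (D z) \<le> C then D z else 0)" for z
  have [measurable]: "w \<in> borel_measurable borel" unfolding w_def by measurable
  show thesis
  proof (rule that[of w])
    show "dual_norm N (w z) \<le> C" for z using C by (simp add: w_def dual_norm_zero)
    show "AE z in lborel. z \<in> U \<longrightarrow> GDERIV f z :> w z"
      using seg_lipschitz_AE_differentiable[OF f U]
    proof (eventually_elim, intro impI)
      fix z assume "z \<in> U \<longrightarrow> (\<exists>w. GDERIV f z :> w)" "z \<in> U"
      then obtain \<xi> where \<xi>: "GDERIV f z :> \<xi>" by blast
      have "dual_norm N \<xi> \<le> C" by (rule dual_norm_gradient_le[OF f U \<open>z \<in> U\<close> \<xi>])
      then show "GDERIV f z :> w z" using \<xi> D[OF \<open>z \<in> U\<close> \<xi>] by (simp add: w_def)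
    qed
  qed measurable
qed

end

section \<open>The fundamental theorem of calculus along Lipschitz paths\<close>

lemma has_real_derivative_along_path:
  fixes \<gamma> :: "real \<Rightarrow> real ^ 'n"
  assumes "GDERIV H (\<gamma> t) :> D" "(\<gamma> has_vector_derivative \<gamma>') (at t)"
  shows "((\<lambda>t. H (\<gamma> t)) has_real_derivative D \<bullet> \<gamma>') (at t)"
proof -
  have "((\<lambda>t. H (\<gamma> t)) has_derivative (\<lambda>s. (s *\<^sub>R \<gamma>') \<bullet> D)) (at t)"
    using has_derivative_compose[of \<gamma> "\<lambda>s. s *\<^sub>R \<gamma>'" t UNIV H "\<lambda>h. h \<bullet> D"] assms
    by (simp add: gderiv_def has_vector_derivative_def)
  then show ?thesis by (simp add: has_field_derivative_def mult_commute_abs inner_commute)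
qed

context normed_coordinates
begin

lemma seg_lipschitz_along_lipschitz_path:
  assumes f: "seg_lipschitz C U f" and U: "open U" and \<gamma>: "\<gamma> ` {0..1} \<subseteq> U" "continuous_on {0..1} \<gamma>"
    and L: "\<And>s t. s \<in> {0..1} \<Longrightarrow> t \<in> {0..1} \<Longrightarrow> N (\<gamma> s - \<gamma> t) \<le> L * \<bar>s - t\<bar>"
    and st: "s \<in> {0..1}" "t \<in> {0..1}"
  shows "\<bar>f (\<gamma> t) - f (\<gamma> s)\<bar> \<le> C * L * \<bar>t - s\<bar>"
proof -
  define p where "p \<tau> = \<gamma> (s + \<tau> * (t - s))" for \<tau>
  have in01: "s + \<tau> * (t - s) \<in> {0..1}" if "\<tau> \<in> {0..1}" for \<tau>
    using convexD_alt[of "{0..1::real}" s t \<tau>] that st by (simp add: algebra_simps)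
  have "continuous_on {0..1} p"
    unfolding p_def by (rule continuous_on_compose2[OF \<gamma>(2)]) (use in01 in \<open>auto intro!: continuous_intros\<close>)
  then have path: "path p" by (simp add: path_def)
  have image: "path_image p \<subseteq> U" using \<gamma>(1) in01 by (auto simp: path_image_def p_def)
  have "curve_length N p \<le> ereal (L * \<bar>t - s\<bar>)"
  proof (rule curve_length_le_lipschitz)
    fix a b :: real assume "a \<in> {0..1}" "b \<in> {0..1}"
    then have "N (p a - p b) \<le> L * \<bar>(s + a * (t - s)) - (s + b * (t - s))\<bar>"
      unfolding p_def by (intro L in01)
    also have "(s + a * (t - s)) - (s + b * (t - s)) = (a - b) * (t - s)" by (simp add: algebra_simps)
    finally show "N (p a - p b) \<le> L * \<bar>t - s\<bar> * \<bar>a - b\<bar>" by (simp add: abs_mult mult_ac)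
  qed
  from seg_lipschitz_curve[OF f U path image this]
  show ?thesis by (simp add: p_def pathstart_def pathfinish_def mult.assoc)
qed

lemma lipschitz_path_AE_differentiable:
  assumes \<gamma>: "lipschitz_path N \<Omega> x y \<gamma>"
  shows "AE t in lborel. t \<in> {0<..<1} \<longrightarrow> (\<exists>\<gamma>'. (\<gamma> has_vector_derivative \<gamma>') (at t))"
proof -
  obtain L where L: "\<And>s t. s \<in> {0..1} \<Longrightarrow> t \<in> {0..1} \<Longrightarrow> N (\<gamma> s - \<gamma> t) \<le> L * \<bar>s - t\<bar>"
    using \<gamma> unfolding lipschitz_path_def by blast
  obtain b where b: "0 < b" "\<And>x. norm x \<le> b * N x" using norm_le_N by blast
  define c where "c t = max 0 (min 1 t)" for t :: real
  have c01: "c t \<in> {0..1}" for t by (simp add: c_def)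
  have c_lip: "\<bar>c s - c t\<bar> \<le> \<bar>s - t\<bar>" for s t by (auto simp: c_def)
  have L0: "0 \<le> L" using order_trans[OF N_nonneg L[of 0 1]] by simp
  have "AE t in lborel. \<forall>e\<in>Basis. \<exists>d. ((\<lambda>t. \<gamma> (c t) \<bullet> e) has_real_derivative d) (at t)"
  proof (subst AE_ball_countable, simp add: countable_finite, rule ballI)
    fix e :: "real^'n" assume e: "e \<in> Basis"
    have "\<bar>\<gamma> (c s) \<bullet> e - \<gamma> (c t) \<bullet> e\<bar> \<le> (b * L) * \<bar>s - t\<bar>" for s t
    proof -
      have "\<bar>(\<gamma> (c s) - \<gamma> (c t)) \<bullet> e\<bar> \<le> norm (\<gamma> (c s) - \<gamma> (c t))" by (rule Basis_le_norm[OF e])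
      also have "\<dots> \<le> b * N (\<gamma> (c s) - \<gamma> (c t))" by (rule b(2))
      also have "\<dots> \<le> b * (L * \<bar>s - t\<bar>)"
        using b(1) L[OF c01 c01, of s t] mult_left_mono[OF c_lip L0, of s t] by simp
      finally show ?thesis by (simp add: inner_diff_left mult.assoc)
    qed
    from lipschitz_real_derivative[OF this] obtain g
      where "AE t in lborel. ((\<lambda>t. \<gamma> (c t) \<bullet> e) has_real_derivative g t) (at t)" by metis
    then show "AE t in lborel. \<exists>d. ((\<lambda>t. \<gamma> (c t) \<bullet> e) has_real_derivative d) (at t)"
      by eventually_elim blast
  qed
  then show ?thesis
  proof (eventually_elim, intro impI)
    fix t :: real assume d: "\<forall>e\<in>Basis. \<exists>d. ((\<lambda>t. \<gamma> (c t) \<bullet> e) has_real_derivative d) (at t)"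
      and t: "t \<in> {0<..<1}"
    obtain d where d: "\<And>e. e \<in> Basis \<Longrightarrow> ((\<lambda>t. \<gamma> (c t) \<bullet> e) has_real_derivative d e) (at t)"
      using bchoice[OF d] by blast
    define \<gamma>' where "\<gamma>' = (\<Sum>e\<in>Basis. d e *\<^sub>R e)"
    have "((\<lambda>t. \<gamma> (c t)) has_vector_derivative \<gamma>') (at t)"
      unfolding has_vector_derivative_def
    proof (subst has_derivative_componentwise_within, rule ballI)
      fix e :: "real^'n" assume e: "e \<in> Basis"
      have "\<gamma>' \<bullet> e = d e" using e by (simp add: \<gamma>'_def)
      then have "(\<lambda>s. (s *\<^sub>R \<gamma>') \<bullet> e) = (*) (d e)" by (auto simp: mult.commute)
      then show "((\<lambda>t. \<gamma> (c t) \<bullet> e) has_derivative (\<lambda>s. (s *\<^sub>R \<gamma>') \<bullet> e)) (at t)"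
        using d[OF e] by (simp only: has_field_derivative_def)
    qed
    then have "(\<gamma> has_vector_derivative \<gamma>') (at t)"
      unfolding has_vector_derivative_def
      by (rule has_derivative_transform_within_open[where s="{0<..<1}"]) (use t in \<open>auto simp: c_def\<close>)
    then show "\<exists>\<gamma>'. (\<gamma> has_vector_derivative \<gamma>') (at t)" by blast
  qed
qed

text \<open>
  The composition of \<open>H\<close> and \<open>\<gamma>\<close>, extended by constants beyond the ends of \<open>{0..1}\<close>, is a Lipschitz
  function of one variable and so the integral of its derivative.  That derivative is the path
  integrand wherever \<open>\<gamma>\<close> is differentiable.  The integrand itself is measurable since it agrees
  almost everywhere with a measurable function.
\<close>

lemma path_integral_of_gradient:
  assumes H: "seg_lipschitz C U H" and U: "open U"
    and D: "\<And>z. z \<in> U \<Longrightarrow> GDERIV H z :> D z"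
    and \<gamma>: "lipschitz_path N U x y \<gamma>"
  shows "integrable (lebesgue_on {0..1}) (path_integrand D \<gamma>)"
    and "(LINT t|lebesgue_on {0..1}. path_integrand D \<gamma> t) = H y - H x"
proof -
  obtain L where L: "\<And>s t. s \<in> {0..1} \<Longrightarrow> t \<in> {0..1} \<Longrightarrow> N (\<gamma> s - \<gamma> t) \<le> L * \<bar>s - t\<bar>"
    using \<gamma> unfolding lipschitz_path_def by blast
  have L0: "0 \<le> L" using order_trans[OF N_nonneg L[of 0 1]] by simp
  have C0: "0 \<le> C" using H by (simp add: seg_lipschitz_def)
  have \<gamma>U: "\<gamma> ` {0..1} \<subseteq> U" "\<gamma> 0 = x" "\<gamma> 1 = y" using \<gamma> by (auto simp: lipschitz_path_def)
  have c\<gamma>: "continuous_on {0..1} \<gamma>" using lipschitz_path_path(1)[OF \<gamma>] by (simp add: path_def)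
  define c where "c t = max 0 (min 1 t)" for t :: real
  have c01: "c t \<in> {0..1}" for t by (simp add: c_def)
  have c_lip: "\<bar>c s - c t\<bar> \<le> \<bar>s - t\<bar>" for s t by (auto simp: c_def)
  define F where "F t = H (\<gamma> (c t))" for t
  have "\<bar>F s - F t\<bar> \<le> (C * L) * \<bar>s - t\<bar>" for s t
    using seg_lipschitz_along_lipschitz_path[OF H U \<gamma>U(1) c\<gamma> L c01 c01, of t s]
      mult_left_mono[OF c_lip, of "C * L" s t] C0 L0
    by (simp add: F_def abs_minus_commute)
  then obtain g where [measurable]: "g \<in> borel_measurable borel"
    and g: "AE t in lborel. (F has_real_derivative g t) (at t)"
    and gi: "\<And>a b. a \<le> b \<Longrightarrow> set_integrable lborel {a..b} g \<and> (LINT t:{a..b}|lborel. g t) = F b - F a"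
    by (rule lipschitz_real_derivative) blast
  have eq: "AE t in lborel. indicator {0..1} t *\<^sub>R g t = indicator {0..1} t *\<^sub>R path_integrand D \<gamma> t"
    using g lipschitz_path_AE_differentiable[OF \<gamma>] AE_lborel_singleton[of 0] AE_lborel_singleton[of 1]
  proof eventually_elim
    case (elim t)
    show ?case
    proof (cases "t \<in> {0..1}")
      case True
      then have t: "t \<in> {0<..<1}" using elim by auto
      then obtain \<gamma>' where \<gamma>': "(\<gamma> has_vector_derivative \<gamma>') (at t)" using elim by blast
      have "\<gamma> t \<in> U" using True \<gamma>U(1) by blast
      then have "((\<lambda>t. H (\<gamma> t)) has_real_derivative D (\<gamma> t) \<bullet> \<gamma>') (at t)"
        by (intro has_real_derivative_along_path D \<gamma>')
      moreover have "((\<lambda>t. H (\<gamma> t)) has_real_derivative g t) (at t)"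
        using elim(1) unfolding has_field_derivative_def
        by (rule has_derivative_transform_within_open[where s="{0<..<1}"]) (use t in \<open>auto simp: F_def c_def\<close>)
      ultimately have "D (\<gamma> t) \<bullet> \<gamma>' = g t" by (rule DERIV_unique)
      moreover have "vector_derivative \<gamma> (at t within {0..1}) = \<gamma>'"
        by (rule vector_derivative_at_within_ivl[OF \<gamma>']) (use t in auto)
      ultimately show ?thesis by (simp add: path_integrand_def)
    qed simp
  qed
  then have eq': "AE t in lebesgue. indicator {0..1} t *\<^sub>R g t = indicator {0..1} t *\<^sub>R path_integrand D \<gamma> t"
    by (rule AE_completion)
  have m1: "(\<lambda>t. indicator {0..1} t *\<^sub>R g t) \<in> borel_measurable lborel" by measurable
  then have m1': "(\<lambda>t. indicator {0..1} t *\<^sub>R g t) \<in> borel_measurable lebesgue" by (rule measurable_completion)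
  have m2: "(\<lambda>t. indicator {0..1} t *\<^sub>R path_integrand D \<gamma> t) \<in> borel_measurable lebesgue"
    by (rule borel_measurable_AE[OF m1' eq'])
  have "integrable lebesgue (\<lambda>t. indicator {0..1} t *\<^sub>R g t)"
    using gi[of 0 1] m1 by (simp add: integrable_completion set_integrable_def)
  then have "integrable lebesgue (\<lambda>t. indicator {0..1} t *\<^sub>R path_integrand D \<gamma> t)"
    by (rule integrable_cong_AE_imp[OF _ m2]) (use eq' in \<open>auto elim: eventually_mono\<close>)
  then show "integrable (lebesgue_on {0..1}) (path_integrand D \<gamma>)"
    by (subst integrable_restrict_space) auto
  have "(LINT t|lebesgue_on {0..1}. path_integrand D \<gamma> t)
      = (LINT t|lebesgue. indicator {0..1} t *\<^sub>R path_integrand D \<gamma> t)"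
    by (rule integral_restrict_space) simp
  also have "\<dots> = (LINT t|lebesgue. indicator {0..1} t *\<^sub>R g t)"
    by (rule integral_cong_AE[OF m2 m1']) (use eq' in \<open>auto elim: eventually_mono\<close>)
  also have "\<dots> = (LINT t|lborel. indicator {0..1} t *\<^sub>R g t)"
    by (rule integral_completion[OF m1])
  also have "\<dots> = F 1 - F 0" using gi[of 0 1] by (simp add: set_lebesgue_integral_def)
  also have "\<dots> = H y - H x" using \<gamma>U by (simp add: F_def c_def)
  finally show "(LINT t|lebesgue_on {0..1}. path_integrand D \<gamma> t) = H y - H x" .
qed

end

section \<open>Mollifying functions on a domain\<close>

context normed_coordinates
begin

text \<open>
  The factor \<open>k\<^sup>n\<close> in \<^const>\<open>dilate\<close> compensates the Jacobian of the dilation.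
\<close>

lemma kernel_dilate:
  assumes u: "is_mollifier N u" and k: "0 < k"
  shows "kernel (1 / real k) (dilate u k)"
proof -
  have nn: "\<And>x. 0 \<le> u x" and ck: "Ck (Suc 0) u" and cl: "closure {x. u x \<noteq> 0} \<subseteq> {x. N x \<le> 1}"
    and int: "(LINT x|lebesgue. u x) = 1"
    using u unfolding is_mollifier_def by blast+
  obtain D where D: "\<And>x. GDERIV u x :> D x" and cD: "\<And>i. continuous_on UNIV (\<lambda>x. D x $ i)"
    using ck unfolding Ck.simps by blast
  have contD: "continuous_on UNIV D"
    using continuous_on_vec_lambda[of UNIV "\<lambda>i x. D x $ i"] cD by simp
  have "continuous_on UNIV u"
  proof (rule continuous_at_imp_continuous_on, rule ballI)
    show "isCont u x" for x
      using D[of x] unfolding gderiv_def by (rule has_derivative_continuous)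
  qed
  then have [measurable]: "u \<in> borel_measurable borel" by (rule borel_measurable_continuous_onI)
  have "(LINT x|lborel. u x) = (LINT x|density (distr lborel borel (\<lambda>x. 0 + real k *\<^sub>R x)) (\<lambda>_. \<bar>real k\<bar> ^ DIM(real^'n)). u x)"
    using k by (intro arg_cong[where f="\<lambda>M. integral\<^sup>L M u"] lborel_affine) simp
  also have "\<dots> = (LINT x|lborel. real k ^ CARD('n) * u (real k *\<^sub>R x))"
    by (simp add: integral_density integral_distr)
  finally have 1: "(LINT x|lborel. dilate u k x) = 1"
    using int by (simp add: integral_completion dilate_def[abs_def])
  have 2: "0 \<le> dilate u k x" for x using nn by (simp add: dilate_def)
  have 3: "N x \<le> 1 / real k" if "dilate u k x \<noteq> 0" for x
  proof -
    have "u (real k *\<^sub>R x) \<noteq> 0" using that by (auto simp: dilate_def)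
    then have "real k *\<^sub>R x \<in> {x. N x \<le> 1}" using cl closure_subset[of "{x. u x \<noteq> 0}"] by auto
    then show ?thesis using k by (simp add: N_scaleR field_simps)
  qed
  have 4: "GDERIV (dilate u k) x :> (real k ^ CARD('n) * real k) *\<^sub>R D (real k *\<^sub>R x)" for x
  proof -
    have "(u has_derivative (\<lambda>h. h \<bullet> D (real k *\<^sub>R x))) (at (real k *\<^sub>R x))"
      using D by (simp add: gderiv_def)
    then have "((\<lambda>x. u (real k *\<^sub>R x)) has_derivative (\<lambda>h. (real k *\<^sub>R h) \<bullet> D (real k *\<^sub>R x))) (at x)"
      by (rule has_derivative_compose[rotated]) (auto intro!: derivative_eq_intros)
    from has_derivative_mult_right[OF this, of "real k ^ CARD('n)"]
    have "(dilate u k has_derivative (\<lambda>h. real k ^ CARD('n) * ((real k *\<^sub>R h) \<bullet> D (real k *\<^sub>R x)))) (at x)"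
      by (simp only: dilate_def[abs_def])
    then show ?thesis by (simp add: gderiv_def mult.assoc)
  qed
  have 5: "continuous_on UNIV (\<lambda>x. (real k ^ CARD('n) * real k) *\<^sub>R D (real k *\<^sub>R x))"
    by (rule continuous_on_scaleR[OF continuous_on_const continuous_on_compose2[OF contD]])
      (auto intro!: continuous_intros)
  have "\<exists>D'. (\<forall>x. GDERIV (dilate u k) x :> D' x) \<and> continuous_on UNIV D'"
    by (rule exI, rule conjI[OF allI[OF 4] 5])
  then show ?thesis using 1 2 3 by (simp only: kernel_def) blast
qed

text \<open>
  The strict inequality in \<^const>\<open>inner_part\<close> provides a ball that is strictly larger than the
  support of \<open>u\<^sub>k\<close>, and thereby the room to differentiate.
\<close>

lemma inner_part_iff: "x \<in> inner_part N \<Omega> k \<longleftrightarrow> (\<exists>r > 1 / real k. nball x r \<subseteq> \<Omega>)"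
proof
  assume "x \<in> inner_part N \<Omega> k"
  then have "ereal (1 / real k) < (INF y\<in>- \<Omega>. ereal (N (x - y)))" by (simp add: inner_part_def)
  then obtain r where r: "ereal (1 / real k) < ereal r" "ereal r < (INF y\<in>- \<Omega>. ereal (N (x - y)))"
    by (rule ereal_dense2[elim_format]) blast
  have "nball x r \<subseteq> \<Omega>"
  proof (rule ccontr)
    assume "\<not> nball x r \<subseteq> \<Omega>"
    then obtain y where y: "y \<in> - \<Omega>" "N (x - y) < r" by (auto simp: nball_def N_commute)
    have "(INF y\<in>- \<Omega>. ereal (N (x - y))) \<le> ereal (N (x - y))" by (rule INF_lower[OF y(1)])
    then have "ereal r < ereal (N (x - y))" by (rule less_le_trans[OF r(2)])
    then show False using y(2) by simp
  qed
  then show "\<exists>r > 1 / real k. nball x r \<subseteq> \<Omega>" using r(1) by auto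
next
  assume "\<exists>r > 1 / real k. nball x r \<subseteq> \<Omega>"
  then obtain r where r: "1 / real k < r" "nball x r \<subseteq> \<Omega>" by blast
  have "0 < r" by (rule le_less_trans[OF _ r(1)]) simp
  then have "x \<in> \<Omega>" using r(2) by auto
  have "ereal r \<le> (INF y\<in>- \<Omega>. ereal (N (x - y)))"
  proof (rule INF_greatest)
    fix y assume "y \<in> - \<Omega>"
    then have "y \<notin> nball x r" using r(2) by blast
    then show "ereal r \<le> ereal (N (x - y))" by (simp add: nball_def N_commute)
  qed
  then have "ereal (1 / real k) < (INF y\<in>- \<Omega>. ereal (N (x - y)))"
    by (rule less_le_trans[rotated]) (use r(1) in simp)
  then show "x \<in> inner_part N \<Omega> k" using \<open>x \<in> \<Omega>\<close> by (simp add: inner_part_def)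
qed

lemma inner_part_subset: "inner_part N \<Omega> k \<subseteq> \<Omega>"
  by (auto simp: inner_part_def)

lemma inner_part_nested:
  assumes "x \<in> inner_part N \<Omega> m" "N (y - x) \<le> s" "s + 1 / real k \<le> 1 / real m"
  shows "y \<in> inner_part N \<Omega> k"
proof -
  obtain r where r: "1 / real m < r" "nball x r \<subseteq> \<Omega>" using assms(1) unfolding inner_part_iff by blast
  have "nball y (r - s) \<subseteq> \<Omega>" using nball_subset[of y x "r - s" r] assms(2) r(2) by auto
  moreover have "1 / real k < r - s" using assms(3) r(1) by linarith
  ultimately show ?thesis unfolding inner_part_iff by blast
qed

text \<open>
  A point with room for two successive mollifications.
\<close>

lemma inner_part_inner_part:
  assumes z: "z \<in> inner_part N \<Omega> m" and jk: "1 / real j + 1 / real k \<le> 1 / real m"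
  shows "z \<in> inner_part N (inner_part N \<Omega> k) j"
proof -
  obtain r where r: "1 / real m < r" "nball z r \<subseteq> \<Omega>" using z unfolding inner_part_iff by blast
  have "nball z (r - 1 / real k) \<subseteq> inner_part N \<Omega> k"
  proof
    fix y assume "y \<in> nball z (r - 1 / real k)"
    then have "1 / real k < r - N (y - z)" by (simp add: nball_def)
    moreover have "nball y (r - N (y - z)) \<subseteq> \<Omega>" using nball_subset[of y z "r - N (y - z)" r] r(2) by auto
    ultimately show "y \<in> inner_part N \<Omega> k" unfolding inner_part_iff by blast
  qed
  moreover have "1 / real j < r - 1 / real k" using r(1) jk by linarith
  ultimately show ?thesis unfolding inner_part_iff by blast
qed

lemma open_inner_part: "open (inner_part N \<Omega> k)"
proof (rule Topological_Spaces.openI)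
  fix x assume "x \<in> inner_part N \<Omega> k"
  then obtain r where r: "1 / real k < r" "nball x r \<subseteq> \<Omega>" unfolding inner_part_iff by blast
  define s where "s = (r - 1 / real k) / 2"
  have s: "0 < s" "1 / real k < r - s" using r(1) by (auto simp: s_def field_simps)
  have "nball x s \<subseteq> inner_part N \<Omega> k"
  proof
    fix y assume "y \<in> nball x s"
    then have "nball y (r - s) \<subseteq> \<Omega>" using nball_subset[of y x "r - s" r] r(2) by (auto simp: nball_def)
    then show "y \<in> inner_part N \<Omega> k" using s(2) unfolding inner_part_iff by blast
  qed
  then show "\<exists>T. open T \<and> x \<in> T \<and> T \<subseteq> inner_part N \<Omega> k" using s(1) by (intro exI[of _ "nball x s"]) simp
qed

lemma inner_part_mono:
  assumes "0 < m" "m \<le> k"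
  shows "inner_part N \<Omega> m \<subseteq> inner_part N \<Omega> k"
proof
  fix x assume "x \<in> inner_part N \<Omega> m"
  moreover have "1 / real k \<le> 1 / real m" using assms by (simp add: frac_le)
  ultimately show "x \<in> inner_part N \<Omega> k" using inner_part_nested[of x \<Omega> m x 0 k] by simp
qed

lemma compact_subset_inner_part:
  assumes \<Omega>: "open \<Omega>" and K: "compact K" "K \<subseteq> \<Omega>"
  obtains m where "0 < m" "\<And>k. m \<le> k \<Longrightarrow> K \<subseteq> inner_part N \<Omega> k"
proof -
  have "K \<subseteq> (\<Union>k\<in>{0<..}. inner_part N \<Omega> k)"
  proof
    fix x assume "x \<in> K"
    then obtain r where r: "0 < r" "nball x r \<subseteq> \<Omega>" using open_contains_nball[OF \<Omega>] K(2) by blast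
    obtain n where "inverse (real (Suc n)) < r" using r(1) reals_Archimedean by blast
    then have "x \<in> inner_part N \<Omega> (Suc n)"
      using r(2) unfolding inner_part_iff inverse_eq_divide by blast
    then show "x \<in> (\<Union>k\<in>{0<..}. inner_part N \<Omega> k)" by blast
  qed
  then obtain T where T: "T \<subseteq> {0<..}" "finite T" "K \<subseteq> (\<Union>k\<in>T. inner_part N \<Omega> k)"
    by (rule compactE_image[OF K(1), rotated]) (auto simp: open_inner_part)
  show thesis
  proof (rule that[of "Suc (\<Sum>T)"])
    fix k assume k: "Suc (\<Sum>T) \<le> k"
    show "K \<subseteq> inner_part N \<Omega> k"
    proof
      fix x assume "x \<in> K"
      then obtain j where j: "j \<in> T" "x \<in> inner_part N \<Omega> j" using T(3) by blast
      have "j \<le> \<Sum>T" using member_le_sum[OF j(1), of id] T(2) by simp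
      then have "j \<le> k" using k by simp
      then show "x \<in> inner_part N \<Omega> k" using j T(1) inner_part_mono[of j k \<Omega>] by auto
    qed
  qed simp
qed

lemma seg_lipschitz_shift:
  assumes f: "seg_lipschitz C U f" and x: "x \<in> inner_part N U k" and z: "N z \<le> 1 / real k"
  shows "norm (f (x - z) - f x) \<le> C / real k"
proof -
  obtain r where r: "1 / real k < r" "nball x r \<subseteq> U" using x unfolding inner_part_iff by blast
  have C: "0 \<le> C" using f by (simp add: seg_lipschitz_def)
  have "0 < r" by (rule le_less_trans[OF _ r(1)]) simp
  have "\<bar>f (x - z) - f x\<bar> \<le> C * N ((x - z) - x)"
    by (rule seg_lipschitz_convex[OF f convex_nball r(2)]) (use z r \<open>0 < r\<close> in \<open>auto simp: nball_def\<close>)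
  also have "\<dots> \<le> C * (1 / real k)" using z C by (intro mult_left_mono) auto
  finally show ?thesis by simp
qed

end

context mollifying_sequence
begin

lemma GDERIV_mollify_seg_lipschitz:
  assumes f: "seg_lipschitz C U f" and k: "0 < k" and x: "x \<in> inner_part N U k"
    and m: "f \<in> borel_measurable borel" "g \<in> borel_measurable borel"
    and der: "AE y in lborel. y \<in> U \<longrightarrow> GDERIV f y :> g y"
  shows "GDERIV (mollify (v k) f) x :> mollify (v k) g x"
proof -
  obtain r where r: "1 / real k < r" "nball x r \<subseteq> U" using x unfolding inner_part_iff by blast
  obtain B where B: "0 < B" "\<And>x. N x \<le> B * norm x" using N_le_norm by blast
  have C: "0 \<le> C" using f by (simp add: seg_lipschitz_def)
  show ?thesis
  proof (rule GDERIV_mollify[OF kernel[OF k] r(1) m, of "C * B"])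
    fix y z assume "y \<in> nball x r" "z \<in> nball x r"
    then have "\<bar>f y - f z\<bar> \<le> C * N (y - z)" by (rule seg_lipschitz_convex[OF f convex_nball r(2)])
    also have "\<dots> \<le> C * (B * norm (y - z))" using B C by (intro mult_left_mono) auto
    finally show "\<bar>f y - f z\<bar> \<le> C * B * norm (y - z)" by (simp add: mult.assoc)
  qed (use der r(2) C B in \<open>auto elim!: eventually_mono\<close>)
qed

lemma mollify_seg_lipschitz_close:
  assumes f: "seg_lipschitz C U f" and k: "0 < k" and x: "x \<in> inner_part N U k"
    and m: "f \<in> borel_measurable borel"
  shows "\<bar>mollify (v k) f x - f x\<bar> \<le> C / real k"
  using norm_mollify_minus_le[OF kernel[OF k] m seg_lipschitz_shift[OF f x]] by simp

lemma mollify_integrable_seg_lipschitz: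
  assumes f: "seg_lipschitz C U f" and k: "0 < k" and x: "x \<in> inner_part N U k"
    and m: "f \<in> borel_measurable borel"
  shows "integrable lborel (\<lambda>z. v k z * f (x - z))"
proof -
  have "norm (f (x - z)) \<le> \<bar>f x\<bar> + C / real k" if "N z \<le> 1 / real k" for z
    using seg_lipschitz_shift[OF f x that] by simp
  then have "integrable lborel (\<lambda>z. v k z *\<^sub>R f (x - z))" by (rule mollify_integrable[OF kernel[OF k] m])
  then show ?thesis by simp
qed

lemma dual_norm_mollify_le:
  assumes k: "0 < k" and g: "g \<in> borel_measurable borel" and C: "\<And>x. dual_norm N (g x) \<le> C"
  shows "dual_norm N (mollify (v k) g x) \<le> C"
proof (rule dual_norm_le)
  have C0: "0 \<le> C" using order_trans[OF dual_norm_nonneg C] .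
  then show "0 \<le> C" .
  obtain B where gb: "\<And>x. norm (g x) \<le> B" using norm_bound_of_dual_norm_bound[of g C] C by blast
  fix e
  have "mollify (v k) g x \<bullet> e = mollify (v k) (\<lambda>y. g y \<bullet> e) x"
    by (rule inner_mollify[OF kernel[OF k] g gb])
  also have "norm \<dots> \<le> C * N e"
  proof (rule norm_mollify_le[OF kernel[OF k]])
    show "(\<lambda>y. g y \<bullet> e) \<in> borel_measurable borel" using g by measurable
    show "norm (g (x - z) \<bullet> e) \<le> C * N e" for z
      using abs_inner_le_dual_norm[of "g (x - z)" e] mult_right_mono[OF C N_nonneg[of e], of "x - z"] by simp
  qed
  finally show "\<bar>mollify (v k) g x \<bullet> e\<bar> \<le> C * N e" by simp
qed

lemma mollify_seg_lipschitz_tendsto: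
  assumes f: "seg_lipschitz C U f" and U: "open U" and x: "x \<in> U" and m: "f \<in> borel_measurable borel"
  shows "(\<lambda>k. mollify (v k) f x) \<longlonglongrightarrow> f x"
proof -
  obtain j where j: "0 < j" "\<And>k. j \<le> k \<Longrightarrow> {x} \<subseteq> inner_part N U k"
    using compact_subset_inner_part[OF U, of "{x}"] x by auto
  have "(\<lambda>k. mollify (v k) f x - f x) \<longlonglongrightarrow> 0"
  proof (rule Lim_null_comparison)
    show "\<forall>\<^sub>F k in sequentially. norm (mollify (v k) f x - f x) \<le> C * (1 / real k)"
      using eventually_ge_at_top[of j]
    proof eventually_elim
      case (elim k)
      then show ?case using mollify_seg_lipschitz_close[OF f _ _ m, of k x] j by simp
    qed
    show "(\<lambda>k. C * (1 / real k)) \<longlonglongrightarrow> 0" using tendsto_mult_right[OF lim_1_over_n, of C] by simp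
  qed
  then show ?thesis by (rule LIM_zero_cancel)
qed

text \<open>
  The vanishing principle, applied to the coordinates of \<open>g - w\<close>.
\<close>

lemma AE_eq_of_mollify_eq:
  assumes S: "open S" and g: "g \<in> borel_measurable borel" "\<And>x. dual_norm N (g x) \<le> C"
    and w: "w \<in> borel_measurable borel" "\<And>x. dual_norm N (w x) \<le> C"
    and eq: "\<And>k x. m \<le> k \<Longrightarrow> 0 < k \<Longrightarrow> x \<in> S \<Longrightarrow> mollify (v k) g x = mollify (v k) w x"
  shows "AE x in lborel. x \<in> S \<longrightarrow> g x = w x"
proof -
  note [measurable] = g(1) w(1)
  obtain Bg where gb: "\<And>x. norm (g x) \<le> Bg" using norm_bound_of_dual_norm_bound[of g C] g(2) by blast
  obtain Bw where wb: "\<And>x. norm (w x) \<le> Bw" using norm_bound_of_dual_norm_bound[of w C] w(2) by blast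
  have "AE x in lborel. \<forall>e\<in>Basis. x \<in> S \<longrightarrow> g x \<bullet> e - w x \<bullet> e = 0"
  proof (subst AE_ball_countable, simp add: countable_finite, rule ballI)
    fix e :: "real^'n" assume e: "e \<in> Basis"
    have gbe: "\<bar>g x \<bullet> e\<bar> \<le> Bg" for x by (rule order_trans[OF Basis_le_norm[OF e] gb])
    have wbe: "\<bar>w x \<bullet> e\<bar> \<le> Bw" for x by (rule order_trans[OF Basis_le_norm[OF e] wb])
    show "AE x in lborel. x \<in> S \<longrightarrow> g x \<bullet> e - w x \<bullet> e = 0"
    proof (rule AE_zero_of_mollification_sequence_zero[OF S, where m="max m 1"])
      show "\<bar>g x \<bullet> e - w x \<bullet> e\<bar> \<le> Bg + Bw" for x
        using gbe[of x] wbe[of x] by linarith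
      fix k x assume k: "max m 1 \<le> k" and x: "x \<in> S"
      then have k0: "0 < k" "m \<le> k" by auto
      have i: "integrable lborel (\<lambda>z. v k z *\<^sub>R (h (x - z) \<bullet> e))"
        if "h \<in> borel_measurable borel" "\<And>x. \<bar>h x \<bullet> e\<bar> \<le> B" for h B
        using that by (intro mollify_integrable[OF kernel[OF k0(1)], where f="\<lambda>x. h x \<bullet> e"]) auto
      have "mollify (v k) (\<lambda>x. g x \<bullet> e - w x \<bullet> e) x = mollify (v k) (\<lambda>x. g x \<bullet> e) x - mollify (v k) (\<lambda>x. w x \<bullet> e) x"
        unfolding mollify_def scaleR_diff_right
        by (rule Bochner_Integration.integral_diff[OF i[OF g(1) gbe] i[OF w(1) wbe]])
      also have "\<dots> = mollify (v k) g x \<bullet> e - mollify (v k) w x \<bullet> e"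
        using inner_mollify[OF kernel[OF k0(1)] g(1) gb, of x e]
          inner_mollify[OF kernel[OF k0(1)] w(1) wb, of x e] by simp
      also have "\<dots> = 0" using eq[OF k0(2,1) x] by simp
      finally show "mollify (v k) (\<lambda>x. g x \<bullet> e - w x \<bullet> e) x = 0" .
    qed measurable
  qed
  then show ?thesis
    by eventually_elim (auto intro: euclidean_eqI)
qed

text \<open>
  The mollifications of \<open>f\<close> and \<open>h\<close> have the same gradient, so they differ by a constant along a
  path from \<open>x\<close> to \<open>y\<close>; they converge to \<open>f\<close> and \<open>h\<close>.
\<close>

lemma seg_lipschitz_eq_of_gradient_eq:
  assumes U: "open U" "connected U" and f: "seg_lipschitz C U f" "f \<in> borel_measurable borel"
    and h: "seg_lipschitz C' U h" "h \<in> borel_measurable borel" and g: "g \<in> borel_measurable borel"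
    and df: "AE z in lborel. z \<in> U \<longrightarrow> GDERIV f z :> g z"
    and dh: "AE z in lborel. z \<in> U \<longrightarrow> GDERIV h z :> g z"
    and xy: "x \<in> U" "y \<in> U"
  shows "f x - f y = h x - h y"
proof -
  obtain \<gamma> where \<gamma>: "lipschitz_path N U x y \<gamma>" using lipschitz_path_exists[OF U xy] by blast
  note p = lipschitz_path_path[OF \<gamma>]
  have P: "compact (path_image \<gamma>)" "connected (path_image \<gamma>)" "x \<in> path_image \<gamma>" "y \<in> path_image \<gamma>"
    using p pathstart_in_path_image[of \<gamma>] pathfinish_in_path_image[of \<gamma>]
    by (auto simp: compact_path_image connected_path_image)
  obtain m where m: "0 < m" "\<And>k. m \<le> k \<Longrightarrow> path_image \<gamma> \<subseteq> inner_part N U k"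
    using compact_subset_inner_part[OF U(1) P(1) p(2)] by blast
  have ev: "\<forall>\<^sub>F k in sequentially. mollify (v k) f x - mollify (v k) f y = mollify (v k) h x - mollify (v k) h y"
    using eventually_ge_at_top[of m]
  proof eventually_elim
    case (elim k)
    then have k: "0 < k" using m by simp
    show ?case
      by (rule gradients_eq_differences_eq[OF open_inner_part P(2) m(2)[OF elim] _ _ P(3,4)])
        (rule GDERIV_mollify_seg_lipschitz[OF f(1) k _ f(2) g df] GDERIV_mollify_seg_lipschitz[OF h(1) k _ h(2) g dh], assumption)+
  qed
  have "(\<lambda>k. mollify (v k) f x - mollify (v k) f y) \<longlonglongrightarrow> f x - f y"
    by (intro tendsto_diff mollify_seg_lipschitz_tendsto[OF f(1) U(1) _ f(2)] xy)
  then have "(\<lambda>k. mollify (v k) h x - mollify (v k) h y) \<longlonglongrightarrow> f x - f y"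
    by (rule Lim_transform_eventually[OF _ ev])
  moreover have "(\<lambda>k. mollify (v k) h x - mollify (v k) h y) \<longlonglongrightarrow> h x - h y"
    by (intro tendsto_diff mollify_seg_lipschitz_tendsto[OF h(1) U(1) _ h(2)] xy)
  ultimately show ?thesis by (rule LIMSEQ_unique)
qed

text \<open>
  A given segment may lie in the null set where \<open>f\<close> has no gradient.  The mollification averages over
  parallel segments nearby, and its gradient obeys the same bound everywhere.
\<close>

lemma seg_lipschitz_of_gradient_bound:
  assumes U: "open U" and f: "seg_lipschitz C' U f" "f \<in> borel_measurable borel"
    and g: "g \<in> borel_measurable borel" "\<And>z. dual_norm N (g z) \<le> C"
    and df: "AE z in lborel. z \<in> U \<longrightarrow> GDERIV f z :> g z"
  shows "seg_lipschitz C U f"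
  unfolding seg_lipschitz_def
proof (intro conjI allI impI)
  show C0: "0 \<le> C" using order_trans[OF dual_norm_nonneg g(2)] .
  fix x y assume s: "closed_segment x y \<subseteq> U"
  have xy: "x \<in> U" "y \<in> U" using s by auto
  obtain m where m: "0 < m" "\<And>k. m \<le> k \<Longrightarrow> closed_segment x y \<subseteq> inner_part N U k"
    using compact_subset_inner_part[OF U compact_segment s] by blast
  have "\<forall>\<^sub>F k in sequentially. \<bar>mollify (v k) f x - mollify (v k) f y\<bar> \<le> C * N (x - y)"
    using eventually_ge_at_top[of m]
  proof eventually_elim
    case (elim k)
    then have k: "0 < k" using m by simp
    have "seg_lipschitz C (inner_part N U k) (mollify (v k) f)"
      by (rule seg_lipschitz_of_gradient[OF GDERIV_mollify_seg_lipschitz[OF f(1) k _ f(2) g(1) df]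
            dual_norm_mollify_le[OF k g] C0])
    then show ?case using m(2)[OF elim] by (auto simp: seg_lipschitz_def)
  qed
  moreover have "(\<lambda>k. \<bar>mollify (v k) f x - mollify (v k) f y\<bar>) \<longlonglongrightarrow> \<bar>f x - f y\<bar>"
    by (intro tendsto_rabs tendsto_diff mollify_seg_lipschitz_tendsto[OF f(1) U _ f(2)] xy)
  ultimately show "\<bar>f x - f y\<bar> \<le> C * N (x - y)"
    by (intro tendsto_upperbound[where F=sequentially]) auto
qed

end

section \<open>Fields with conservative mollifications are gradients\<close>

lemma inverse_double_sum_le:
  assumes "0 < m" "2 * m \<le> j" "2 * m \<le> k"
  shows "1 / real j + 1 / real k \<le> 1 / real m"
proof -
  have "1 / real j \<le> 1 / real (2 * m)" "1 / real k \<le> 1 / real (2 * m)"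
    using assms by (intro frac_le; simp)+
  then show ?thesis by simp
qed

text \<open>
  The situation of the surjectivity proof: \<open>h k\<close> is a potential of the field \<open>g\<close> mollified at scale
  \<open>1 / k\<close>.
\<close>

locale mollified_conservative_field = mollifying_sequence N v
  for N :: "real ^ 'n \<Rightarrow> real" and v +
  fixes \<Omega> :: "(real ^ 'n) set" and g :: "real ^ 'n \<Rightarrow> real ^ 'n" and C :: real and x0 :: "real ^ 'n"
    and h :: "nat \<Rightarrow> real ^ 'n \<Rightarrow> real"
  assumes domain: "open \<Omega>" "connected \<Omega>" "x0 \<in> \<Omega>"
    and g_measurable [measurable]: "g \<in> borel_measurable borel"
    and g_bound: "dual_norm N (g x) \<le> C"
    and h_measurable [measurable]: "h k \<in> borel_measurable borel"
    and h_gradient: "0 < k \<Longrightarrow> x \<in> inner_part N \<Omega> k \<Longrightarrow> GDERIV (h k) x :> mollify (v k) g x"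
begin

lemma C_nonneg: "0 \<le> C"
  using order_trans[OF dual_norm_nonneg g_bound] .

lemma mollify_g_measurable:
  assumes "0 < k"
  shows "mollify (v k) g \<in> borel_measurable borel"
proof -
  obtain B where "\<And>x. norm (g x) \<le> B" using norm_bound_of_dual_norm_bound[of g C] g_bound by blast
  then show ?thesis
    by (intro borel_measurable_continuous_onI continuous_on_mollify[OF kernel[OF assms] g_measurable])
qed

lemma h_seg_lipschitz: "0 < k \<Longrightarrow> seg_lipschitz C (inner_part N \<Omega> k) (h k)"
  by (rule seg_lipschitz_of_gradient[OF h_gradient dual_norm_mollify_le[OF _ g_measurable g_bound] C_nonneg])

text \<open>
  Both functions have the gradient obtained by mollifying \<open>g\<close> twice, at the scales \<open>1 / j\<close> and
  \<open>1 / k\<close>; the order is irrelevant by \<open>mollify_commute\<close>.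
\<close>

lemma mollify_h_differences:
  assumes jk: "0 < j" "0 < k" "1 / real j + 1 / real k \<le> 1 / real m"
    and P: "connected P" "P \<subseteq> inner_part N \<Omega> m" "x \<in> P" "y \<in> P"
  shows "mollify (v j) (h k) x - mollify (v j) (h k) y = mollify (v k) (h j) x - mollify (v k) (h j) y"
proof (rule gradients_eq_differences_eq[OF open_inner_part P(1,2) _ _ P(3,4)])
  fix z assume z: "z \<in> inner_part N \<Omega> m"
  have grad: "GDERIV (mollify (v j) (h k)) z :> mollify (v j) (mollify (v k) g) z"
    if "0 < j" "0 < k" "1 / real j + 1 / real k \<le> 1 / real m" for j k
    by (rule GDERIV_mollify_seg_lipschitz[OF h_seg_lipschitz[OF that(2)] that(1)
          inner_part_inner_part[OF z that(3)] h_measurable mollify_g_measurable[OF that(2)]])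
      (use h_gradient[OF that(2)] in auto)
  show "GDERIV (mollify (v j) (h k)) z :> mollify (v j) (mollify (v k) g) z"
    by (rule grad[OF jk])
  obtain B where B: "\<And>x. norm (g x) \<le> B" using norm_bound_of_dual_norm_bound[of g C] g_bound by blast
  have "mollify (v k) (mollify (v j) g) z = mollify (v j) (mollify (v k) g) z"
    by (rule mollify_commute[OF kernel[OF jk(2)] kernel[OF jk(1)] g_measurable B])
  then show "GDERIV (mollify (v k) (h j)) z :> mollify (v j) (mollify (v k) g) z"
    using grad[OF jk(2,1)] jk(3) by (simp add: add.commute)
qed

lemma mollify_h_close:
  assumes jk: "0 < j" "0 < k" "1 / real j + 1 / real k \<le> 1 / real m" and x: "x \<in> inner_part N \<Omega> m"
  shows "\<bar>mollify (v j) (h k) x - h k x\<bar> \<le> C / real j"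
  by (rule mollify_seg_lipschitz_close[OF h_seg_lipschitz[OF jk(2)] jk(1) inner_part_inner_part[OF x jk(3)] h_measurable])

text \<open>
  Each potential is close to its mollification, and the mollifications of \<open>h k\<close> at scale \<open>1 / j\<close> and
  of \<open>h j\<close> at scale \<open>1 / k\<close> have equal differences.
\<close>

lemma h_differences_close:
  assumes jk: "0 < j" "0 < k" "1 / real j + 1 / real k \<le> 1 / real m"
    and P: "connected P" "P \<subseteq> inner_part N \<Omega> m" "x \<in> P" "y \<in> P"
  shows "\<bar>(h k x - h k y) - (h j x - h j y)\<bar> \<le> 2 * C / real j + 2 * C / real k"
proof -
  have xy: "x \<in> inner_part N \<Omega> m" "y \<in> inner_part N \<Omega> m" using P by auto
  have kj: "1 / real k + 1 / real j \<le> 1 / real m" using jk(3) by simp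
  show ?thesis
    using mollify_h_differences[OF jk P] mollify_h_close[OF jk xy(1)] mollify_h_close[OF jk xy(2)]
      mollify_h_close[OF jk(2,1) kj xy(1)] mollify_h_close[OF jk(2,1) kj xy(2)]
    by (simp add: abs_le_iff)
qed

lemma connected_in_inner_part:
  assumes "x \<in> \<Omega>" "y \<in> \<Omega>"
  obtains P m where "0 < m" "connected P" "P \<subseteq> inner_part N \<Omega> m" "x \<in> P" "y \<in> P"
proof -
  obtain \<gamma> where \<gamma>: "lipschitz_path N \<Omega> x y \<gamma>" using lipschitz_path_exists[OF domain(1,2) assms] by blast
  note p = lipschitz_path_path[OF \<gamma>]
  obtain m where m: "0 < m" "\<And>k. m \<le> k \<Longrightarrow> path_image \<gamma> \<subseteq> inner_part N \<Omega> k"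
    using compact_subset_inner_part[OF domain(1) compact_path_image[OF p(1)] p(2)] by blast
  show thesis
    by (rule that[OF m(1) connected_path_image[OF p(1)] m(2)[OF order_refl]])
      (use p pathstart_in_path_image[of \<gamma>] pathfinish_in_path_image[of \<gamma>] in auto)
qed

definition limit_potential :: "real ^ 'n \<Rightarrow> real" where
  "limit_potential x = (if x \<in> \<Omega> then lim (\<lambda>k. h k x - h k x0) else 0)"

lemma h_tendsto:
  assumes x: "x \<in> \<Omega>"
  shows "(\<lambda>k. h k x - h k x0) \<longlonglongrightarrow> limit_potential x"
proof -
  obtain P m where m: "0 < m" and P: "connected P" "P \<subseteq> inner_part N \<Omega> m" "x \<in> P" "x0 \<in> P"
    by (rule connected_in_inner_part[OF x domain(3)])
  have "Cauchy (\<lambda>k. h k x - h k x0)"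
  proof (rule CauchyI)
    fix e :: real assume e: "0 < e"
    obtain n0 :: nat where n0: "4 * C / e < real n0" using reals_Archimedean2 by blast
    define n where "n = max (2 * m) (Suc n0)"
    have "0 < n" by (simp add: n_def)
    have small: "2 * C / real k < e / 2" if "n \<le> k" for k
    proof -
      have "n0 < k" using that by (simp add: n_def)
      then have "4 * C / e < real k" using n0 by linarith
      then have "4 * C < real k * e" using e by (simp only: pos_divide_less_eq)
      then have "2 * C < e / 2 * real k" by (simp add: mult.commute)
      moreover have "0 < real k" using \<open>n0 < k\<close> by simp
      ultimately show ?thesis by (simp only: pos_divide_less_eq)
    qed
    show "\<exists>n. \<forall>k\<ge>n. \<forall>j\<ge>n. norm (h k x - h k x0 - (h j x - h j x0)) < e"
    proof (intro exI[of _ n] allI impI)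
      fix k j assume kj: "n \<le> k" "n \<le> j"
      then have "0 < j" "0 < k" "2 * m \<le> j" "2 * m \<le> k" using \<open>0 < n\<close> by (auto simp: n_def)
      then have "\<bar>(h k x - h k x0) - (h j x - h j x0)\<bar> \<le> 2 * C / real j + 2 * C / real k"
        by (intro h_differences_close[OF _ _ _ P] inverse_double_sum_le m)
      then show "norm (h k x - h k x0 - (h j x - h j x0)) < e"
        using small[OF kj(1)] small[OF kj(2)] by simp
    qed
  qed
  then have "convergent (\<lambda>k. h k x - h k x0)" by (rule Cauchy_convergent)
  then show ?thesis using x by (simp add: limit_potential_def convergent_LIMSEQ_iff)
qed

lemma h_differences_tendsto:
  assumes "x \<in> \<Omega>" "y \<in> \<Omega>"
  shows "(\<lambda>k. h k x - h k y) \<longlonglongrightarrow> limit_potential x - limit_potential y"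
  using tendsto_diff[OF h_tendsto[OF assms(1)] h_tendsto[OF assms(2)]] by simp

lemma limit_potential_base: "limit_potential x0 = 0"
  using LIMSEQ_unique[OF h_tendsto[OF domain(3)], of 0] by simp

lemma limit_potential_seg_lipschitz: "seg_lipschitz C \<Omega> limit_potential"
  unfolding seg_lipschitz_def
proof (intro conjI allI impI C_nonneg)
  fix x y assume s: "closed_segment x y \<subseteq> \<Omega>"
  have xy: "x \<in> \<Omega>" "y \<in> \<Omega>" using s by auto
  obtain m where m: "0 < m" "\<And>k. m \<le> k \<Longrightarrow> closed_segment x y \<subseteq> inner_part N \<Omega> k"
    using compact_subset_inner_part[OF domain(1) compact_segment s] by blast
  have "\<forall>\<^sub>F k in sequentially. \<bar>h k x - h k y\<bar> \<le> C * N (x - y)"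
    using eventually_ge_at_top[of m]
  proof eventually_elim
    case (elim k)
    then have "0 < k" using m by simp
    then show ?case using h_seg_lipschitz[of k] m(2)[OF elim] by (auto simp: seg_lipschitz_def)
  qed
  then show "\<bar>limit_potential x - limit_potential y\<bar> \<le> C * N (x - y)"
    by (rule tendsto_upperbound[OF tendsto_rabs[OF h_differences_tendsto[OF xy]]]) simp
qed

lemma limit_potential_measurable [measurable]: "limit_potential \<in> borel_measurable borel"
proof -
  have "(\<lambda>x. indicator \<Omega> x *\<^sub>R limit_potential x) \<in> borel_measurable borel"
    using domain(1)
    by (intro borel_measurable_continuous_on_indicator seg_lipschitz_continuous_on[OF limit_potential_seg_lipschitz]) auto
  moreover have "(\<lambda>x. indicator \<Omega> x *\<^sub>R limit_potential x) = limit_potential"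
    by (auto simp: limit_potential_def indicator_def)
  ultimately show ?thesis by simp
qed

lemma h_close_limit_potential:
  assumes j: "0 < m" "2 * m \<le> j" and P: "connected P" "P \<subseteq> inner_part N \<Omega> m" "x \<in> P" "y \<in> P"
  shows "\<bar>(limit_potential x - limit_potential y) - (h j x - h j y)\<bar> \<le> 2 * C / real j"
proof -
  have xy: "x \<in> \<Omega>" "y \<in> \<Omega>" using P inner_part_subset by blast+
  have "(\<lambda>k. \<bar>(h k x - h k y) - (h j x - h j y)\<bar>) \<longlonglongrightarrow> \<bar>(limit_potential x - limit_potential y) - (h j x - h j y)\<bar>"
    by (intro tendsto_rabs tendsto_diff[OF _ tendsto_const] h_differences_tendsto xy)
  moreover have "(\<lambda>k. 2 * C / real j + 2 * C / real k) \<longlonglongrightarrow> 2 * C / real j"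
    using tendsto_add[OF tendsto_const[of "2 * C / real j"] tendsto_mult_right[OF lim_1_over_n, of "2 * C"]] by simp
  moreover have "\<exists>n. \<forall>k\<ge>n. \<bar>(h k x - h k y) - (h j x - h j y)\<bar> \<le> 2 * C / real j + 2 * C / real k"
    using j by (intro exI[of _ "2 * m"] allI impI h_differences_close[OF _ _ _ P] inverse_double_sum_le) auto
  ultimately show ?thesis by (rule LIMSEQ_le)
qed

text \<open>
  Up to an error of order \<open>1 / j\<close>, the limit potential may be replaced by \<open>h j\<close> under the mollification
  at scale \<open>1 / i\<close>, the two mollification indices may be exchanged, and the mollification of
  \<open>h i\<close> at scale \<open>1 / j\<close> may be dropped.  The claim does not involve \<open>j\<close>, which tends to infinity.
\<close>

lemma mollify_limit_potential_differences:
  assumes i: "0 < m" "2 * m \<le> i" and sub: "nball z \<epsilon> \<subseteq> inner_part N \<Omega> m"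
    and y: "y \<in> nball z \<epsilon>" and z: "z \<in> nball z \<epsilon>"
  shows "mollify (v i) limit_potential y - mollify (v i) limit_potential z = h i y - h i z"
proof -
  let ?f = limit_potential
  have i0: "0 < i" using i by simp
  have ym: "y \<in> inner_part N \<Omega> m" "z \<in> inner_part N \<Omega> m" using y z sub by auto
  have yi: "p \<in> inner_part N \<Omega> i" if "p \<in> inner_part N \<Omega> m" for p
    using inner_part_mono[of m i \<Omega>] i that by auto
  have bound: "\<bar>(mollify (v i) ?f y - mollify (v i) ?f z) - (h i y - h i z)\<bar> \<le> 4 * C / real j"
    if j: "4 * m \<le> j" for j
  proof -
    have j0: "0 < j" "2 * m \<le> j" using i j by auto
    note ij = inverse_double_sum_le[OF i(1,2) j0(2)] and ji = inverse_double_sum_le[OF i(1) j0(2) i(2)]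
    define \<Phi> where "\<Phi> \<xi> = (?f (y + \<xi>) - ?f (z + \<xi>)) - (h j (y + \<xi>) - h j (z + \<xi>))" for \<xi>
    have [measurable]: "\<Phi> \<in> borel_measurable borel" unfolding \<Phi>_def by measurable
    have if': "integrable lborel (\<lambda>\<zeta>. v i \<zeta> * ?f (p - \<zeta>))" if "p \<in> inner_part N \<Omega> m" for p
      by (rule mollify_integrable_seg_lipschitz[OF limit_potential_seg_lipschitz i0 yi[OF that]]) measurable
    have ih: "integrable lborel (\<lambda>\<zeta>. v i \<zeta> * h j (p - \<zeta>))" if "p \<in> inner_part N \<Omega> m" for p
      by (rule mollify_integrable_seg_lipschitz[OF h_seg_lipschitz[OF j0(1)] i0 inner_part_inner_part[OF that ij]]) measurable
    have "mollify (v i) \<Phi> 0 = (mollify (v i) ?f y - mollify (v i) ?f z) - (mollify (v i) (h j) y - mollify (v i) (h j) z)"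
      using if' ih ym by (simp add: mollify_def \<Phi>_def right_diff_distrib)
    moreover have "norm (mollify (v i) \<Phi> 0) \<le> 2 * C / real j"
    proof (rule norm_mollify_le[OF kernel[OF i0]])
      fix \<zeta> assume \<zeta>: "N \<zeta> \<le> 1 / real i"
      \<comment> \<open>A displacement by \<open>\<zeta>\<close> with \<open>N \<zeta> \<le> 1 / i \<le> 1 / (2 * m)\<close> leads from \<open>\<Omega>\<^sub>m\<close> into \<open>\<Omega>\<^sub>2\<^sub>m\<close>; therefore \<open>j \<ge> 4 * m\<close>.\<close>
      have "nball (z - \<zeta>) \<epsilon> \<subseteq> inner_part N \<Omega> (2 * m)"
      proof
        fix p assume "p \<in> nball (z - \<zeta>) \<epsilon>"
        then have "p + \<zeta> \<in> inner_part N \<Omega> m" using sub by (auto simp: nball_def algebra_simps)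
        moreover have "1 / real i + 1 / real (2 * m) \<le> 1 / real m"
          by (rule inverse_double_sum_le) (use i in auto)
        ultimately show "p \<in> inner_part N \<Omega> (2 * m)"
          using inner_part_nested[of "p + \<zeta>" \<Omega> m p "1 / real i" "2 * m"] \<zeta> by simp
      qed
      moreover have "y - \<zeta> \<in> nball (z - \<zeta>) \<epsilon>" "z - \<zeta> \<in> nball (z - \<zeta>) \<epsilon>"
        using y z by (auto simp: nball_def)
      ultimately have "\<bar>(?f (y - \<zeta>) - ?f (z - \<zeta>)) - (h j (y - \<zeta>) - h j (z - \<zeta>))\<bar> \<le> 2 * C / real j"
        using j i by (intro h_close_limit_potential[of "2 * m" j "nball (z - \<zeta>) \<epsilon>"] convex_connected convex_nball) auto
      then show "norm (\<Phi> (0 - \<zeta>)) \<le> 2 * C / real j" by (simp add: \<Phi>_def)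
    qed measurable
    moreover have "mollify (v i) (h j) y - mollify (v i) (h j) z = mollify (v j) (h i) y - mollify (v j) (h i) z"
      by (rule mollify_h_differences[OF i0 j0(1) ij convex_connected[OF convex_nball] sub y z])
    moreover have "\<bar>mollify (v j) (h i) y - h i y\<bar> \<le> C / real j" "\<bar>mollify (v j) (h i) z - h i z\<bar> \<le> C / real j"
      using mollify_h_close[OF j0(1) i0 ji] ym by auto
    ultimately show ?thesis by (simp add: abs_le_iff)
  qed
  have "(\<lambda>j. 4 * C / real j) \<longlonglongrightarrow> 0" using tendsto_mult_right[OF lim_1_over_n, of "4 * C"] by simp
  then have "\<bar>(mollify (v i) ?f y - mollify (v i) ?f z) - (h i y - h i z)\<bar> \<le> 0"
    by (rule tendsto_lowerbound) (auto intro: eventually_mono[OF eventually_ge_at_top[of "4 * m"] bound])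
  then show ?thesis by simp
qed

text \<open>
  Let \<open>w\<close> be the gradient of the limit potential.  The mollifications of \<open>w\<close> and \<open>g\<close> are both gradients of
  the mollified limit potential, so they agree, and hence \<open>w = g\<close> almost everywhere.
\<close>

theorem limit_potential_gradient: "AE z in lborel. z \<in> \<Omega> \<longrightarrow> GDERIV limit_potential z :> g z"
proof -
  let ?f = limit_potential
  obtain w where [measurable]: "w \<in> borel_measurable borel" and w: "\<And>z. dual_norm N (w z) \<le> C"
    and grad: "AE z in lborel. z \<in> \<Omega> \<longrightarrow> GDERIV ?f z :> w z"
    using seg_lipschitz_AE_gradient[OF limit_potential_seg_lipschitz domain(1)] by blast
  have eq: "mollify (v i) g z = mollify (v i) w z"
    if m: "0 < m" and i: "2 * m \<le> i" and z: "z \<in> inner_part N \<Omega> m" for m i z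
  proof -
    have i0: "0 < i" using m i by simp
    have zi: "z \<in> inner_part N \<Omega> i" using inner_part_mono[of m i \<Omega>] m i z by auto
    obtain \<epsilon> where \<epsilon>: "0 < \<epsilon>" "nball z \<epsilon> \<subseteq> inner_part N \<Omega> m"
      using open_contains_nball[OF open_inner_part z] by blast
    have "((\<lambda>y. h i y + (mollify (v i) ?f z - h i z)) has_derivative (\<lambda>d. d \<bullet> mollify (v i) g z)) (at z)"
      using h_gradient[OF i0 zi] by (auto simp: gderiv_def intro!: derivative_eq_intros)
    then have "GDERIV (\<lambda>y. h i y + (mollify (v i) ?f z - h i z)) z :> mollify (v i) g z"
      by (simp add: gderiv_def)
    then have "GDERIV (mollify (v i) ?f) z :> mollify (v i) g z"
    proof (rule GDERIV_cong_open[rotated 3])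
      show "open (nball z \<epsilon>)" "z \<in> nball z \<epsilon>" using \<epsilon> by auto
      show "h i y + (mollify (v i) ?f z - h i z) = mollify (v i) ?f y" if "y \<in> nball z \<epsilon>" for y
        using mollify_limit_potential_differences[OF m i \<epsilon>(2) that] \<epsilon>(1) by simp
    qed
    moreover have "GDERIV (mollify (v i) ?f) z :> mollify (v i) w z"
      by (rule GDERIV_mollify_seg_lipschitz[OF limit_potential_seg_lipschitz i0 zi _ _ grad]) measurable
    ultimately show ?thesis by (rule GDERIV_unique)
  qed
  have "AE z in lborel. \<forall>m::nat. 0 < m \<longrightarrow> z \<in> inner_part N \<Omega> m \<longrightarrow> g z = w z"
  proof (subst AE_all_countable, rule allI)
    fix m :: nat
    show "AE z in lborel. 0 < m \<longrightarrow> z \<in> inner_part N \<Omega> m \<longrightarrow> g z = w z"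
    proof (cases "0 < m")
      case True
      have "AE z in lborel. z \<in> inner_part N \<Omega> m \<longrightarrow> g z = w z"
        by (rule AE_eq_of_mollify_eq[OF open_inner_part g_measurable g_bound _ w, where m="2 * m"])
          (use eq[OF True] in auto)
      then show ?thesis by eventually_elim simp
    qed simp
  qed
  with grad show ?thesis
  proof (eventually_elim, intro impI)
    fix z assume z: "z \<in> \<Omega> \<longrightarrow> GDERIV ?f z :> w z" "\<forall>m. 0 < m \<longrightarrow> z \<in> inner_part N \<Omega> m \<longrightarrow> g z = w z" "z \<in> \<Omega>"
    obtain m where "0 < m" "\<And>k. m \<le> k \<Longrightarrow> {z} \<subseteq> inner_part N \<Omega> k"
      using compact_subset_inner_part[OF domain(1), of "{z}"] z(3) by auto
    then show "GDERIV ?f z :> g z" using z by auto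
  qed
qed

end

section \<open>The gradient operator\<close>

locale lipschitz_domain = normed_coordinates N for N :: "real ^ 'n \<Rightarrow> real" +
  fixes \<Omega> :: "(real ^ 'n) set" and x0 :: "real ^ 'n" and u :: "real ^ 'n \<Rightarrow> real"
  assumes is_domain: "is_domain \<Omega>" and x0: "x0 \<in> \<Omega>" and mollifier: "is_mollifier N u"

sublocale lipschitz_domain \<subseteq> mollifying_sequence N "dilate u"
  by unfold_locales (rule kernel_dilate[OF mollifier])

context lipschitz_domain
begin

lemma domain: "open \<Omega>" "connected \<Omega>"
  using is_domain by (auto simp: is_domain_def)

lemma AE_lebesgue_on_domain_iff: "(AE z in lebesgue_on \<Omega>. P z) \<longleftrightarrow> (AE z in lborel. z \<in> \<Omega> \<longrightarrow> P z)"
  using domain(1) by (simp add: AE_restrict_space_iff AE_completion_iff)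

lemma Lip0_iff:
  "f \<in> Lip0 N \<Omega> x0 \<longleftrightarrow> (\<forall>x. x \<notin> \<Omega> \<longrightarrow> f x = 0) \<and> f x0 = 0 \<and> (\<exists>C. seg_lipschitz C \<Omega> f)"
proof -
  have "(\<exists>L. \<forall>x\<in>\<Omega>. \<forall>y\<in>\<Omega>. \<bar>f x - f y\<bar> \<le> L * intrinsic_dist N \<Omega> x y) \<longleftrightarrow> (\<exists>C. seg_lipschitz C \<Omega> f)"
  proof
    assume "\<exists>L. \<forall>x\<in>\<Omega>. \<forall>y\<in>\<Omega>. \<bar>f x - f y\<bar> \<le> L * intrinsic_dist N \<Omega> x y"
    then obtain L where L: "\<And>x y. x \<in> \<Omega> \<Longrightarrow> y \<in> \<Omega> \<Longrightarrow> \<bar>f x - f y\<bar> \<le> L * intrinsic_dist N \<Omega> x y" by blast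
    have "\<bar>f x - f y\<bar> \<le> max L 0 * intrinsic_dist N \<Omega> x y" if "x \<in> \<Omega>" "y \<in> \<Omega>" for x y
    proof -
      have "0 \<le> intrinsic_dist N \<Omega> x y"
        using norm_le_intrinsic_dist[OF domain that] N_nonneg[of "x - y"] by linarith
      then have "L * intrinsic_dist N \<Omega> x y \<le> max L 0 * intrinsic_dist N \<Omega> x y"
        by (intro mult_right_mono) auto
      then show ?thesis using L[OF that] by linarith
    qed
    then have "seg_lipschitz (max L 0) \<Omega> f"
      using lipschitz_intrinsic_iff_seg_lipschitz[OF domain, of "max L 0" f] by auto
    then show "\<exists>C. seg_lipschitz C \<Omega> f" by blast
  next
    assume "\<exists>C. seg_lipschitz C \<Omega> f"
    then obtain C where C: "seg_lipschitz C \<Omega> f" by blast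
    then have "0 \<le> C" by (simp add: seg_lipschitz_def)
    then show "\<exists>L. \<forall>x\<in>\<Omega>. \<forall>y\<in>\<Omega>. \<bar>f x - f y\<bar> \<le> L * intrinsic_dist N \<Omega> x y"
      using lipschitz_intrinsic_iff_seg_lipschitz[OF domain, of C f] C by blast
  qed
  then show ?thesis by (simp add: Lip0_def)
qed

lemma Lip0_measurable:
  assumes "f \<in> Lip0 N \<Omega> x0" shows "f \<in> borel_measurable borel"
proof -
  obtain C where C: "seg_lipschitz C \<Omega> f" using assms unfolding Lip0_iff by blast
  have "(\<lambda>x. indicator \<Omega> x *\<^sub>R f x) \<in> borel_measurable borel"
    using domain(1) by (intro borel_measurable_continuous_on_indicator seg_lipschitz_continuous_on[OF C]) auto
  moreover have "(\<lambda>x. indicator \<Omega> x *\<^sub>R f x) = f"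
    using assms unfolding Lip0_iff by (intro ext) (auto simp: indicator_def)
  ultimately show ?thesis by simp
qed

lemma dual_norm_measurable:
  assumes "g \<in> borel_measurable (lebesgue_on \<Omega>)"
  shows "(\<lambda>z. ereal (dual_norm N (g z))) \<in> borel_measurable (lebesgue_on \<Omega>)"
  by (intro borel_measurable_ereal measurable_compose[OF assms borel_measurable_dual_norm])

lemma ess_norm_le_iff:
  assumes g: "g \<in> borel_measurable (lebesgue_on \<Omega>)"
  shows "ess_norm N \<Omega> g \<le> ereal C \<longleftrightarrow> (AE z in lborel. z \<in> \<Omega> \<longrightarrow> dual_norm N (g z) \<le> C)"
proof
  assume le: "ess_norm N \<Omega> g \<le> ereal C"
  have "AE z in lebesgue_on \<Omega>. ereal (dual_norm N (g z)) \<le> ess_norm N \<Omega> g"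
    unfolding ess_norm_def by (rule esssup_AE)
  then have "AE z in lebesgue_on \<Omega>. dual_norm N (g z) \<le> C"
  proof eventually_elim
    case (elim z)
    then show ?case using order_trans[OF _ le] by fastforce
  qed
  then show "AE z in lborel. z \<in> \<Omega> \<longrightarrow> dual_norm N (g z) \<le> C" by (simp add: AE_lebesgue_on_domain_iff)
next
  assume "AE z in lborel. z \<in> \<Omega> \<longrightarrow> dual_norm N (g z) \<le> C"
  then have "AE z in lebesgue_on \<Omega>. ereal (dual_norm N (g z)) \<le> ereal C" by (simp add: AE_lebesgue_on_domain_iff)
  then show "ess_norm N \<Omega> g \<le> ereal C"
    unfolding ess_norm_def by (rule esssup_I[OF dual_norm_measurable[OF g]])
qed

text \<open>
  The essential supremum over a null set would be \<open>-\<infinity>\<close>; a non-empty open set is not null.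
\<close>

lemma ess_norm_nonneg:
  assumes g: "g \<in> borel_measurable (lebesgue_on \<Omega>)"
  shows "0 \<le> ess_norm N \<Omega> g"
proof (rule ccontr)
  assume "\<not> 0 \<le> ess_norm N \<Omega> g"
  then have neg: "ess_norm N \<Omega> g < 0" by simp
  have "AE z in lebesgue_on \<Omega>. ereal (dual_norm N (g z)) \<le> ess_norm N \<Omega> g"
    unfolding ess_norm_def by (rule esssup_AE)
  then have "AE z in lebesgue_on \<Omega>. False"
  proof eventually_elim
    case (elim z)
    then have "ereal (dual_norm N (g z)) < 0" using neg by (rule le_less_trans)
    then show ?case using dual_norm_nonneg[of "g z"] by simp
  qed
  then have "AE z in lborel. z \<notin> \<Omega>" by (simp add: AE_lebesgue_on_domain_iff)
  then have "AE z in lborel. z \<in> - \<Omega>" by simp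
  then have "AE z in lebesgue. z \<in> - \<Omega>" by (rule AE_completion)
  then have "x0 \<in> - \<Omega>" using domain(1) by (intro mem_closed_if_AE_lebesgue) auto
  then show False using x0 by simp
qed

lemma Linf_fun_bound:
  assumes g: "g \<in> Linf_fun N \<Omega>"
  obtains C where "0 \<le> C" "ess_norm N \<Omega> g = ereal C" "AE z in lborel. z \<in> \<Omega> \<longrightarrow> dual_norm N (g z) \<le> C"
proof -
  have m: "g \<in> borel_measurable (lebesgue_on \<Omega>)" "ess_norm N \<Omega> g < \<infinity>" using g by (auto simp: Linf_fun_def)
  then obtain C where C: "ess_norm N \<Omega> g = ereal C" "0 \<le> C"
    using ess_norm_nonneg[OF m(1)] by (cases "ess_norm N \<Omega> g") auto
  then show thesis using that ess_norm_le_iff[OF m(1), of C] by simp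
qed

lemma bounded_measurable_Linf_fun:
  assumes "w \<in> borel_measurable borel" "\<And>z. dual_norm N (w z) \<le> C"
  shows "w \<in> Linf_fun N \<Omega>"
proof -
  have "w \<in> borel_measurable (lebesgue_on \<Omega>)"
    using assms(1) by (intro measurable_restrict_space1 measurable_completion) simp
  then show ?thesis
    using ess_norm_le_iff[of w C] assms(2) by (auto simp: Linf_fun_def intro: le_less_trans)
qed

text \<open>
  An element of \<^const>\<open>Linf_fun\<close> is Lebesgue measurable on \<open>\<Omega>\<close> and bounded only essentially.  The
  Borel function \<open>w\<close>, bounded everywhere and zero off \<open>\<Omega>\<close>, is the version to which Fubini's
  theorem and the pointwise estimates for mollifications apply.
\<close>

lemma Linf_fun_borel_representative:
  assumes g: "g \<in> Linf_fun N \<Omega>" and bd: "AE z in lborel. z \<in> \<Omega> \<longrightarrow> dual_norm N (g z) \<le> C" and C: "0 \<le> C"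
  obtains w where "w \<in> borel_measurable borel" "\<And>z. dual_norm N (w z) \<le> C" "\<And>z. z \<notin> \<Omega> \<Longrightarrow> w z = 0"
    "AE z in lborel. z \<in> \<Omega> \<longrightarrow> g z = w z"
proof -
  have m: "(\<lambda>z. indicator \<Omega> z *\<^sub>R g z) \<in> borel_measurable lebesgue"
    using g domain(1) by (subst borel_measurable_restrict_space_iff[symmetric]) (auto simp: Linf_fun_def)
  have "\<exists>h. h \<in> borel_measurable lborel \<and> (AE z in lborel. (indicator \<Omega> z *\<^sub>R g z) \<bullet> e = h z)" for e
  proof -
    have "(\<lambda>z. (indicator \<Omega> z *\<^sub>R g z) \<bullet> e) \<in> borel_measurable lebesgue"
      by (intro borel_measurable_inner m borel_measurable_const)
    from completion_ex_borel_measurable_real[OF this] show ?thesis by blast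
  qed
  then have "\<exists>h. \<forall>e. h e \<in> borel_measurable lborel \<and> (AE z in lborel. (indicator \<Omega> z *\<^sub>R g z) \<bullet> e = h e z)"
    by (intro choice allI)
  then obtain h where h: "\<forall>e. h e \<in> borel_measurable lborel \<and> (AE z in lborel. (indicator \<Omega> z *\<^sub>R g z) \<bullet> e = h e z)"
    by (rule exE)
  have [measurable]: "h e \<in> borel_measurable borel" for e using h by simp
  have h_eq: "AE z in lborel. \<forall>e\<in>Basis. (indicator \<Omega> z *\<^sub>R g z) \<bullet> e = h e z"
    using h by (subst AE_ball_countable) (auto simp: countable_finite)
  define G where "G z = (\<Sum>e\<in>Basis. h e z *\<^sub>R e)" for z
  have [measurable]: "G \<in> borel_measurable borel" unfolding G_def by measurable
  have [measurable]: "\<Omega> \<in> sets borel" using domain(1) by simp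
  define w where "w z = (if z \<in> \<Omega> \<and> dual_norm N (G z) \<le> C then G z else 0)" for z
  show thesis
  proof (rule that[of w])
    show "w \<in> borel_measurable borel" unfolding w_def by measurable
    show "dual_norm N (w z) \<le> C" for z using C by (simp add: w_def dual_norm_zero)
    show "w z = 0" if "z \<notin> \<Omega>" for z using that by (simp add: w_def)
    show "AE z in lborel. z \<in> \<Omega> \<longrightarrow> g z = w z"
      using h_eq bd
    proof (eventually_elim, intro impI)
      fix z assume h: "\<forall>e\<in>Basis. (indicator \<Omega> z *\<^sub>R g z) \<bullet> e = h e z"
        and b: "z \<in> \<Omega> \<longrightarrow> dual_norm N (g z) \<le> C" and z: "z \<in> \<Omega>"
      have "G z = (\<Sum>e\<in>Basis. (g z \<bullet> e) *\<^sub>R e)"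
        unfolding G_def using h z by (intro sum.cong) auto
      then have "G z = g z" by (simp add: euclidean_representation)
      then show "g z = w z" using b z by (simp add: w_def)
    qed
  qed
qed

lemma convolve_eq_mollify:
  assumes k: "0 < k" and g: "g \<in> Linf_fun N \<Omega>" and [measurable]: "w \<in> borel_measurable borel"
    and w0: "\<And>z. z \<notin> \<Omega> \<Longrightarrow> w z = 0" and eq: "AE z in lborel. z \<in> \<Omega> \<longrightarrow> g z = w z"
  shows "convolve \<Omega> g (dilate u k) = mollify (dilate u k) w"
proof
  fix x
  note [measurable] = kernel_measurable[OF kernel[OF k]]
  have m: "(\<lambda>y. dilate u k (x - y) *\<^sub>R w y) \<in> borel_measurable lborel" by measurable
  have m': "(\<lambda>y. dilate u k (x - y) *\<^sub>R w y) \<in> borel_measurable lebesgue"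
    by (rule measurable_completion[OF m])
  have "AE y in lborel. dilate u k (x - y) *\<^sub>R w y = indicator \<Omega> y *\<^sub>R (dilate u k (x - y) *\<^sub>R g y)"
    using eq by eventually_elim (use w0 in \<open>auto simp: indicator_def\<close>)
  then have ae: "AE y in lebesgue. dilate u k (x - y) *\<^sub>R w y = indicator \<Omega> y *\<^sub>R (dilate u k (x - y) *\<^sub>R g y)"
    by (rule AE_completion)
  have "convolve \<Omega> g (dilate u k) x = (LINT y|lebesgue. indicator \<Omega> y *\<^sub>R (dilate u k (x - y) *\<^sub>R g y))"
    unfolding convolve_def using domain(1) by (intro integral_restrict_space) simp
  also have "\<dots> = (LINT y|lebesgue. dilate u k (x - y) *\<^sub>R w y)"
    by (rule integral_cong_AE[OF borel_measurable_AE[OF m' ae] m']) (use ae in \<open>auto elim: eventually_mono\<close>)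
  also have "\<dots> = mollify (dilate u k) w x"
    by (simp add: integral_completion[OF m] mollify_reflect)
  finally show "convolve \<Omega> g (dilate u k) x = mollify (dilate u k) w x" .
qed

text \<open>
  Collects what is needed to pass from a field on \<open>\<Omega>\<close>, given up to null sets, to a field on the
  whole space: both have the same mollifications, and the essential supremum becomes a supremum.
\<close>

definition borel_representative ::
    "(real ^ 'n \<Rightarrow> real ^ 'n) \<Rightarrow> (real ^ 'n \<Rightarrow> real ^ 'n) \<Rightarrow> real \<Rightarrow> bool" where
  "borel_representative g w C \<longleftrightarrow>
     ess_norm N \<Omega> g = ereal C \<and> w \<in> borel_measurable borel \<and> (\<forall>z. dual_norm N (w z) \<le> C) \<and>
     (AE z in lborel. z \<in> \<Omega> \<longrightarrow> g z = w z) \<and>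
     (\<forall>k>0. convolve \<Omega> g (dilate u k) = mollify (dilate u k) w)"

lemma borel_representativeD:
  assumes "borel_representative g w C"
  shows "ess_norm N \<Omega> g = ereal C" "w \<in> borel_measurable borel" "\<And>z. dual_norm N (w z) \<le> C"
    "AE z in lborel. z \<in> \<Omega> \<longrightarrow> g z = w z"
    "\<And>k. 0 < k \<Longrightarrow> convolve \<Omega> g (dilate u k) = mollify (dilate u k) w"
  using assms by (auto simp: borel_representative_def)

lemma borel_representative_exists:
  assumes g: "g \<in> Linf_fun N \<Omega>"
  obtains w C where "borel_representative g w C"
proof -
  obtain C where C: "0 \<le> C" "ess_norm N \<Omega> g = ereal C" "AE z in lborel. z \<in> \<Omega> \<longrightarrow> dual_norm N (g z) \<le> C"
    using Linf_fun_bound[OF g] .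
  obtain w where w: "w \<in> borel_measurable borel" "\<And>z. dual_norm N (w z) \<le> C" "\<And>z. z \<notin> \<Omega> \<Longrightarrow> w z = 0"
    "AE z in lborel. z \<in> \<Omega> \<longrightarrow> g z = w z"
    using Linf_fun_borel_representative[OF g C(3,1)] by blast
  have "convolve \<Omega> g (dilate u k) = mollify (dilate u k) w" if "0 < k" for k
    by (rule convolve_eq_mollify[OF that g w(1,3,4)])
  then have "borel_representative g w C" using C(2) w(1,2,4) by (simp add: borel_representative_def)
  then show thesis by (rule that)
qed

lemma grad_op_iff: "g \<in> grad_op N \<Omega> f \<longleftrightarrow> g \<in> Linf_fun N \<Omega> \<and> (AE z in lborel. z \<in> \<Omega> \<longrightarrow> GDERIV f z :> g z)"
  by (simp add: grad_op_def AE_lebesgue_on_domain_iff)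

lemma grad_op_nonempty:
  assumes "f \<in> Lip0 N \<Omega> x0"
  obtains g where "g \<in> grad_op N \<Omega> f"
proof -
  obtain C where C: "seg_lipschitz C \<Omega> f" using assms unfolding Lip0_iff by blast
  obtain w where "w \<in> borel_measurable borel" "\<And>z. dual_norm N (w z) \<le> C"
    "AE z in lborel. z \<in> \<Omega> \<longrightarrow> GDERIV f z :> w z"
    using seg_lipschitz_AE_gradient[OF C domain(1)] by blast
  then have "w \<in> grad_op N \<Omega> f" using bounded_measurable_Linf_fun[of w C] by (simp add: grad_op_iff)
  then show thesis by (rule that)
qed

lemma grad_op_class:
  assumes g: "g \<in> grad_op N \<Omega> f"
  shows "grad_op N \<Omega> f = ae_equal N \<Omega> `` {g}"
proof -
  have gL: "g \<in> Linf_fun N \<Omega>" and grad: "AE z in lborel. z \<in> \<Omega> \<longrightarrow> GDERIV f z :> g z"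
    using g by (auto simp: grad_op_iff)
  have iff: "(AE z in lborel. z \<in> \<Omega> \<longrightarrow> GDERIV f z :> h z) \<longleftrightarrow> (AE z in lborel. z \<in> \<Omega> \<longrightarrow> g z = h z)" for h
  proof
    assume "AE z in lborel. z \<in> \<Omega> \<longrightarrow> GDERIV f z :> h z"
    with grad show "AE z in lborel. z \<in> \<Omega> \<longrightarrow> g z = h z"
    proof (eventually_elim, intro impI)
      fix z assume "z \<in> \<Omega> \<longrightarrow> GDERIV f z :> g z" "z \<in> \<Omega> \<longrightarrow> GDERIV f z :> h z" "z \<in> \<Omega>"
      then show "g z = h z" by (intro GDERIV_unique[of f z]) simp_all
    qed
  next
    assume "AE z in lborel. z \<in> \<Omega> \<longrightarrow> g z = h z"
    with grad show "AE z in lborel. z \<in> \<Omega> \<longrightarrow> GDERIV f z :> h z"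
      by eventually_elim simp
  qed
  show ?thesis
  proof (rule set_eqI)
    fix h
    show "h \<in> grad_op N \<Omega> f \<longleftrightarrow> h \<in> ae_equal N \<Omega> `` {g}"
      unfolding grad_op_iff iff[of h] using gL by (simp add: ae_equal_def AE_lebesgue_on_domain_iff)
  qed
qed

lemma grad_op_in_Linf:
  assumes "f \<in> Lip0 N \<Omega> x0"
  shows "grad_op N \<Omega> f \<in> Linf N \<Omega>"
proof -
  obtain g where g: "g \<in> grad_op N \<Omega> f" using grad_op_nonempty[OF assms] .
  then have "g \<in> Linf_fun N \<Omega>" by (simp add: grad_op_iff)
  then show ?thesis unfolding Linf_def grad_op_class[OF g] by (rule quotientI)
qed

lemma mollify_potential:
  assumes f: "f \<in> Lip0 N \<Omega> x0" and w: "w \<in> borel_measurable borel" "\<And>z. dual_norm N (w z) \<le> C"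
    and grad: "AE z in lborel. z \<in> \<Omega> \<longrightarrow> GDERIV f z :> w z" and k: "0 < k"
  shows "\<And>x. x \<in> inner_part N \<Omega> k \<Longrightarrow> GDERIV (mollify (dilate u k) f) x :> mollify (dilate u k) w x"
    and "seg_lipschitz C (inner_part N \<Omega> k) (mollify (dilate u k) f)"
proof -
  obtain C' where C': "seg_lipschitz C' \<Omega> f" using f unfolding Lip0_iff by blast
  show g: "\<And>x. x \<in> inner_part N \<Omega> k \<Longrightarrow> GDERIV (mollify (dilate u k) f) x :> mollify (dilate u k) w x"
    by (rule GDERIV_mollify_seg_lipschitz[OF C' k _ Lip0_measurable[OF f] w(1) grad])
  show "seg_lipschitz C (inner_part N \<Omega> k) (mollify (dilate u k) f)"
    by (rule seg_lipschitz_of_gradient[OF g dual_norm_mollify_le[OF k w] order_trans[OF dual_norm_nonneg w(2)]])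
qed

lemma grad_op_in_Y_space:
  assumes f: "f \<in> Lip0 N \<Omega> x0"
  shows "grad_op N \<Omega> f \<in> Y_space N \<Omega> u"
  unfolding Y_space_def
proof (intro CollectI conjI ballI allI impI grad_op_in_Linf[OF f])
  fix g and k :: nat assume g: "g \<in> grad_op N \<Omega> f" and "1 \<le> k"
  then have k: "0 < k" by simp
  have gL: "g \<in> Linf_fun N \<Omega>" and grad: "AE z in lborel. z \<in> \<Omega> \<longrightarrow> GDERIV f z :> g z"
    using g by (auto simp: grad_op_iff)
  obtain w C where rep: "borel_representative g w C" by (rule borel_representative_exists[OF gL])
  note w = borel_representativeD(2,3)[OF rep] and eq = borel_representativeD(4)[OF rep]
    and conv = borel_representativeD(5)[OF rep]
  have gradw: "AE z in lborel. z \<in> \<Omega> \<longrightarrow> GDERIV f z :> w z"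
    using grad eq by eventually_elim auto
  obtain B where wb: "\<And>z. norm (w z) \<le> B" using norm_bound_of_dual_norm_bound[of w C] w(2) by blast
  show "conservative (inner_part N \<Omega> k) (convolve \<Omega> g (dilate u k))"
    unfolding conservative_def conv[OF k]
  proof (intro conjI exI ballI)
    show "continuous_on (inner_part N \<Omega> k) (mollify (dilate u k) w)"
      by (rule continuous_on_mollify[OF kernel[OF k] w(1) wb])
    show "GDERIV (mollify (dilate u k) f) x :> mollify (dilate u k) w x" if "x \<in> inner_part N \<Omega> k" for x
      by (rule mollify_potential(1)[OF f w gradw k that])
  qed
qed

text \<open>
  The potentials of the mollified field converge to a preimage (\<open>limit_potential_gradient\<close>).
\<close>

lemma Y_space_in_range:
  assumes G: "G \<in> Y_space N \<Omega> u"
  shows "G \<in> grad_op N \<Omega> ` Lip0 N \<Omega> x0"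
proof -
  have "G \<in> Linf N \<Omega>" using G by (simp add: Y_space_def)
  then obtain g where gL: "g \<in> Linf_fun N \<Omega>" and Gg: "G = ae_equal N \<Omega> `` {g}"
    unfolding Linf_def by (rule quotientE)
  then have "g \<in> G" by (simp add: ae_equal_def)
  then have cons: "conservative (inner_part N \<Omega> k) (convolve \<Omega> g (dilate u k))" if "0 < k" for k
    using G that by (auto simp: Y_space_def)
  obtain w C where rep: "borel_representative g w C" by (rule borel_representative_exists[OF gL])
  note w = borel_representativeD(2,3)[OF rep] and eq = borel_representativeD(4)[OF rep]
    and conv = borel_representativeD(5)[OF rep]
  have "\<exists>h. 0 < k \<longrightarrow> (\<forall>x\<in>inner_part N \<Omega> k. GDERIV h x :> mollify (dilate u k) w x)" for k
    using cons[of k] conv[of k] by (auto simp: conservative_def)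
  then have "\<exists>H. \<forall>k. 0 < k \<longrightarrow> (\<forall>x\<in>inner_part N \<Omega> k. GDERIV (H k) x :> mollify (dilate u k) w x)"
    by (intro choice allI)
  then obtain H where H: "\<forall>k. 0 < k \<longrightarrow> (\<forall>x\<in>inner_part N \<Omega> k. GDERIV (H k) x :> mollify (dilate u k) w x)"
    by (rule exE)
  \<comment> \<open>A potential is arbitrary off \<open>\<Omega>\<^sub>k\<close>; setting it to zero there makes it Borel measurable.\<close>
  define h where "h k x = (if 0 < k then indicator (inner_part N \<Omega> k) x *\<^sub>R H k x else 0)" for k x
  have "mollified_conservative_field N (dilate u) \<Omega> w C x0 h"
  proof unfold_locales
    show "open \<Omega>" "connected \<Omega>" "x0 \<in> \<Omega>" using domain x0 by auto
    show "w \<in> borel_measurable borel" "\<And>x. dual_norm N (w x) \<le> C" by (rule w)+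
    show "h k \<in> borel_measurable borel" for k
    proof (cases "0 < k")
      case True
      have "continuous_on (inner_part N \<Omega> k) (H k)"
      proof (rule continuous_at_imp_continuous_on, rule ballI)
        fix x assume "x \<in> inner_part N \<Omega> k"
        then have "GDERIV (H k) x :> mollify (dilate u k) w x" using H True by blast
        then show "isCont (H k) x" unfolding gderiv_def by (rule has_derivative_continuous)
      qed
      then have "(\<lambda>x. indicator (inner_part N \<Omega> k) x *\<^sub>R H k x) \<in> borel_measurable borel"
        using open_inner_part by (intro borel_measurable_continuous_on_indicator) auto
      then show ?thesis using True by (simp add: h_def[abs_def])
    qed (simp add: h_def[abs_def])
    fix k x assume k: "0 < k" and x: "x \<in> inner_part N \<Omega> k"
    show "GDERIV (h k) x :> mollify (dilate u k) w x"
      by (rule GDERIV_cong_open[OF open_inner_part x, of "H k"]) (use H k x in \<open>auto simp: h_def\<close>)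
  qed
  then interpret field: mollified_conservative_field N "dilate u" \<Omega> w C x0 h .
  let ?f = field.limit_potential
  have f: "?f \<in> Lip0 N \<Omega> x0"
    using field.limit_potential_seg_lipschitz field.limit_potential_base
    by (auto simp: Lip0_iff field.limit_potential_def)
  have "AE z in lborel. z \<in> \<Omega> \<longrightarrow> GDERIV ?f z :> g z"
    using field.limit_potential_gradient eq by eventually_elim auto
  then have "g \<in> grad_op N \<Omega> ?f" using gL by (simp add: grad_op_iff)
  then have "grad_op N \<Omega> ?f = G" unfolding Gg by (rule grad_op_class)
  then show ?thesis using f by blast
qed

lemma inj_on_grad_op: "inj_on (grad_op N \<Omega>) (Lip0 N \<Omega> x0)"
proof (rule inj_onI)
  fix f h assume f: "f \<in> Lip0 N \<Omega> x0" and h: "h \<in> Lip0 N \<Omega> x0" and eq: "grad_op N \<Omega> f = grad_op N \<Omega> h"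
  obtain g where g: "g \<in> grad_op N \<Omega> f" using grad_op_nonempty[OF f] .
  then have gh: "g \<in> grad_op N \<Omega> h" using eq by simp
  have gL: "g \<in> Linf_fun N \<Omega>" using g by (simp add: grad_op_iff)
  obtain w C where rep: "borel_representative g w C" by (rule borel_representative_exists[OF gL])
  note w = borel_representativeD(2,3)[OF rep] and ew = borel_representativeD(4)[OF rep]
  have df: "AE z in lborel. z \<in> \<Omega> \<longrightarrow> GDERIV f z :> w z"
    using g ew unfolding grad_op_iff by (auto elim: eventually_elim2)
  have dh: "AE z in lborel. z \<in> \<Omega> \<longrightarrow> GDERIV h z :> w z"
    using gh ew unfolding grad_op_iff by (auto elim: eventually_elim2)
  obtain Cf Ch where C: "seg_lipschitz Cf \<Omega> f" "seg_lipschitz Ch \<Omega> h" using f h unfolding Lip0_iff by blast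
  show "f = h"
  proof
    fix x
    show "f x = h x"
    proof (cases "x \<in> \<Omega>")
      case True
      have "f x - f x0 = h x - h x0"
        by (rule seg_lipschitz_eq_of_gradient_eq[OF domain C(1) Lip0_measurable[OF f] C(2) Lip0_measurable[OF h] w(1) df dh True x0])
      then show ?thesis using f h by (simp add: Lip0_iff)
    qed (use f h in \<open>simp add: Lip0_iff\<close>)
  qed
qed

lemma grad_op_image: "grad_op N \<Omega> ` Lip0 N \<Omega> x0 = Y_space N \<Omega> u"
  using grad_op_in_Y_space Y_space_in_range by blast

text \<open>
  The integral along \<open>\<gamma>\<close> is the difference of the mollification of \<open>f\<close> at the two end points, which
  converges to \<open>f x - f x0\<close>.
\<close>

lemma path_integrals_tendsto:
  assumes f: "f \<in> Lip0 N \<Omega> x0" and g: "g \<in> grad_op N \<Omega> f" and x: "x \<in> \<Omega>" and \<gamma>: "lipschitz_path N \<Omega> x0 x \<gamma>"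
  shows "\<forall>\<^sub>F k in sequentially. \<gamma> ` {0..1} \<subseteq> inner_part N \<Omega> k \<and>
      integrable (lebesgue_on {0..1}) (path_integrand (convolve \<Omega> g (dilate u k)) \<gamma>)" (is ?A)
    and "(\<lambda>k. LINT t|lebesgue_on {0..1}. path_integrand (convolve \<Omega> g (dilate u k)) \<gamma> t) \<longlonglongrightarrow> f x" (is ?B)
proof -
  have gL: "g \<in> Linf_fun N \<Omega>" using g by (simp add: grad_op_iff)
  obtain w C where rep: "borel_representative g w C" by (rule borel_representative_exists[OF gL])
  note w = borel_representativeD(2,3)[OF rep] and ew = borel_representativeD(4)[OF rep]
    and conv = borel_representativeD(5)[OF rep]
  have df: "AE z in lborel. z \<in> \<Omega> \<longrightarrow> GDERIV f z :> w z"
    using g ew unfolding grad_op_iff by (auto elim: eventually_elim2)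
  obtain Cf where Cf: "seg_lipschitz Cf \<Omega> f" using f unfolding Lip0_iff by blast
  have f0: "f x0 = 0" using f by (simp add: Lip0_iff)
  note p = lipschitz_path_path[OF \<gamma>]
  obtain m where m: "0 < m" "\<And>k. m \<le> k \<Longrightarrow> path_image \<gamma> \<subseteq> inner_part N \<Omega> k"
    using compact_subset_inner_part[OF domain(1) compact_path_image[OF p(1)] p(2)] by blast
  have main: "\<gamma> ` {0..1} \<subseteq> inner_part N \<Omega> k \<and>
      integrable (lebesgue_on {0..1}) (path_integrand (convolve \<Omega> g (dilate u k)) \<gamma>) \<and>
      (LINT t|lebesgue_on {0..1}. path_integrand (convolve \<Omega> g (dilate u k)) \<gamma> t)
        = mollify (dilate u k) f x - mollify (dilate u k) f x0" if "m \<le> k" for k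
  proof -
    have k: "0 < k" using m(1) that by simp
    have sub: "\<gamma> ` {0..1} \<subseteq> inner_part N \<Omega> k" using m(2)[OF that] by (simp add: path_image_def)
    then have \<gamma>k: "lipschitz_path N (inner_part N \<Omega> k) x0 x \<gamma>" using \<gamma> by (simp add: lipschitz_path_def)
    note P = mollify_potential[OF f w df k]
    show ?thesis
      unfolding conv[OF k]
      using sub path_integral_of_gradient[OF P(2) open_inner_part P(1) \<gamma>k] by simp
  qed
  show ?A using eventually_ge_at_top[of m] by eventually_elim (use main in blast)
  have "(\<lambda>k. mollify (dilate u k) f x - mollify (dilate u k) f x0) \<longlonglongrightarrow> f x - f x0"
    by (intro tendsto_diff mollify_seg_lipschitz_tendsto[OF Cf domain(1) _ Lip0_measurable[OF f]] x x0)
  moreover have "\<forall>\<^sub>F k in sequentially. mollify (dilate u k) f x - mollify (dilate u k) f x0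
      = (LINT t|lebesgue_on {0..1}. path_integrand (convolve \<Omega> g (dilate u k)) \<gamma> t)"
    using eventually_ge_at_top[of m] by eventually_elim (simp add: main)
  ultimately have "(\<lambda>k. LINT t|lebesgue_on {0..1}. path_integrand (convolve \<Omega> g (dilate u k)) \<gamma> t) \<longlonglongrightarrow> f x - f x0"
    by (rule Lim_transform_eventually)
  then show ?B by (simp add: f0)
qed

lemma grad_op_add:
  assumes f: "f \<in> Lip0 N \<Omega> x0" and h: "h \<in> Lip0 N \<Omega> x0"
  shows "grad_op N \<Omega> (\<lambda>x. f x + h x) = Linf_add N \<Omega> (grad_op N \<Omega> f) (grad_op N \<Omega> h)"
proof (intro set_eqI iffI)
  fix w assume w: "w \<in> grad_op N \<Omega> (\<lambda>x. f x + h x)"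
  obtain a where a: "a \<in> grad_op N \<Omega> f" using grad_op_nonempty[OF f] .
  obtain b where b: "b \<in> grad_op N \<Omega> h" using grad_op_nonempty[OF h] .
  have "AE z in lborel. z \<in> \<Omega> \<longrightarrow> GDERIV f z :> a z" "AE z in lborel. z \<in> \<Omega> \<longrightarrow> GDERIV h z :> b z"
    "AE z in lborel. z \<in> \<Omega> \<longrightarrow> GDERIV (\<lambda>x. f x + h x) z :> w z"
    using a b w by (auto simp: grad_op_iff)
  then have "AE z in lborel. z \<in> \<Omega> \<longrightarrow> w z = a z + b z"
  proof (eventually_elim, intro impI)
    fix z assume "z \<in> \<Omega> \<longrightarrow> GDERIV f z :> a z" "z \<in> \<Omega> \<longrightarrow> GDERIV h z :> b z"
      "z \<in> \<Omega> \<longrightarrow> GDERIV (\<lambda>x. f x + h x) z :> w z" "z \<in> \<Omega>"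
    then show "w z = a z + b z"
      by (intro GDERIV_unique[of "\<lambda>x. f x + h x" z] GDERIV_add) simp_all
  qed
  then show "w \<in> Linf_add N \<Omega> (grad_op N \<Omega> f) (grad_op N \<Omega> h)"
    using a b w[unfolded grad_op_iff] unfolding Linf_add_def AE_lebesgue_on_domain_iff by blast
next
  fix w assume "w \<in> Linf_add N \<Omega> (grad_op N \<Omega> f) (grad_op N \<Omega> h)"
  then obtain a b where w: "w \<in> Linf_fun N \<Omega>" and a: "a \<in> grad_op N \<Omega> f" and b: "b \<in> grad_op N \<Omega> h"
    and eq: "AE z in lborel. z \<in> \<Omega> \<longrightarrow> w z = a z + b z"
    unfolding Linf_add_def AE_lebesgue_on_domain_iff by blast
  have "AE z in lborel. z \<in> \<Omega> \<longrightarrow> GDERIV f z :> a z" "AE z in lborel. z \<in> \<Omega> \<longrightarrow> GDERIV h z :> b z"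
    using a b by (auto simp: grad_op_iff)
  then have "AE z in lborel. z \<in> \<Omega> \<longrightarrow> GDERIV (\<lambda>x. f x + h x) z :> w z"
    using eq by eventually_elim (simp add: GDERIV_add)
  then show "w \<in> grad_op N \<Omega> (\<lambda>x. f x + h x)" using w by (simp add: grad_op_iff)
qed

lemma grad_op_scale:
  assumes f: "f \<in> Lip0 N \<Omega> x0"
  shows "grad_op N \<Omega> (\<lambda>x. c * f x) = Linf_scale N \<Omega> c (grad_op N \<Omega> f)"
proof (intro set_eqI iffI)
  fix w assume w: "w \<in> grad_op N \<Omega> (\<lambda>x. c * f x)"
  obtain a where a: "a \<in> grad_op N \<Omega> f" using grad_op_nonempty[OF f] .
  have "AE z in lborel. z \<in> \<Omega> \<longrightarrow> GDERIV f z :> a z" "AE z in lborel. z \<in> \<Omega> \<longrightarrow> GDERIV (\<lambda>x. c * f x) z :> w z"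
    using a w by (auto simp: grad_op_iff)
  then have "AE z in lborel. z \<in> \<Omega> \<longrightarrow> w z = c *\<^sub>R a z"
  proof (eventually_elim, intro impI)
    fix z assume "z \<in> \<Omega> \<longrightarrow> GDERIV f z :> a z" "z \<in> \<Omega> \<longrightarrow> GDERIV (\<lambda>x. c * f x) z :> w z" "z \<in> \<Omega>"
    then show "w z = c *\<^sub>R a z"
      by (intro GDERIV_unique[of "\<lambda>x. c * f x" z] GDERIV_cmult) simp_all
  qed
  then show "w \<in> Linf_scale N \<Omega> c (grad_op N \<Omega> f)"
    using a w[unfolded grad_op_iff] unfolding Linf_scale_def AE_lebesgue_on_domain_iff by blast
next
  fix w assume "w \<in> Linf_scale N \<Omega> c (grad_op N \<Omega> f)"
  then obtain a where w: "w \<in> Linf_fun N \<Omega>" and a: "a \<in> grad_op N \<Omega> f"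
    and eq: "AE z in lborel. z \<in> \<Omega> \<longrightarrow> w z = c *\<^sub>R a z"
    unfolding Linf_scale_def AE_lebesgue_on_domain_iff by blast
  have "AE z in lborel. z \<in> \<Omega> \<longrightarrow> GDERIV f z :> a z" using a by (auto simp: grad_op_iff)
  then have "AE z in lborel. z \<in> \<Omega> \<longrightarrow> GDERIV (\<lambda>x. c * f x) z :> w z"
    using eq by eventually_elim (simp add: GDERIV_cmult)
  then show "w \<in> grad_op N \<Omega> (\<lambda>x. c * f x)" using w by (simp add: grad_op_iff)
qed

lemma
  assumes C: "seg_lipschitz C \<Omega> f"
  shows Lip_norm_nonneg: "0 \<le> Lip_norm N \<Omega> f"
    and Lip_norm_le_iff: "0 \<le> K \<Longrightarrow> Lip_norm N \<Omega> f \<le> K \<longleftrightarrow> seg_lipschitz K \<Omega> f"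
proof -
  define S where "S = {\<bar>f x - f y\<bar> / intrinsic_dist N \<Omega> x y | x y. x \<in> \<Omega> \<and> y \<in> \<Omega> \<and> x \<noteq> y}"
  have S: "Lip_norm N \<Omega> f = Sup S" by (simp add: Lip_norm_def S_def)
  have d: "0 < intrinsic_dist N \<Omega> x y" if "x \<in> \<Omega>" "y \<in> \<Omega>" "x \<noteq> y" for x y
  proof -
    have "0 < N (x - y)" using N_nonneg[of "x - y"] that(3) by (simp add: less_eq_real_def)
    then show ?thesis using norm_le_intrinsic_dist[OF domain that(1,2)] by linarith
  qed
  have le: "s \<le> B" if B: "seg_lipschitz B \<Omega> f" and s: "s \<in> S" for s B
  proof -
    obtain x y where xy: "x \<in> \<Omega>" "y \<in> \<Omega>" "x \<noteq> y" "s = \<bar>f x - f y\<bar> / intrinsic_dist N \<Omega> x y"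
      using s unfolding S_def by blast
    have "0 \<le> B" using B by (simp add: seg_lipschitz_def)
    then have "\<bar>f x - f y\<bar> \<le> B * intrinsic_dist N \<Omega> x y"
      using lipschitz_intrinsic_iff_seg_lipschitz[OF domain, of B f] B xy by blast
    then show ?thesis using d[OF xy(1-3)] xy(4) by (simp add: divide_le_eq)
  qed
  have "\<Omega> \<noteq> {x0}" using domain(1) not_open_singleton[of x0] by auto
  then obtain y where y: "y \<in> \<Omega>" "y \<noteq> x0" using x0 by blast
  then have elem: "\<bar>f y - f x0\<bar> / intrinsic_dist N \<Omega> y x0 \<in> S" unfolding S_def using x0 by blast
  then have ne: "S \<noteq> {}" by blast
  have bdd: "bdd_above S" using le[OF C] by (rule bdd_aboveI)
  have "0 \<le> \<bar>f y - f x0\<bar> / intrinsic_dist N \<Omega> y x0" using d[OF y(1) x0 y(2)] by simp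
  also have "\<dots> \<le> Lip_norm N \<Omega> f" unfolding S by (rule cSup_upper[OF elem bdd])
  finally show "0 \<le> Lip_norm N \<Omega> f" .
  show "Lip_norm N \<Omega> f \<le> K \<longleftrightarrow> seg_lipschitz K \<Omega> f" if K: "0 \<le> K"
  proof
    assume "Lip_norm N \<Omega> f \<le> K"
    then have K': "Sup S \<le> K" by (simp add: S)
    have "\<bar>f x - f y\<bar> \<le> K * intrinsic_dist N \<Omega> x y" if xy: "x \<in> \<Omega>" "y \<in> \<Omega>" for x y
    proof (cases "x = y")
      case True
      then show ?thesis using K norm_le_intrinsic_dist[OF domain xy] by simp
    next
      case False
      then have "\<bar>f x - f y\<bar> / intrinsic_dist N \<Omega> x y \<in> S" unfolding S_def using xy by blast
      then have "\<bar>f x - f y\<bar> / intrinsic_dist N \<Omega> x y \<le> K"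
        using cSup_upper[OF _ bdd] K' by (meson order_trans)
      then show ?thesis using d[OF xy False] by (simp add: divide_le_eq)
    qed
    then show "seg_lipschitz K \<Omega> f" using lipschitz_intrinsic_iff_seg_lipschitz[OF domain K, of f] by blast
  next
    assume "seg_lipschitz K \<Omega> f"
    then show "Lip_norm N \<Omega> f \<le> K" unfolding S using le by (intro cSup_least[OF ne]) blast
  qed
qed

text \<open>
  Both norms are the least constant \<open>C\<close> for which \<open>f\<close> is Lipschitz along segments: mollification
  turns an almost everywhere bound on the gradient into such a constant, and differentiation turns
  the constant into a bound on the gradient.
\<close>

theorem grad_op_isometry:
  assumes f: "f \<in> Lip0 N \<Omega> x0"
  shows "Linf_norm N \<Omega> (grad_op N \<Omega> f) = Lip_norm N \<Omega> f"
proof -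
  define g where "g = (SOME g. g \<in> grad_op N \<Omega> f)"
  obtain g' where "g' \<in> grad_op N \<Omega> f" using grad_op_nonempty[OF f] .
  then have g: "g \<in> grad_op N \<Omega> f" unfolding g_def by (rule someI[of "\<lambda>g. g \<in> grad_op N \<Omega> f"])
  have gL: "g \<in> Linf_fun N \<Omega>" and gm: "g \<in> borel_measurable (lebesgue_on \<Omega>)"
    and grad: "AE z in lborel. z \<in> \<Omega> \<longrightarrow> GDERIV f z :> g z"
    using g by (auto simp: grad_op_iff Linf_fun_def)
  obtain C where C: "seg_lipschitz C \<Omega> f" using f unfolding Lip0_iff by blast
  obtain w c where rep: "borel_representative g w c" by (rule borel_representative_exists[OF gL])
  note c = borel_representativeD(1)[OF rep] and w = borel_representativeD(2,3)[OF rep]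
    and ew = borel_representativeD(4)[OF rep]
  have df: "AE z in lborel. z \<in> \<Omega> \<longrightarrow> GDERIV f z :> w z"
    using grad ew by eventually_elim auto
  have c0: "0 \<le> c" using order_trans[OF dual_norm_nonneg w(2)] .
  have "seg_lipschitz c \<Omega> f"
    by (rule seg_lipschitz_of_gradient_bound[OF domain(1) C Lip0_measurable[OF f] w df])
  then have "Lip_norm N \<Omega> f \<le> c" using Lip_norm_le_iff[OF C c0] by blast
  moreover have "c \<le> Lip_norm N \<Omega> f"
  proof -
    have L: "seg_lipschitz (Lip_norm N \<Omega> f) \<Omega> f"
      using Lip_norm_le_iff[OF C Lip_norm_nonneg[OF C]] by blast
    have "AE z in lborel. z \<in> \<Omega> \<longrightarrow> dual_norm N (g z) \<le> Lip_norm N \<Omega> f"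
      using grad by eventually_elim (use dual_norm_gradient_le[OF L domain(1)] in blast)
    then have "ess_norm N \<Omega> g \<le> ereal (Lip_norm N \<Omega> f)" using ess_norm_le_iff[OF gm] by blast
    then show ?thesis using c by simp
  qed
  ultimately show ?thesis by (simp add: Linf_norm_def c flip: g_def)
qed

end

theorem theorem3p4:
  fixes N :: "real ^ 'n \<Rightarrow> real"
    and \<Omega> :: "(real ^ 'n) set"
    and x0 :: "real ^ 'n"
    and u :: "real ^ 'n \<Rightarrow> real"
  assumes "is_norm N"
    and "is_domain \<Omega>"
    and "x0 \<in> \<Omega>"
    and "is_mollifier N u"
  shows
    "grad_op N \<Omega> ` Lip0 N \<Omega> x0 = Y_space N \<Omega> u
     \<and>
     inj_on (grad_op N \<Omega>) (Lip0 N \<Omega> x0) \<and>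
     (\<forall>x\<in>\<Omega>. \<exists>\<gamma>. lipschitz_path N \<Omega> x0 x \<gamma>) \<and>
     (\<forall>G\<in>Y_space N \<Omega> u. \<forall>g\<in>G. \<forall>x\<in>\<Omega>. \<forall>\<gamma>. lipschitz_path N \<Omega> x0 x \<gamma> \<longrightarrow>
        (\<forall>\<^sub>F k in sequentially.
           \<gamma> ` {0..1} \<subseteq> inner_part N \<Omega> k \<and>
           integrable (lebesgue_on {0..1}) (path_integrand (convolve \<Omega> g (dilate u k)) \<gamma>)) \<and>
        (\<lambda>k. LINT t|lebesgue_on {0..1}. path_integrand (convolve \<Omega> g (dilate u k)) \<gamma> t)
          \<longlonglongrightarrow> the_inv_into (Lip0 N \<Omega> x0) (grad_op N \<Omega>) G x)
     \<and>
     bij_betw (grad_op N \<Omega>) (Lip0 N \<Omega> x0) (Y_space N \<Omega> u) \<and>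
     (\<forall>f\<in>Lip0 N \<Omega> x0. \<forall>h\<in>Lip0 N \<Omega> x0.
        grad_op N \<Omega> (\<lambda>x. f x + h x) = Linf_add N \<Omega> (grad_op N \<Omega> f) (grad_op N \<Omega> h)) \<and>
     (\<forall>c. \<forall>f\<in>Lip0 N \<Omega> x0.
        grad_op N \<Omega> (\<lambda>x. c * f x) = Linf_scale N \<Omega> c (grad_op N \<Omega> f)) \<and>
     (\<forall>f\<in>Lip0 N \<Omega> x0. Linf_norm N \<Omega> (grad_op N \<Omega> f) = Lip_norm N \<Omega> f)"
proof -
  interpret lipschitz_domain N \<Omega> x0 u
    using assms by unfold_locales
  have paths: "\<forall>x\<in>\<Omega>. \<exists>\<gamma>. lipschitz_path N \<Omega> x0 x \<gamma>"
    using lipschitz_path_exists[OF domain x0] by blast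
  have inverse: "(\<forall>\<^sub>F k in sequentially.
           \<gamma> ` {0..1} \<subseteq> inner_part N \<Omega> k \<and>
           integrable (lebesgue_on {0..1}) (path_integrand (convolve \<Omega> g (dilate u k)) \<gamma>)) \<and>
        (\<lambda>k. LINT t|lebesgue_on {0..1}. path_integrand (convolve \<Omega> g (dilate u k)) \<gamma> t)
          \<longlonglongrightarrow> the_inv_into (Lip0 N \<Omega> x0) (grad_op N \<Omega>) G x"
    if G: "G \<in> Y_space N \<Omega> u" and g: "g \<in> G" and x: "x \<in> \<Omega>" and \<gamma>: "lipschitz_path N \<Omega> x0 x \<gamma>" for G g x \<gamma>
  proof -
    obtain f where f: "f \<in> Lip0 N \<Omega> x0" and Gf: "G = grad_op N \<Omega> f" using Y_space_in_range[OF G] by blast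
    have "the_inv_into (Lip0 N \<Omega> x0) (grad_op N \<Omega>) G = f"
      unfolding Gf by (rule the_inv_into_f_f[OF inj_on_grad_op f])
    then show ?thesis using path_integrals_tendsto[OF f g[unfolded Gf] x \<gamma>] by simp
  qed
  show ?thesis
  proof (intro conjI)
    show "grad_op N \<Omega> ` Lip0 N \<Omega> x0 = Y_space N \<Omega> u" by (rule grad_op_image)
    show "inj_on (grad_op N \<Omega>) (Lip0 N \<Omega> x0)" by (rule inj_on_grad_op)
    show "bij_betw (grad_op N \<Omega>) (Lip0 N \<Omega> x0) (Y_space N \<Omega> u)"
      using inj_on_grad_op grad_op_image by (simp add: bij_betw_def)
  qed (intro paths inverse grad_op_add grad_op_scale grad_op_isometry ballI allI impI; assumption)+
qed

end
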